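(* Let $n$ and $d$ be positive integers and let $q$ be a prime power. (i) If $q>4\left(d(d-1)/2+1\right)$, then there is an $(n,q,d)$-perfect hash family of size $$O\left(\frac{d^2\log n}{\log\left(q/\left(e\,(d(d-1)/2+1)\right)\right)}\right)$$ that can be constructed in linear time. (ii) If $d(d-1)/2+2\le q\le 4\left(d(d-1)/2+1\right)$, then there is an $(n,q,d)$-perfect hash family of size $$O\left(\frac{q^2d^2\log n}{(q-d(d-1)/2-1)^2}\right)$$ that can be constructed in linear time. In particular, for any constants $c>1$, $\delta>0$ and $0\le\eta<1$, and for all $n$, the following $(n,q,d)$-perfect hash families can be constructed in linear time: - if $q\ge d^{2+\delta}$: size $O\left(d^2\frac{\log n}{\log q}\right)$; - if $q\ge \frac{c}{2}d^2$: size $O(d^2\log n)$; - if $q=\frac{d(d-1)}{2}+1+d^{2\eta}$: size $O(d^{6-4\eta}\log n)$; - if $q=\frac{d(d-1)}{2}+2$: size $O\left(d^6\frac{\log n}{\log d}\right)$.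
   Context: For $d\le q$, a family $H$ of functions $h:[n]\to[q]$ is an $(n,q,d)$-perfect hash family ($(n,q,d)$-PHF) if for every subset $S\subseteq[n]$ with $|S|=d$ there is $h\in H$ whose restriction to $S$ is injective. The size of the family is $|H|$. "Constructed in linear time" means there is a deterministic algorithm that outputs the family in time linear in the size of its description (the number of functions times $n$). *)

theory Defs
  imports
    Complex_Main
    "HOL-Library.FuncSet"
    "HOL-Number_Theory.Prime_Powers"
begin

section \<open>Perfect hash families\<close>

text \<open>A family is an indexed family, given as a list, so its size is the length of the list.
  The sets \<open>[n]\<close> and \<open>[q]\<close> are \<open>{..<n}\<close> and \<open>{..<q}\<close>; only the values of the functions
  on \<open>{..<n}\<close> matter.\<close>

definition perfect_hash_family :: "nat \<Rightarrow> nat \<Rightarrow> nat \<Rightarrow> (nat \<Rightarrow> nat) list \<Rightarrow> bool" where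
  "perfect_hash_family n q d H \<longleftrightarrow>
     d \<le> q \<and> set H \<subseteq> {..<n} \<rightarrow> {..<q} \<and>
     (\<forall>S. S \<subseteq> {..<n} \<and> card S = d \<longrightarrow> (\<exists>h\<in>set H. inj_on h S))"


section \<open>A word RAM\<close>

text \<open>Structured programs over natural-number words, with finitely many scalar variables and
  arrays per program (all other variables are never touched) and an append-only output.
  Each assignment, store, output and test takes unit time; as the expressions of a fixed
  program have bounded size, charging every arithmetic operation and memory access
  separately would change running times by at most a constant factor.\<close>

type_synonym vname = string

record state =
  vars :: "vname \<Rightarrow> nat"
  arrs :: "vname \<Rightarrow> nat \<Rightarrow> nat"
  outp :: "nat list"

datatype aexp =
    Const nat
  | Var vname
  | Elem vname aexp
  | Plus aexp aexp
  | Minus aexp aexp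
  | Times aexp aexp
  | Div aexp aexp
  | Mod aexp aexp

datatype bexp =
    Less aexp aexp
  | Neg bexp
  | Conj bexp bexp

datatype com =
    Skip
  | Assign vname aexp
  | Store vname aexp aexp
  | Emit aexp
  | Seq com com
  | Cond bexp com com
  | While bexp com

fun aval :: "aexp \<Rightarrow> state \<Rightarrow> nat" where
  "aval (Const k) s = k"
| "aval (Var x) s = vars s x"
| "aval (Elem a e) s = arrs s a (aval e s)"
| "aval (Plus e f) s = aval e s + aval f s"
| "aval (Minus e f) s = aval e s - aval f s"
| "aval (Times e f) s = aval e s * aval f s"
| "aval (Div e f) s = aval e s div aval f s"
| "aval (Mod e f) s = aval e s mod aval f s"

fun bval :: "bexp \<Rightarrow> state \<Rightarrow> bool" where
  "bval (Less e f) s \<longleftrightarrow> aval e s < aval f s"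
| "bval (Neg b) s \<longleftrightarrow> \<not> bval b s"
| "bval (Conj b c) s \<longleftrightarrow> bval b s \<and> bval c s"

text \<open>Every value arising in an evaluation, intermediate results and array indices included,
  has to be a word, that is, smaller than \<open>W\<close>. An execution that would leave this range is
  stuck: it has no final state.\<close>

fun afits :: "nat \<Rightarrow> aexp \<Rightarrow> state \<Rightarrow> bool" where
  "afits W (Const k) s \<longleftrightarrow> k < W"
| "afits W (Var x) s \<longleftrightarrow> vars s x < W"
| "afits W (Elem a e) s \<longleftrightarrow> afits W e s \<and> arrs s a (aval e s) < W"
| "afits W (Plus e f) s \<longleftrightarrow> afits W e s \<and> afits W f s \<and> aval e s + aval f s < W"
| "afits W (Minus e f) s \<longleftrightarrow> afits W e s \<and> afits W f s"
| "afits W (Times e f) s \<longleftrightarrow> afits W e s \<and> afits W f s \<and> aval e s * aval f s < W"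
| "afits W (Div e f) s \<longleftrightarrow> afits W e s \<and> afits W f s"
| "afits W (Mod e f) s \<longleftrightarrow> afits W e s \<and> afits W f s"

fun bfits :: "nat \<Rightarrow> bexp \<Rightarrow> state \<Rightarrow> bool" where
  "bfits W (Less e f) s \<longleftrightarrow> afits W e s \<and> afits W f s"
| "bfits W (Neg b) s \<longleftrightarrow> bfits W b s"
| "bfits W (Conj b c) s \<longleftrightarrow> bfits W b s \<and> bfits W c s"

lemma aval_less_if_afits: "afits W e s \<Longrightarrow> aval e s < W"
proof (induction e)
  case (Minus e f)
  then show ?case by (auto intro: le_less_trans[OF diff_le_self])
next
  case (Div e f)
  then show ?case by (auto intro: le_less_trans[OF div_le_dividend])
next
  case (Mod e f)
  then show ?case by (auto intro: le_less_trans[OF mod_less_eq_dividend])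
qed auto

text \<open>\<open>exec W c s t s'\<close>: with word range \<open>{..<W}\<close>, program \<open>c\<close> started in \<open>s\<close> halts
  in \<open>s'\<close> after \<open>t\<close> steps.\<close>

inductive exec :: "nat \<Rightarrow> com \<Rightarrow> state \<Rightarrow> nat \<Rightarrow> state \<Rightarrow> bool" for W :: nat where
  Skip: "exec W Skip s 1 s"
| Assign: "afits W e s \<Longrightarrow>
    exec W (Assign x e) s 1 (s\<lparr>vars := (vars s)(x := aval e s)\<rparr>)"
| Store: "afits W i s \<Longrightarrow> afits W e s \<Longrightarrow>
    exec W (Store a i e) s 1 (s\<lparr>arrs := (arrs s)(a := (arrs s a)(aval i s := aval e s))\<rparr>)"
| Emit: "afits W e s \<Longrightarrow>
    exec W (Emit e) s 1 (s\<lparr>outp := outp s @ [aval e s]\<rparr>)"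
| Seq: "exec W c1 s t1 s1 \<Longrightarrow> exec W c2 s1 t2 s2 \<Longrightarrow>
    exec W (Seq c1 c2) s (t1 + t2) s2"
| CondTrue: "bfits W b s \<Longrightarrow> bval b s \<Longrightarrow> exec W c1 s t s1 \<Longrightarrow>
    exec W (Cond b c1 c2) s (1 + t) s1"
| CondFalse: "bfits W b s \<Longrightarrow> \<not> bval b s \<Longrightarrow> exec W c2 s t s1 \<Longrightarrow>
    exec W (Cond b c1 c2) s (1 + t) s1"
| WhileFalse: "bfits W b s \<Longrightarrow> \<not> bval b s \<Longrightarrow>
    exec W (While b c) s 1 s"
| WhileTrue: "bfits W b s \<Longrightarrow> bval b s \<Longrightarrow> exec W c s t1 s1 \<Longrightarrow>
    exec W (While b c) s1 t2 s2 \<Longrightarrow>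
    exec W (While b c) s (1 + t1 + t2) s2"

inductive_cases exec_SkipE: "exec W Skip s t s'"
inductive_cases exec_AssignE: "exec W (Assign x e) s t s'"
inductive_cases exec_StoreE: "exec W (Store a i e) s t s'"
inductive_cases exec_EmitE: "exec W (Emit e) s t s'"
inductive_cases exec_SeqE: "exec W (Seq c1 c2) s t s'"
inductive_cases exec_CondE: "exec W (Cond b c1 c2) s t s'"
inductive_cases exec_WhileE: "exec W (While b c) s t s'"

lemma exec_deterministic:
  "exec W c s t s' \<Longrightarrow> exec W c s u s'' \<Longrightarrow> t = u \<and> s' = s''"
proof (induction arbitrary: u s'' rule: exec.induct)
  case (Seq c1 s t1 s1 c2 t2 s2)
  from Seq.prems obtain u1 r u2
    where u: "u = u1 + u2" and *: "exec W c1 s u1 r" "exec W c2 r u2 s''"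
    by (rule exec_SeqE)
  from Seq.IH(1)[OF *(1)] have "t1 = u1" "s1 = r" by simp_all
  with Seq.IH(2) *(2) u show ?case by simp
next
  case (CondTrue b s c1 t s1 c2)
  from CondTrue.prems CondTrue.hyps obtain u1
    where u: "u = 1 + u1" and *: "exec W c1 s u1 s''"
    by (auto elim: exec_CondE)
  from CondTrue.IH[OF *] u show ?case by simp
next
  case (CondFalse b s c2 t s1 c1)
  from CondFalse.prems CondFalse.hyps obtain u1
    where u: "u = 1 + u1" and *: "exec W c2 s u1 s''"
    by (auto elim: exec_CondE)
  from CondFalse.IH[OF *] u show ?case by simp
next
  case (WhileFalse b s c)
  from WhileFalse.prems WhileFalse.hyps show ?case
    by (auto elim: exec_WhileE)
next
  case (WhileTrue b s c t1 s1 t2 s2)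
  from WhileTrue.prems WhileTrue.hyps obtain u1 r u2
    where u: "u = 1 + u1 + u2" and *: "exec W c s u1 r" "exec W (While b c) r u2 s''"
    by (auto elim: exec_WhileE)
  from WhileTrue.IH(1)[OF *(1)] have "t1 = u1" "s1 = r" by simp_all
  with WhileTrue.IH(2) *(2) u show ?case by simp
qed (auto elim: exec_SkipE exec_AssignE exec_StoreE exec_EmitE)


section \<open>Linear-time constructible perfect hash families\<close>

definition init_state :: "nat \<Rightarrow> nat \<Rightarrow> nat \<Rightarrow> state" where
  "init_state n q d =
     \<lparr>vars = (\<lambda>_. 0)(''n'' := n, ''q'' := q, ''d'' := d), arrs = (\<lambda>_ _. 0), outp = []\<rparr>"

text \<open>A family of \<open>N\<close> functions is output as its table of values, function by function.\<close>

definition family_of_table :: "nat \<Rightarrow> nat \<Rightarrow> nat list \<Rightarrow> (nat \<Rightarrow> nat) list" where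
  "family_of_table n N out = map (\<lambda>i x. out ! (i * n + x)) [0..<N]"

text \<open>\<open>linear_time_PHF R f\<close>: one program outputs, for all parameters \<open>(n, q, d)\<close> in \<open>R\<close>, an
  \<open>(n,q,d)\<close>-perfect hash family of size \<open>O(f n q d)\<close>, in time linear in the number \<open>N * n\<close> of
  entries of the table of values. The word range \<open>(n + q) ^ c\<close> stands for words of
  \<open>O(log (n + q))\<close> bits. All constants are uniform in \<open>(n, q, d)\<close>.

  The maximum with 1 is needed because sizes are integers: a bound below 1 would exclude
  even a single function. Such bounds occur for \<open>n = 1\<close>, where \<open>ln n = 0\<close>, and when \<open>q\<close> is so
  large that a quotient of logarithms is close to 0.\<close>

definition linear_time_PHF ::
  "(nat \<Rightarrow> nat \<Rightarrow> nat \<Rightarrow> bool) \<Rightarrow> (nat \<Rightarrow> nat \<Rightarrow> nat \<Rightarrow> real) \<Rightarrow> bool" where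
  "linear_time_PHF R f \<longleftrightarrow>
     (\<exists>prog :: com. \<exists>(c :: nat) (C :: real) (K :: nat). \<forall>n q d. R n q d \<longrightarrow>
        (\<exists>t s N. exec ((n + q) ^ c) prog (init_state n q d) t s \<and>
           length (outp s) = N * n \<and>
           perfect_hash_family n q d (family_of_table n N (outp s)) \<and>
           real N \<le> max 1 (C * f n q d) \<and>
           t \<le> K * (N * n)))"

end

theory Submission
  imports Defs "HOL-Number_Theory.Cong"
begin

text \<open>
  Write \<open>C = d choose 2\<close>. If any two points of \<open>[n]\<close> collide under fewer than a fraction
  \<open>1 / C\<close> of the functions, then no \<open>d\<close> points can spoil all functions, so the family is a perfect
  hash family. Let \<open>q = p ^ e\<close>. The functions are \<open>F\<^sub>p\<close>-linear maps from base-\<open>p\<close> digit strings to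
  digit strings of length \<open>e\<close> that are the identity on \<open>[q]\<close>; only the additive group of
  \<open>F\<^sub>q\<close> is used. By linearity a collision of \<open>x\<close> and \<open>y\<close> depends only on \<open>x - y\<close> up to a scalar;
  scaling the highest non-zero digit, at position \<open>l\<close>, to \<open>-1\<close> turns it into \<open>T u = T (p ^ l)\<close>
  with \<open>u < p ^ l\<close>. So only about \<open>2 n\<close> pairs have to be watched, and the columns \<open>T (p ^ l)\<close> can be
  chosen one after the other, independently: each is the value \<open>v\<close> for which the weight of
  \<open>{u. T u = v}\<close> is smallest, which is at most the average.

  The weight of a pair is multiplied by \<open>q\<^sup>2 / D\<close> upon a collision and by \<open>C q / D\<close> otherwise,
  where \<open>D = C q + q - C\<close>, so that the total weight of a block does not grow. Rounding up to
  integers adds at most 1 per pair and round, so weights stay polynomial and need no scaling. The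
  rounds stop as soon as all counts are small. Comparing a single weight with the total bounds
  their number by \<open>O (C ln n / (ln x - 1 + 1 / x))\<close> with \<open>x = q / C\<close>, which yields all bounds
  but the last.

  For \<open>q = C + 2\<close> the greedy maps go to \<open>[q\<^sup>2]\<close> instead, and each is followed by all \<open>q\<^sup>2 / p\<close> maps
  \<open>[q\<^sup>2] \<rightarrow> [q]\<close> given by a unit matrix next to a Hankel matrix; any two points collide under at most
  \<open>q / p\<close> of these. Now \<open>x\<close> is about \<open>2 q\<close>, which gains the factor \<open>ln d\<close>.
\<close>

section \<open>Timed total correctness\<close>

text \<open>Exceeding the share \<open>1 / C\<close> at an average collision rate
  \<open>1 / Q\<close> is a large deviation, and the weights are those of the exponential-moment
  method: a collision is worth the factor \<open>x = Q / C\<close>, and \<open>D\<close> normalizes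
  the mean factor to 1 when a share \<open>1 / Q\<close> of the weight collides. A pair with at
  least \<open>k / C\<close> collisions in \<open>k\<close> rounds has log-weight at least
  \<open>k * gain x / C\<close>, while its whole block weighs at most \<open>n * (1 + k)\<close>;
  this limits \<open>k\<close>. Since logarithms are not word operations, the program compares
  integer counts and stops by itself; the bound on the rounds lives in the analysis.

  For linear time, a round may cost only O(n) per emitted function. Hence table lookups replace
  digit arithmetic, and costs proportional to blocks are summed as geometric series.

  If \<open>Q = q\<close> is close to \<open>C\<close>, then \<open>gain\<close> may drop to the
  order of \<open>1 / q^2\<close>. Passing to \<open>Q = q^2\<close> raises it to the order of
  \<open>ln q\<close>, at the price of \<open>q^2 / p\<close> functions per greedy table. The second
  stage has collision rate \<open>(q / p) / (q^2 / p) = 1 / q < 1 / C\<close>, so the counting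
  argument applies to each stage separately.\<close>

definition runs :: "nat \<Rightarrow> com \<Rightarrow> state \<Rightarrow> nat \<Rightarrow> (state \<Rightarrow> bool) \<Rightarrow> bool" where
  "runs W c s T Q \<longleftrightarrow> (\<exists>t s'. exec W c s t s' \<and> t \<le> T \<and> Q s')"

abbreviation set_var :: "vname \<Rightarrow> nat \<Rightarrow> state \<Rightarrow> state" where
  "set_var x k s \<equiv> s\<lparr>vars := (vars s)(x := k)\<rparr>"

abbreviation set_arr :: "vname \<Rightarrow> nat \<Rightarrow> nat \<Rightarrow> state \<Rightarrow> state" where
  "set_arr a i k s \<equiv> s\<lparr>arrs := (arrs s)(a := (arrs s a)(i := k))\<rparr>"

lemma runs_mono:
  "runs W c s T Q \<Longrightarrow> T \<le> T' \<Longrightarrow> (\<And>s'. Q s' \<Longrightarrow> Q' s') \<Longrightarrow> runs W c s T' Q'"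
  unfolding runs_def by (meson le_trans)

lemma runs_Skip [simp]: "runs W Skip s T Q \<longleftrightarrow> 1 \<le> T \<and> Q s"
  unfolding runs_def by (metis exec.Skip exec_SkipE)

lemma exec_Assign_iff:
  "exec W (Assign x e) s t s' \<longleftrightarrow> t = 1 \<and> afits W e s \<and> s' = set_var x (aval e s) s"
proof
  show "exec W (Assign x e) s t s' \<Longrightarrow> t = 1 \<and> afits W e s \<and> s' = set_var x (aval e s) s"
    by (erule exec_AssignE) simp
  show "t = 1 \<and> afits W e s \<and> s' = set_var x (aval e s) s \<Longrightarrow> exec W (Assign x e) s t s'"
    using exec.Assign by blast
qed

lemma exec_Store_iff:
  "exec W (Store a i e) s t s' \<longleftrightarrow>
     t = 1 \<and> (afits W i s \<and> afits W e s) \<and> s' = set_arr a (aval i s) (aval e s) s"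
proof
  show "exec W (Store a i e) s t s' \<Longrightarrow>
      t = 1 \<and> (afits W i s \<and> afits W e s) \<and> s' = set_arr a (aval i s) (aval e s) s"
    by (erule exec_StoreE) simp
  show "t = 1 \<and> (afits W i s \<and> afits W e s) \<and> s' = set_arr a (aval i s) (aval e s) s \<Longrightarrow>
      exec W (Store a i e) s t s'"
    using exec.Store by blast
qed

lemma exec_Emit_iff:
  "exec W (Emit e) s t s' \<longleftrightarrow> t = 1 \<and> afits W e s \<and> s' = s\<lparr>outp := outp s @ [aval e s]\<rparr>"
proof
  show "exec W (Emit e) s t s' \<Longrightarrow> t = 1 \<and> afits W e s \<and> s' = s\<lparr>outp := outp s @ [aval e s]\<rparr>"
    by (erule exec_EmitE) simp
  show "t = 1 \<and> afits W e s \<and> s' = s\<lparr>outp := outp s @ [aval e s]\<rparr> \<Longrightarrow> exec W (Emit e) s t s'"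
    using exec.Emit by blast
qed

lemma runs_Assign [simp]:
  "runs W (Assign x e) s T Q \<longleftrightarrow> afits W e s \<and> 1 \<le> T \<and> Q (set_var x (aval e s) s)"
  unfolding runs_def exec_Assign_iff by auto

lemma runs_Store [simp]:
  "runs W (Store a i e) s T Q \<longleftrightarrow>
     afits W i s \<and> afits W e s \<and> 1 \<le> T \<and> Q (set_arr a (aval i s) (aval e s) s)"
  unfolding runs_def exec_Store_iff by auto

lemma runs_Emit [simp]:
  "runs W (Emit e) s T Q \<longleftrightarrow> afits W e s \<and> 1 \<le> T \<and> Q (s\<lparr>outp := outp s @ [aval e s]\<rparr>)"
  unfolding runs_def exec_Emit_iff by auto

lemma runs_Seq:
  assumes "runs W c1 s Ta R" and "\<And>s'. R s' \<Longrightarrow> runs W c2 s' Tb Q" and "Ta + Tb \<le> T"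
  shows "runs W (Seq c1 c2) s T Q"
  using assms unfolding runs_def
  by (meson add_mono exec.Seq le_trans)

text \<open>An equivalence is possible because a unit-time command has exactly one outcome. The
  instances act as simp rules that execute straight-line code symbolically, spending one unit of the
  budget at a time.\<close>

lemma runs_Seq_step:
  assumes "\<And>t s'. exec W c1 s t s' \<longleftrightarrow> t = 1 \<and> P \<and> s' = r"
  shows "runs W (Seq c1 c) s T Q \<longleftrightarrow> P \<and> 1 \<le> T \<and> runs W c r (T - 1) Q"
proof
  assume "runs W (Seq c1 c) s T Q"
  then obtain t s' where "exec W (Seq c1 c) s t s'" and *: "t \<le> T" "Q s'"
    unfolding runs_def by blast
  then obtain t2 where "t = 1 + t2" "P" "exec W c r t2 s'"
    by (elim exec_SeqE) (auto simp: assms)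
  with * show "P \<and> 1 \<le> T \<and> runs W c r (T - 1) Q"
    unfolding runs_def by (intro conjI exI[of _ t2] exI[of _ s']) auto
next
  assume *: "P \<and> 1 \<le> T \<and> runs W c r (T - 1) Q"
  then obtain t s' where "exec W c r t s'" "t \<le> T - 1" "Q s'"
    unfolding runs_def by blast
  moreover have "exec W c1 s 1 r" using * by (simp add: assms)
  ultimately show "runs W (Seq c1 c) s T Q"
    unfolding runs_def using * by (intro exI[of _ "1 + t"] exI[of _ s'] conjI exec.Seq) auto
qed

lemmas runs_Seq_unit [simp] =
  runs_Seq_step[OF exec_Assign_iff] runs_Seq_step[OF exec_Store_iff]

lemma runs_Cond:
  assumes "bfits W b s" and "bval b s \<Longrightarrow> runs W c1 s T Q" and "\<not> bval b s \<Longrightarrow> runs W c2 s T Q"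
    and "1 + T \<le> T'"
  shows "runs W (Cond b c1 c2) s T' Q"
proof (cases "bval b s")
  case True
  with assms obtain t s' where "exec W c1 s t s'" "t \<le> T" "Q s'" unfolding runs_def by blast
  with True assms show ?thesis unfolding runs_def
    by (intro exI[of _ "1 + t"] exI[of _ s']) (auto intro!: exec.CondTrue[simplified])
next
  case False
  with assms obtain t s' where "exec W c2 s t s'" "t \<le> T" "Q s'" unfolding runs_def by blast
  with False assms show ?thesis unfolding runs_def
    by (intro exI[of _ "1 + t"] exI[of _ s']) (auto intro!: exec.CondFalse[simplified])
qed

text \<open>The invariant carries the number of steps spent so far, so the time may be bounded by
  data known only at the end, such as the number of rounds. The final 1 is the failing test.\<close>

lemma exec_While:
  assumes "I t s"
    and fits: "\<And>t s. I t s \<Longrightarrow> bfits W b s"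
    and step: "\<And>t s. I t s \<Longrightarrow> bval b s \<Longrightarrow>
      \<exists>t' s'. exec W c s t' s' \<and> I (t + 1 + t') s' \<and> (\<mu> s' :: nat) < \<mu> s"
  shows "\<exists>t' s'. exec W (While b c) s t' s' \<and> (\<exists>u. I u s' \<and> t + t' = u + 1) \<and> \<not> bval b s'"
  using assms(1)
proof (induction "\<mu> s" arbitrary: t s rule: less_induct)
  case less
  show ?case
  proof (cases "bval b s")
    case False
    then have "exec W (While b c) s 1 s" using fits[OF less.prems] by (intro exec.WhileFalse)
    then show ?thesis using less.prems False by (intro exI[of _ 1] exI[of _ s]) auto
  next
    case True
    from step[OF less.prems True] obtain t' s' where
      1: "exec W c s t' s'" "I (t + 1 + t') s'" "\<mu> s' < \<mu> s" by blast
    from less.hyps[OF 1(3,2)] obtain t2 s2 where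
      2: "exec W (While b c) s' t2 s2" "\<exists>u. I u s2 \<and> t + 1 + t' + t2 = u + 1" "\<not> bval b s2" by blast
    have "exec W (While b c) s (1 + t' + t2) s2"
      using exec.WhileTrue[OF fits[OF less.prems] True 1(1) 2(1)] .
    with 2(2,3) show ?thesis
      by (intro exI[of _ "1 + t' + t2"] exI[of _ s2]) (auto simp: algebra_simps)
  qed
qed

text \<open>\<open>\<phi>\<close> is both termination measure and prepaid time: its drop must cover
  the cost \<open>T\<close> of an iteration and 1 for the test. As \<open>T\<close> may differ
  between iterations, this permits amortized analysis.\<close>

lemma runs_While:
  assumes "I s" and "\<And>s. I s \<Longrightarrow> bfits W b s"
    and step: "\<And>s. I s \<Longrightarrow> bval b s \<Longrightarrow>
      \<exists>T. runs W c s T (\<lambda>s'. I s' \<and> T + 1 + \<phi> s' \<le> \<phi> s)"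
    and "\<And>s. I s \<Longrightarrow> \<not> bval b s \<Longrightarrow> Q s" and "\<phi> s + 1 \<le> T"
  shows "runs W (While b c) s T Q"
proof -
  have "\<exists>t' s'. exec W (While b c) s t' s' \<and>
     (\<exists>u. (I s' \<and> u + \<phi> s' \<le> \<phi> s) \<and> 0 + t' = u + 1) \<and> \<not> bval b s'"
  proof (rule exec_While[where \<mu> = \<phi> and I = "\<lambda>t s'. I s' \<and> t + \<phi> s' \<le> \<phi> s"])
    fix t s1
    assume *: "I s1 \<and> t + \<phi> s1 \<le> \<phi> s" "bval b s1"
    then obtain T t' s' where "exec W c s1 t' s'" "t' \<le> T" "I s'" "T + 1 + \<phi> s' \<le> \<phi> s1"
      using step unfolding runs_def by blast
    with * show "\<exists>t' s'. exec W c s1 t' s' \<and> (I s' \<and> t + 1 + t' + \<phi> s' \<le> \<phi> s) \<and> \<phi> s' < \<phi> s1"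
      by (intro exI[of _ t'] exI[of _ s']) auto
  qed (use assms in auto)
  then show ?thesis unfolding runs_def using assms(4,5)
    by (metis add.commute add.right_neutral add_leD1 add_le_mono1 le_trans)
qed

definition for_loop :: "vname \<Rightarrow> aexp \<Rightarrow> vname \<Rightarrow> com \<Rightarrow> com" where
  "for_loop x lo hi body =
     Seq (Assign x lo) (While (Less (Var x) (Var hi))
       (Seq body (Assign x (Plus (Var x) (Const 1)))))"

text \<open>The 2 in \<open>T + 2\<close> pays for test and increment, the other 2 for
  initialization and the failing test. The invariant is evaluated after the increment.\<close>

lemma runs_for:
  assumes "x \<noteq> hi" "afits W lo s" "aval lo s = l" "vars s hi = h" "l \<le> h" "h < W"
    and init: "I l (set_var x l s)"
    and step: "\<And>k s. l \<le> k \<Longrightarrow> k < h \<Longrightarrow> I k s \<Longrightarrow> vars s x = k \<Longrightarrow> vars s hi = h \<Longrightarrow>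
      runs W body s T (\<lambda>s'. vars s' x = k \<and> vars s' hi = h \<and> I (Suc k) (set_var x (Suc k) s'))"
    and final: "\<And>s. I h s \<Longrightarrow> vars s x = h \<Longrightarrow> vars s hi = h \<Longrightarrow> Q s"
    and time: "2 + (h - l) * (T + 2) \<le> T'"
  shows "runs W (for_loop x lo hi body) s T' Q"
proof -
  let ?J = "\<lambda>s. vars s hi = h \<and> l \<le> vars s x \<and> vars s x \<le> h \<and> I (vars s x) s"
  let ?\<phi> = "\<lambda>s. (h - vars s x) * (T + 2)"
  have "runs W (While (Less (Var x) (Var hi)) (Seq body (Assign x (Plus (Var x) (Const 1)))))
      (set_var x l s) (T' - 1) Q"
  proof (rule runs_While[where I = ?J and \<phi> = ?\<phi>])
    show "?J (set_var x l s)" using assms by simp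
    show "bfits W (Less (Var x) (Var hi)) s" if "?J s" for s using that \<open>h < W\<close> by simp
    show "Q s" if "?J s" "\<not> bval (Less (Var x) (Var hi)) s" for s
      using that final[of s] by auto
    show "?\<phi> (set_var x l s) + 1 \<le> T' - 1" using time by simp
    fix s assume J: "?J s" and "bval (Less (Var x) (Var hi)) s"
    then have lt: "vars s x < h" by simp
    define k where "k = vars s x"
    have "(h - k) * (T + 2) = (h - Suc k) * (T + 2) + (T + 2)"
      using lt by (simp add: k_def algebra_simps flip: Suc_diff_Suc)
    then have "runs W (Seq body (Assign x (Plus (Var x) (Const 1)))) s (T + 1)
        (\<lambda>s'. ?J s' \<and> T + 1 + 1 + ?\<phi> s' \<le> ?\<phi> s)"
      using J lt k_def[symmetric] \<open>h < W\<close> \<open>x \<noteq> hi\<close>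
      by (intro runs_Seq[OF step, where Tb = 1]) auto
    then show "\<exists>T. runs W (Seq body (Assign x (Plus (Var x) (Const 1)))) s T
        (\<lambda>s'. ?J s' \<and> T + 1 + ?\<phi> s' \<le> ?\<phi> s)" by blast
  qed
  then show ?thesis unfolding for_loop_def using assms by simp
qed

text \<open>Frame condition: \<open>V\<close> collects the names that may have changed.\<close>

definition agree :: "'a set \<Rightarrow> ('a \<Rightarrow> 'b) \<Rightarrow> ('a \<Rightarrow> 'b) \<Rightarrow> bool" where
  "agree V f g \<longleftrightarrow> (\<forall>x. x \<notin> V \<longrightarrow> g x = f x)"

lemma agree_refl [simp]: "agree V f f"
  by (simp add: agree_def)

lemma agree_upd [simp]: "x \<in> V \<Longrightarrow> agree V f (g(x := k)) \<longleftrightarrow> agree V f g"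
  by (auto simp: agree_def)

abbreviation same :: "vname set \<Rightarrow> vname set \<Rightarrow> state \<Rightarrow> state \<Rightarrow> bool" where
  "same V A s s' \<equiv> agree V (vars s) (vars s') \<and> agree A (arrs s) (arrs s') \<and> outp s' = outp s"

lemma same_var: "same V A s s' \<Longrightarrow> x \<notin> V \<Longrightarrow> vars s' x = vars s x"
  by (simp add: agree_def)

section \<open>Digit strings and linear tables\<close>

definition dig :: "nat \<Rightarrow> nat \<Rightarrow> nat \<Rightarrow> nat" where
  "dig p x i = x div p ^ i mod p"

lemma dig_0 [simp]: "dig p 0 i = 0"
  by (simp add: dig_def)

lemma dig_less: "0 < p \<Longrightarrow> dig p x i < p"
  by (simp add: dig_def)

lemma dig_eq_0: "x < p ^ i \<Longrightarrow> dig p x i = 0"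
  by (simp add: dig_def)

lemma dig_mod: "i < l \<Longrightarrow> dig p (x mod p ^ l) i = dig p x i"
proof -
  assume "i < l"
  then obtain k where k: "l = i + Suc k" by (metis add_Suc_right less_iff_Suc_add)
  have "x mod p ^ l div p ^ i = x div p ^ i mod p ^ Suc k"
    by (cases "p = 0") (simp_all add: k power_add mod_mult2_eq del: power_Suc add_Suc_right)
  then show ?thesis by (simp add: dig_def mod_mod_cancel)
qed

lemma dig_div: "dig p (x div p ^ k) i = dig p x (k + i)"
  by (simp add: dig_def power_add div_mult2_eq)

lemma digits_eqI:
  assumes "x < p ^ e" "y < p ^ e" "\<And>i. i < e \<Longrightarrow> dig p x i = dig p y i"
  shows "x = y"
  using assms
proof (induction e arbitrary: x y)
  case (Suc e)
  have "x div p = y div p"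
  proof (rule Suc.IH)
    show "x div p < p ^ e" "y div p < p ^ e"
      using Suc.prems by (simp_all add: less_mult_imp_div_less mult.commute)
    show "dig p (x div p) i = dig p (y div p) i" if "i < e" for i
      using Suc.prems(3)[of "Suc i"] that dig_div[of p x 1 i] dig_div[of p y 1 i] by simp
  qed
  moreover have "x mod p = y mod p"
    using Suc.prems(3)[of 0] by (simp add: dig_def)
  ultimately show ?case by (metis mult_div_mod_eq)
qed simp

lemma dig_power: "1 < p \<Longrightarrow> dig p (p ^ l) i = (if i = l then 1 else 0)"
proof (cases "i \<le> l")
  case True
  assume "1 < p"
  then have "p ^ l div p ^ i = p ^ (l - i)" using True by (simp add: power_diff)
  then show ?thesis using True \<open>1 < p\<close> by (cases "l - i") (auto simp: dig_def)
next
  case False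
  assume "1 < p"
  then show ?thesis using False by (simp add: dig_eq_0)
qed

text \<open>The bound on the sum excludes a carry out of digit \<open>l\<close>.\<close>

lemma dig_add_power:
  assumes "1 < p" and "x + p ^ l < p ^ Suc l"
  shows "dig p (x + p ^ l) i = (if i = l then Suc (dig p x i) else dig p x i)"
proof -
  consider "i < l" | "i = l" | "l < i" by linarith
  then show ?thesis
  proof cases
    case 1
    then have "dig p (x + p ^ l) i = dig p ((x + p ^ l) mod p ^ l) i" by (simp only: dig_mod)
    also have "\<dots> = dig p x i" using 1 by (simp add: dig_mod)
    finally show ?thesis using 1 by simp
  next
    case 2
    have "(x + p ^ l) div p ^ l = Suc (x div p ^ l)" using assms by simp
    moreover have "(x + p ^ l) div p ^ l < p"
      using assms by (intro less_mult_imp_div_less) simp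
    moreover have "x div p ^ l < p" using calculation by linarith
    ultimately show ?thesis using 2 by (metis dig_def mod_less)
  next
    case 3
    then have "p ^ Suc l \<le> p ^ i" using assms by (intro power_increasing) auto
    with assms 3 show ?thesis by (simp add: dig_eq_0)
  qed
qed

text \<open>\<open>t div c * c\<close> retains the digits above \<open>l\<close>, and reduction
  modulo \<open>c\<close> drops the carry out of digit \<open>l\<close>. So one digit is incremented
  cyclically by constantly many word operations.\<close>

lemma dig_cyclic_add:
  fixes p l t e :: nat
  assumes "1 < p"
  defines "c \<equiv> p ^ Suc l"
  defines "t' \<equiv> t div c * c + (t + p ^ l) mod c"
  shows "dig p t' i = (if i = l then Suc (dig p t i) mod p else dig p t i)"
    and "t < p ^ e \<Longrightarrow> l < e \<Longrightarrow> t' < p ^ e"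
proof -
  have c: "0 < c" using assms by simp
  have hi: "t' div c = t div c" using c by (simp add: t'_def)
  have lo: "t' mod c = (t + p ^ l) mod c" by (simp add: t'_def)
  consider "i < l" | "i = l" | "l < i" by linarith
  then show "dig p t' i = (if i = l then Suc (dig p t i) mod p else dig p t i)"
  proof cases
    case 1
    have "dig p t' i = dig p (t' mod c) i" using 1 by (simp add: c_def dig_mod del: power_Suc)
    also have "\<dots> = dig p (t + p ^ l) i"  unfolding lo unfolding c_def using 1 by (intro dig_mod) simp
    also have "\<dots> = dig p ((t + p ^ l) mod p ^ l) i" using 1 by (simp only: dig_mod)
    also have "\<dots> = dig p t i" using 1 by (simp add: dig_mod)
    finally show ?thesis using 1 by simp
  next
    case 2
    have "dig p t' l = dig p (t' mod c) l" by (simp add: c_def dig_mod del: power_Suc)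
    also have "\<dots> = dig p (t + p ^ l) l"  unfolding lo by (simp add: c_def dig_mod del: power_Suc)
    also have "\<dots> = Suc (dig p t l) mod p" using assms by (simp add: dig_def mod_Suc_eq)
    finally show ?thesis using 2 by simp
  next
    case 3
    then obtain k where k: "i = Suc l + k" using less_iff_Suc_add by auto
    show ?thesis using hi dig_div[of p t' "Suc l" k] dig_div[of p t "Suc l" k] 3
      by (simp add: k c_def)
  qed
  assume "t < p ^ e" "l < e"
  then obtain k where e: "e = Suc l + k" using less_iff_Suc_add by auto
  have pe: "p ^ e = p ^ k * c" by (simp add: e c_def power_add)
  have "t div c < p ^ k" using \<open>t < p ^ e\<close> by (simp add: pe less_mult_imp_div_less)
  then have "Suc (t div c) * c \<le> p ^ e" unfolding pe by (intro mult_right_mono) auto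
  moreover have "(t + p ^ l) mod c < c" using c by simp
  ultimately show "t' < p ^ e" by (simp add: t'_def)
qed

lemma ex_digits:
  assumes "\<And>i. i < l \<Longrightarrow> f i < p"
  obtains u where "u < p ^ l" "\<And>i. i < l \<Longrightarrow> dig p u i = f i"
  using assms
proof (induction l arbitrary: thesis)
  case 0
  show ?case by (rule 0(1)[of 0]) auto
next
  case (Suc l)
  obtain u where u: "u < p ^ l" "\<And>i. i < l \<Longrightarrow> dig p u i = f i"
    using Suc.IH Suc.prems(2) by (metis less_Suc_eq)
  show ?case
  proof (rule Suc.prems(1))
    have "Suc (f l) * p ^ l \<le> p * p ^ l" using Suc.prems(2)[of l] by (intro mult_right_mono) auto
    with u(1) show "u + f l * p ^ l < p ^ Suc l" by simp
    show "dig p (u + f l * p ^ l) i = f i" if "i < Suc l" for i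
    proof (cases "i = l")
      case True
      then show ?thesis using u(1) Suc.prems(2)[of l] by (simp add: dig_def)
    next
      case False
      then have "dig p (u + f l * p ^ l) i = dig p ((u + f l * p ^ l) mod p ^ l) i"
        using that by (simp only: dig_mod)
      then show ?thesis using u False that by simp
    qed
  qed
qed

text \<open>A table \<open>X\<close> on \<open>{..<h}\<close> is an \<open>F\<^sub>p\<close>-linear map from digit strings to digit strings of length
  \<open>e\<close> that is the identity on \<open>{..<p ^ e}\<close>; \<open>X (p ^ i)\<close> is the \<open>i\<close>-th column of its matrix. The
  entries of \<open>X\<close> outside \<open>{..<h}\<close> only occur multiplied with zero digits.\<close>

definition linear_on :: "nat \<Rightarrow> nat \<Rightarrow> nat \<Rightarrow> nat \<Rightarrow> (nat \<Rightarrow> nat) \<Rightarrow> bool" where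
  "linear_on p e L h X \<longleftrightarrow> h \<le> p ^ L \<and>
     (\<forall>x<h. X x < p ^ e \<and> (x < p ^ e \<longrightarrow> X x = x) \<and>
       (\<forall>j<e. [dig p (X x) j = (\<Sum>i<L. dig p (X (p ^ i)) j * dig p x i)] (mod p)))"

lemma linear_on_id:
  assumes "1 < p" "h \<le> p ^ L" "h \<le> p ^ e" "\<And>x. x < h \<Longrightarrow> X x = x"
  shows "linear_on p e L h X"
  unfolding linear_on_def
proof (intro conjI allI impI)
  fix x j assume x: "x < h" and "j < e"
  have "(\<Sum>i<L. dig p (X (p ^ i)) j * dig p x i) = (\<Sum>i<L. if i = j then dig p x i else 0)"
  proof (rule sum.cong[OF refl])
    fix i
    show "dig p (X (p ^ i)) j * dig p x i = (if i = j then dig p x i else 0)"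
    proof (cases "p ^ i < h")
      case True
      then show ?thesis using assms by (simp add: dig_power)
    next
      case False
      then show ?thesis using x by (auto simp: dig_eq_0)
    qed
  qed
  also have "\<dots> = dig p x j"
  proof (cases "j < L")
    case False
    then have "x < p ^ j" using assms x
      by (meson less_le_trans linorder_not_less power_increasing less_imp_le)
    with False show ?thesis by (simp add: dig_eq_0)
  qed (simp add: sum.delta)
  finally show "[dig p (X x) j = (\<Sum>i<L. dig p (X (p ^ i)) j * dig p x i)] (mod p)"
    using assms(4)[OF x] by simp
qed (use assms in auto)

lemma linear_on_cong:
  assumes "linear_on p e L h X" "\<And>x. x < h \<Longrightarrow> Y x = X x"
  shows "linear_on p e L h Y"
proof -
  have "(\<Sum>i<L. dig p (Y (p ^ i)) j * dig p x i) = (\<Sum>i<L. dig p (X (p ^ i)) j * dig p x i)"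
    if "x < h" for x j
  proof (rule sum.cong[OF refl])
    fix i
    show "dig p (Y (p ^ i)) j * dig p x i = dig p (X (p ^ i)) j * dig p x i"
    proof (cases "p ^ i < h")
      case False
      then show ?thesis using that by (simp add: dig_eq_0)
    qed (simp add: assms(2))
  qed
  with assms show ?thesis by (simp add: linear_on_def)
qed

text \<open>From \<open>x - p ^ l\<close> to \<open>x\<close> only digit \<open>l\<close> rises, by
  one, so the matrix product gains one copy of column \<open>l\<close>. By \<open>e \<le> l\<close>
  the new point is outside the range of the identity condition.\<close>

lemma linear_on_extend:
  assumes p: "1 < p" and l: "e \<le> l" and X: "linear_on p e L x X" and "p ^ l \<le> x" "x < p ^ Suc l" "x < p ^ L"
    and Xx: "X x < p ^ e"
      "\<And>j. j < e \<Longrightarrow> dig p (X x) j = (dig p (X (x - p ^ l)) j + dig p (X (p ^ l)) j) mod p"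
  shows "linear_on p e L (Suc x) X"
proof -
  define y where "y = x - p ^ l"
  have xy: "x = y + p ^ l" using assms by (simp add: y_def)
  have "y < x" using p xy by simp
  have lL: "l < L" using \<open>p ^ l \<le> x\<close> \<open>x < p ^ L\<close> p by (meson le_less_trans power_less_imp_less_exp)
  have digx: "dig p x i = (if i = l then Suc (dig p y i) else dig p y i)" for i
    using dig_add_power[of p y l i] p \<open>x < p ^ Suc l\<close> by (simp add: xy)
  have "[dig p (X x) j = (\<Sum>i<L. dig p (X (p ^ i)) j * dig p x i)] (mod p)" if "j < e" for j
  proof -
    have IH: "[dig p (X y) j = (\<Sum>i<L. dig p (X (p ^ i)) j * dig p y i)] (mod p)"
      using X \<open>y < x\<close> that by (auto simp: linear_on_def)
    have "(\<Sum>i<L. dig p (X (p ^ i)) j * dig p x i) =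
        (\<Sum>i<L. dig p (X (p ^ i)) j * dig p y i + (if i = l then dig p (X (p ^ i)) j else 0))"
      by (rule sum.cong) (auto simp: digx)
    also have "\<dots> = (\<Sum>i<L. dig p (X (p ^ i)) j * dig p y i) + dig p (X (p ^ l)) j"
      using lL by (simp add: sum.distrib)
    also have "[\<dots> = dig p (X y) j + dig p (X (p ^ l)) j] (mod p)"
      by (rule cong_add[OF cong_sym[OF IH] cong_refl])
    finally show ?thesis unfolding Xx(2)[OF that] y_def[symmetric] by (simp add: cong_def)
  qed
  moreover have "\<not> x < p ^ e"
    using power_increasing[OF l, of p] p \<open>p ^ l \<le> x\<close> by linarith
  ultimately show ?thesis
    using X Xx(1) \<open>x < p ^ L\<close> unfolding linear_on_def less_Suc_eq by auto
qed

text \<open>\<open>l\<close> is the highest position where \<open>x\<close> and \<open>y\<close>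
  differ. Multiplied by \<open>k\<close>, their digitwise difference has \<open>-1\<close> at
  \<open>l\<close> and the digits of \<open>u\<close> below; moving the last column to the other
  side gives the collision of \<open>u\<close> and \<open>p ^ l\<close>. It matters that
  \<open>l\<close> and \<open>u\<close> are obtained before \<open>X\<close>: one pair represents
  \<open>x\<close> and \<open>y\<close> under all tables.\<close>

lemma linear_on_collision:
  assumes "prime p" and "x \<noteq> y" "x < h" "y < h"
  obtains l u where "u < p ^ l" "p ^ l < h"
    "\<And>X e L. linear_on p e L h X \<Longrightarrow> X x = X y \<Longrightarrow> e \<le> l \<and> X u = X (p ^ l)"
proof -
  have p: "1 < p" using prime_gt_1_nat[OF assms(1)] .
  have big: "dig p x i = 0" "dig p y i = 0" if "h \<le> i" for i
  proof -
    have "i < p ^ i" using p by (intro power_gt_expt) simp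
    then show "dig p x i = 0" "dig p y i = 0" using assms that by (auto intro!: dig_eq_0)
  qed
  have bd: "i \<le> h" if "dig p x i \<noteq> dig p y i" for i
    using big[of i] that by (cases "h \<le> i") auto
  define l where "l = (GREATEST i. dig p x i \<noteq> dig p y i)"
  have "\<exists>i. dig p x i \<noteq> dig p y i"
  proof (rule ccontr)
    assume "\<not> ?thesis"
    moreover have "h < p ^ h" using p by (intro power_gt_expt) simp
    then have "x < p ^ h" "y < p ^ h" using assms by auto
    ultimately show False using digits_eqI[of x p h y] \<open>x \<noteq> y\<close> by auto
  qed
  then have l: "dig p x l \<noteq> dig p y l"
    unfolding l_def by (rule GreatestI_ex_nat[where b = h]) (rule bd)
  have gt: "dig p x i = dig p y i" if "l < i" for i
  proof (rule ccontr)
    assume "dig p x i \<noteq> dig p y i"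
    then have "i \<le> l" unfolding l_def
      by (rule Greatest_le_nat[where b = h]) (rule bd)
    with that show False by simp
  qed
  have plh: "p ^ l < h"
  proof (rule ccontr)
    assume "\<not> ?thesis"
    then have "x < p ^ l" "y < p ^ l" using assms by auto
    with l show False by (simp add: dig_eq_0)
  qed
  define \<delta> where "\<delta> i = int (dig p x i) - int (dig p y i)" for i
  have "\<bar>\<delta> l\<bar> < int p" "\<delta> l \<noteq> 0"
    using dig_less[of p x l] dig_less[of p y l] l p by (auto simp: \<delta>_def)
  then have "\<not> int p dvd \<delta> l"
    using dvd_imp_le_int[of "\<delta> l" "int p"] by auto
  \<comment> \<open>Here \<open>p\<close> has to be prime: the leading difference must be invertible
    to be scaled to \<open>-1\<close>.\<close>
  then have "coprime (\<delta> l) (int p)"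
    using assms(1) prime_imp_coprime[of "int p" "\<delta> l"] by (simp add: coprime_commute)
  then obtain k0 where k0: "[\<delta> l * k0 = 1] (mod int p)"
    using cong_solve_coprime_int by blast
  define k where "k = - k0"
  have k: "[k * \<delta> l = - 1] (mod int p)"
    using cong_minus_minus_iff[of "\<delta> l * k0" 1 "int p"] k0 by (simp add: k_def mult.commute)
  obtain u where u: "u < p ^ l" "\<And>i. i < l \<Longrightarrow> dig p u i = nat (k * \<delta> i mod int p)"
    by (rule ex_digits[of l "\<lambda>i. nat (k * \<delta> i mod int p)" p])
      (use p in \<open>auto simp: nat_less_iff\<close>)
  have uk: "[int (dig p u i) = k * \<delta> i] (mod int p)" if "i < l" for i
    using p u(2)[OF that] by (simp add: cong_def)
  show thesis
  proof (rule that[OF u(1) plh])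
    fix X e L assume X: "linear_on p e L h X" and XX: "X x = X y"
    define c where "c j i = int (dig p (X (p ^ i)) j)" for j i
    have lin: "[int (dig p (X z) j) = (\<Sum>i<L. c j i * int (dig p z i))] (mod int p)"
      if "z < h" "j < e" for z j
      using X that unfolding linear_on_def c_def
      by (simp flip: of_nat_mult of_nat_sum add: cong_int_iff)
    have "p ^ l < p ^ L" using X plh by (simp add: linear_on_def)
    then have lL: "l < L" using p by simp
    have cl: "[(\<Sum>i<l. c j i * int (dig p u i)) = c j l] (mod int p)" if "j < e" for j
    proof -
      have "[(\<Sum>i<L. c j i * int (dig p x i)) = (\<Sum>i<L. c j i * int (dig p y i))] (mod int p)"
        by (rule cong_trans[OF cong_sym[OF lin[OF \<open>x < h\<close> that]] lin[OF \<open>y < h\<close> that, folded XX]])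
      then have "[(\<Sum>i<L. c j i * \<delta> i) = 0] (mod int p)"
        by (simp add: cong_iff_dvd_diff \<delta>_def right_diff_distrib sum_subtractf)
      moreover have "(\<Sum>i<L. c j i * \<delta> i) = (\<Sum>i<Suc l. c j i * \<delta> i)"
        using lL gt by (intro sum.mono_neutral_right) (auto simp: \<delta>_def not_less_eq)
      ultimately have "[k * (\<Sum>i<Suc l. c j i * \<delta> i) = k * 0] (mod int p)"
        by (intro cong_mult cong_refl) simp
      then have "[(\<Sum>i<l. c j i * (k * \<delta> i)) + c j l * (k * \<delta> l) = 0] (mod int p)"
        by (simp add: algebra_simps sum_distrib_left)
      moreover have "[(\<Sum>i<l. c j i * (k * \<delta> i)) + c j l * (k * \<delta> l) =
          (\<Sum>i<l. c j i * int (dig p u i)) + c j l * (- 1)] (mod int p)"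
        using uk k by (intro cong_add cong_sum cong_mult cong_refl) (auto intro: cong_sym)
      ultimately have "[(\<Sum>i<l. c j i * int (dig p u i)) + c j l * (- 1) = 0] (mod int p)"
        by (rule cong_trans[OF cong_sym, rotated])
      then show ?thesis by (simp add: cong_iff_dvd_diff)
    qed
    \<comment> \<open>For \<open>l < e\<close> the columns up to \<open>l\<close> are unit vectors,
      and coordinate \<open>l\<close> of \<open>cl\<close> would read \<open>0 = 1\<close>.\<close>
    have "e \<le> l"
    proof (rule ccontr)
      assume "\<not> e \<le> l"
      then have "X (p ^ i) = p ^ i" if "i \<le> l" for i
      proof -
        have "p ^ i \<le> p ^ l" "p ^ i < p ^ e"
          using p that \<open>\<not> e \<le> l\<close> by (auto simp: power_increasing)
        with X plh show ?thesis by (simp add: linear_on_def)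
      qed
      then have "c l i = (if i = l then 1 else 0)" if "i \<le> l" for i
        using that p by (simp add: c_def dig_power)
      then have "[0 = 1] (mod int p)" using cl[of l] \<open>\<not> e \<le> l\<close> by simp
      then show False using p by (simp add: cong_def)
    qed
    moreover have "X u = X (p ^ l)"
    proof (rule digits_eqI)
      have "u < h" using u(1) plh by simp
      then show "X u < p ^ e" "X (p ^ l) < p ^ e" using X plh by (simp_all add: linear_on_def)
      fix j assume "j < e"
      have "(\<Sum>i<L. c j i * int (dig p u i)) = (\<Sum>i<l. c j i * int (dig p u i))"
      proof (rule sum.mono_neutral_right)
        show "\<forall>i\<in>{..<L} - {..<l}. c j i * int (dig p u i) = 0"
        proof
          fix i assume "i \<in> {..<L} - {..<l}"
          then have "p ^ l \<le> p ^ i" using p by (intro power_increasing) auto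
          then show "c j i * int (dig p u i) = 0" using u(1) by (simp add: dig_eq_0)
        qed
      qed (use lL in auto)
      then have "[int (dig p (X u) j) = c j l] (mod int p)"
        using cong_trans[OF lin[OF \<open>u < h\<close> \<open>j < e\<close>]] cl[OF \<open>j < e\<close>] by simp
      then show "dig p (X u) j = dig p (X (p ^ l)) j"
        unfolding c_def using p by (simp add: cong_int_iff cong_def dig_less)
    qed
    ultimately show "e \<le> l \<and> X u = X (p ^ l)" ..
  qed
qed

section \<open>Collisions, weights and the number of rounds\<close>

text \<open>With \<open>l = e + f\<close>, equation \<open>j\<close> of a collision expresses digit
  \<open>f + j\<close> of \<open>A\<close> through digits of smaller index: a linear recurrence with
  coefficients from \<open>u\<close>. So digits \<open>f\<close> to \<open>f + e - 1\<close> follow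
  from the lower ones, and \<open>A\<close> is known from its \<open>f\<close> lowest digits and the
  \<open>e - 1 - f\<close> digits from \<open>f + e\<close> on, which leaves
  \<open>p ^ (e - 1)\<close> possibilities.\<close>

lemma hankel_collisions:
  assumes p: "prime p" and "0 < e" and m: "m \<le> p ^ (2 * e)"
    and lin: "\<And>A. A < p ^ (2 * e - 1) \<Longrightarrow> linear_on p e L m (G A)"
    and cols: "\<And>A i. A < p ^ (2 * e - 1) \<Longrightarrow> p ^ (e + i) < m \<Longrightarrow> G A (p ^ (e + i)) = A div p ^ i mod p ^ e"
    and xy: "x \<noteq> y" "x < m" "y < m"
  shows "card {A. A < p ^ (2 * e - 1) \<and> G A x = G A y} \<le> p ^ (e - 1)"
proof -
  have p1: "1 < p" using prime_gt_1_nat[OF p] .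
  let ?S = "{A. A < p ^ (2 * e - 1) \<and> G A x = G A y}"
  obtain l u where u: "u < p ^ l" and l: "p ^ l < m"
    and coll: "\<And>X e L. linear_on p e L m X \<Longrightarrow> X x = X y \<Longrightarrow> e \<le> l \<and> X u = X (p ^ l)"
    using linear_on_collision[OF p xy] by metis
  show ?thesis
  proof (cases "?S = {}")
    case False
    then obtain A0 where "A0 \<in> ?S" by blast
    then have "e \<le> l" using coll lin by blast
    then obtain f where f: "l = e + f" using le_Suc_ex by blast
    have "p ^ l < p ^ (2 * e)" using l m by simp
    then have "f < e" using p1 f by simp
    have um: "u < m" using u l by simp
    have rec: "[(\<Sum>i<L. (if i < e then (if i = j then 1 else 0) else dig p A (i - e + j)) * dig p u i) =
        dig p A (f + j)] (mod p)" if "A \<in> ?S" "j < e" for A j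
    proof -
      have A: "A < p ^ (2 * e - 1)" "G A u = G A (p ^ l)" using that coll lin by blast+
      have G: "linear_on p e L m (G A)" using lin A by blast
      have col: "dig p (G A (p ^ (e + i))) j = dig p A (i + j)" if "p ^ (e + i) < m" for i
        using cols[OF A(1) that] \<open>j < e\<close> by (simp add: dig_mod dig_div)
      have "(\<Sum>i<L. (if i < e then (if i = j then 1 else 0) else dig p A (i - e + j)) * dig p u i)
          = (\<Sum>i<L. dig p (G A (p ^ i)) j * dig p u i)"
      proof (rule sum.cong[OF refl])
        fix i
        show "(if i < e then (if i = j then 1 else 0) else dig p A (i - e + j)) * dig p u i
            = dig p (G A (p ^ i)) j * dig p u i"
        proof (cases "p ^ i < m")
          case True
          show ?thesis
          proof (cases "i < e")
            case i: True
            then have "p ^ i < p ^ e" using p1 by simp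
            with G True have "G A (p ^ i) = p ^ i" by (simp add: linear_on_def)
            with i p1 show ?thesis by (auto simp: dig_power)
          next
            case False
            with True col[of "i - e"] show ?thesis by simp
          qed
        next
          case False
          with um show ?thesis by (simp add: dig_eq_0)
        qed
      qed
      also have "[\<dots> = dig p (G A u) j] (mod p)"
        by (rule cong_sym) (use G um \<open>j < e\<close> in \<open>simp add: linear_on_def\<close>)
      also have "dig p (G A u) j = dig p A (f + j)"
        using A(2) col[of f] l f by simp
      finally show ?thesis .
    qed
    have "inj_on (\<lambda>A. (A mod p ^ f, A div p ^ (f + e))) ?S"
    proof (rule inj_onI)
      fix A B assume AB: "A \<in> ?S" "B \<in> ?S" and eq: "(A mod p ^ f, A div p ^ (f + e)) = (B mod p ^ f, B div p ^ (f + e))"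
      have "dig p A t = dig p B t" for t
      proof (induction t rule: less_induct)
        case (less t)
        consider "t < f" | "f \<le> t" "t < f + e" | "f + e \<le> t" by linarith
        then show ?case
        proof cases
          case 1
          then show ?thesis using dig_mod[OF 1, of p A] dig_mod[OF 1, of p B] eq by simp
        next
          case 2
          define j where "j = t - f"
          have j: "j < e" "t = f + j" using 2 by (auto simp: j_def)
          have "(\<Sum>i<L. (if i < e then (if i = j then 1 else 0) else dig p A (i - e + j)) * dig p u i)
             = (\<Sum>i<L. (if i < e then (if i = j then 1 else 0) else dig p B (i - e + j)) * dig p u i)"
          proof (rule sum.cong[OF refl])
            fix i
            show "(if i < e then (if i = j then 1 else 0) else dig p A (i - e + j)) * dig p u i
              = (if i < e then (if i = j then 1 else 0) else dig p B (i - e + j)) * dig p u i"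
            \<comment> \<open>For \<open>e \<le> i < l\<close> the digit of \<open>A\<close> has
              index \<open>i - e + j < f + j\<close>, so the induction hypothesis applies; from
              \<open>l\<close> on the digits of \<open>u\<close> are 0.\<close>
            proof (cases "i < l")
              case True
              then show ?thesis using less.IH[of "i - e + j"] j f by auto
            next
              case False
              then have "p ^ l \<le> p ^ i" using p1 by (intro power_increasing) auto
              then show ?thesis using u by (simp add: dig_eq_0)
            qed
          qed
          then have "[dig p A (f + j) = dig p B (f + j)] (mod p)"
            using rec[OF AB(1) j(1)] rec[OF AB(2) j(1)] by (simp add: cong_def)
          then show ?thesis using p1 j by (simp add: cong_def dig_less)
        next
          case 3
          then obtain k where "t = (f + e) + k" using le_Suc_ex by blast
          then show ?thesis using dig_div[of p A "f + e" k] dig_div[of p B "f + e" k] eq by simp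
        qed
      qed
      then show "A = B" using AB by (intro digits_eqI[of A p "2 * e - 1" B]) auto
    qed
    moreover have "(\<lambda>A. (A mod p ^ f, A div p ^ (f + e))) ` ?S \<subseteq> {..<p ^ f} \<times> {..<p ^ (2 * e - 1 - (f + e))}"
    proof -
      have "p ^ (2 * e - 1) = p ^ (2 * e - 1 - (f + e)) * p ^ (f + e)"
        unfolding power_add[symmetric] by (rule arg_cong[of _ _ "power p"]) (use \<open>f < e\<close> in simp)
      then show ?thesis using p1 by (auto simp: less_mult_imp_div_less)
    qed
    ultimately have "card ?S \<le> card ({..<p ^ f} \<times> {..<p ^ (2 * e - 1 - (f + e))})"
      by (intro card_inj_on_le) auto
    also have "\<dots> = p ^ (f + (2 * e - 1 - (f + e)))"
      by (simp add: card_cartesian_product power_add)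
    also have "f + (2 * e - 1 - (f + e)) = e - 1" using \<open>f < e\<close> by simp
    finally show ?thesis .
  qed (metis card.empty zero_le)
qed

text \<open>If every pair in \<open>S\<close> collides under less than a fraction \<open>1 / (d choose 2)\<close> of the
  functions, then the pairs cannot account for all functions.\<close>

lemma ex_inj_on_of_few_collisions:
  fixes fs :: "('a \<Rightarrow> 'b) list"
  assumes "finite S" "fs \<noteq> []"
    and few: "\<And>x y. x \<in> S \<Longrightarrow> y \<in> S \<Longrightarrow> x \<noteq> y \<Longrightarrow>
      (card S choose 2) * length (filter (\<lambda>f. f x = f y) fs) < length fs"
  shows "\<exists>f\<in>set fs. inj_on f S"
proof (rule ccontr)
  assume none: "\<not> ?thesis"
  define Ps where "Ps = {B. B \<subseteq> S \<and> card B = 2}"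
  have Ps: "finite Ps" "card Ps = card S choose 2"
    using assms(1) by (simp_all add: Ps_def n_subsets)
  let ?c = "\<lambda>B. length (filter (\<lambda>f. \<not> inj_on f B) fs)"
  have cover: "\<exists>B\<in>Ps. \<not> inj_on f B" if "f \<in> set fs" for f
  proof -
    from none that obtain x y where "x \<in> S" "y \<in> S" "x \<noteq> y" "f x = f y"
      by (auto simp: inj_on_def)
    then show ?thesis by (intro bexI[of _ "{x, y}"]) (auto simp: Ps_def inj_on_def)
  qed
  \<comment> \<open>Double counting: each function spoils at least one pair.\<close>
  have "length gs \<le> (\<Sum>B\<in>Ps. length (filter (\<lambda>f. \<not> inj_on f B) gs))" if "set gs \<subseteq> set fs" for gs
    using that
  proof (induction gs)
    case (Cons g gs)
    then obtain B where B: "B \<in> Ps" "\<not> inj_on g B" using cover[of g] by auto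
    have "(1::nat) = (\<Sum>B'\<in>Ps. if B' = B then 1 else 0)" using B Ps by simp
    also have "\<dots> \<le> (\<Sum>B\<in>Ps. if inj_on g B then 0 else 1)" using B by (intro sum_mono) auto
    finally have "Suc (length gs) \<le> (\<Sum>B\<in>Ps. length (filter (\<lambda>f. \<not> inj_on f B) gs)) + (\<Sum>B\<in>Ps. if inj_on g B then 0 else 1)"
      using Cons by simp
    also have "\<dots> = (\<Sum>B\<in>Ps. length (filter (\<lambda>f. \<not> inj_on f B) (g # gs)))"
      unfolding sum.distrib[symmetric] by (rule sum.cong) auto
    finally show ?case by simp
  qed simp
  from this[of fs] have le: "length fs \<le> (\<Sum>B\<in>Ps. ?c B)" by simp
  have "Ps \<noteq> {}" using le assms(2) by auto
  have "card Ps * (\<Sum>B\<in>Ps. ?c B) = (\<Sum>B\<in>Ps. card Ps * ?c B)" by (simp add: sum_distrib_left)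
  also have "\<dots> < (\<Sum>B\<in>Ps. length fs)"
  proof (rule sum_strict_mono[OF Ps(1) \<open>Ps \<noteq> {}\<close>])
    fix B assume "B \<in> Ps"
    then obtain x y where B: "B = {x, y}" "x \<noteq> y" "x \<in> S" "y \<in> S"
      by (auto simp: Ps_def card_2_iff)
    then have eq: "(\<lambda>f. \<not> inj_on f B) = (\<lambda>f. f x = f y)" by (auto simp: inj_on_def fun_eq_iff)
    show "card Ps * ?c B < length fs" unfolding eq Ps(2) by (rule few[OF B(3,4,2)])
  qed
  also have "\<dots> = card Ps * length fs" by simp
  finally show False using le by (metis mult_le_mono2 not_less)
qed

text \<open>Minimum at most average: every \<open>y\<close> falls into exactly one of the
  \<open>Q\<close> buckets.\<close>

lemma lightest_bucket:
  fixes w T :: "nat \<Rightarrow> nat"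
  assumes "\<And>y. y < P \<Longrightarrow> T y < Q" and "\<And>a. a < Q \<Longrightarrow> H v \<le> H a"
    and H: "\<And>a. H a = (\<Sum>y<P. if T y = a then w y else 0)"
  shows "Q * H v \<le> (\<Sum>y<P. w y)"
proof -
  have "Q * H v \<le> (\<Sum>a<Q. H a)"
    using sum_bounded_below[of "{..<Q}" "H v" H] assms(2) by simp
  also have "\<dots> = (\<Sum>y<P. \<Sum>a<Q. if T y = a then w y else 0)"
    unfolding H by (rule sum.swap)
  also have "\<dots> = (\<Sum>y<P. w y)"
    by (rule sum.cong) (use assms(1) in auto)
  finally show ?thesis .
qed

text \<open>If a share \<open>s\<close> of the weight collides, the mean factor is
  \<open>(C * Q + s * Q * (Q - C)) / D\<close>. It increases with \<open>s\<close> and equals 1 at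
  \<open>s = 1 / Q\<close>, which is where \<open>D\<close> comes from. The summand \<open>P\<close>
  is one rounding unit per pair.\<close>

lemma potential_step:
  fixes w w' T :: "nat \<Rightarrow> nat"
  assumes "C < Q" and "0 < C" and D: "D = C * Q + Q - C"
    and light: "Q * (\<Sum>y<P. if T y = v then w y else 0) \<le> (\<Sum>y<P. w y)"
    and w': "\<And>y. y < P \<Longrightarrow> w' y = (if T y = v then w y * Q * Q div D + 1 else w y * C * Q div D + 1)"
  shows "(\<Sum>y<P. w' y) \<le> (\<Sum>y<P. w y) + P"
proof -
  define R where "R = Q - C"
  have Q: "Q = C + R" using \<open>C < Q\<close> by (simp add: R_def)
  have D': "D = C * Q + R" using D Q by simp
  define g where "g y = w' y - 1" for y
  have "D * (\<Sum>y<P. g y) = (\<Sum>y<P. D * g y)" by (simp add: sum_distrib_left)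
  also have "\<dots> \<le> (\<Sum>y<P. C * Q * w y + R * Q * (if T y = v then w y else 0))"
  proof (rule sum_mono)
    fix y assume "y \<in> {..<P}"
    then have "D * g y \<le> (if T y = v then w y * Q * Q else w y * C * Q)"
      by (simp add: g_def w' times_div_less_eq_dividend)
    also have "\<dots> = C * Q * w y + R * Q * (if T y = v then w y else 0)"
      by (simp add: Q algebra_simps)
    finally show "D * g y \<le> C * Q * w y + R * Q * (if T y = v then w y else 0)" .
  qed
  also have "\<dots> = C * Q * (\<Sum>y<P. w y) + R * (Q * (\<Sum>y<P. if T y = v then w y else 0))"
    by (simp add: sum.distrib sum_distrib_left algebra_simps)
  also have "\<dots> \<le> C * Q * (\<Sum>y<P. w y) + R * (\<Sum>y<P. w y)" using light by (intro add_left_mono mult_left_mono) auto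
  also have "\<dots> = D * (\<Sum>y<P. w y)" by (simp add: D' algebra_simps)
  finally have "(\<Sum>y<P. g y) \<le> (\<Sum>y<P. w y)" using D' R_def \<open>C < Q\<close> by simp
  moreover have "(\<Sum>y<P. w' y) = (\<Sum>y<P. g y) + P"
  proof -
    have "(\<Sum>y<P. w' y) = (\<Sum>y<P. g y + 1)" by (rule sum.cong) (auto simp: g_def w')
    then show ?thesis by (simp only: sum.distrib) simp
  qed
  ultimately show ?thesis by simp
qed

text \<open>The Poisson form \<open>(x ln x - x + 1) / x\<close> of the Chernoff exponent, as a rate
  per collision: \<open>a\<close> collisions in at most \<open>C * a\<close> rounds are weighed by
  it in \<open>rounds_le\<close>.\<close>

definition gain :: "real \<Rightarrow> real" where
  "gain x = ln x - 1 + 1 / x"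

text \<open>Both sides vanish at 1, and their difference has derivative
  \<open>(1 - 1 / t)^2 / t\<close>.\<close>

lemma gain_ge:
  assumes "1 < x"
  shows "(1 - 1 / x)\<^sup>2 / 2 \<le> gain x"
proof -
  define h where "h t = ln t - 1 + 1 / t - (1 - 1 / t)\<^sup>2 / 2" for t :: real
  have "h 1 \<le> h x"
  proof (rule DERIV_nonneg_imp_nondecreasing[where f = h])
    fix t :: real assume "1 \<le> t" "t \<le> x"
    have "(h has_real_derivative (1 / t - 1 / t\<^sup>2 - (1 - 1 / t) * (1 / t\<^sup>2))) (at t)"
      unfolding h_def using \<open>1 \<le> t\<close>
      by (auto intro!: derivative_eq_intros simp: power2_eq_square field_simps)
    moreover have "1 / t - 1 / t\<^sup>2 - (1 - 1 / t) * (1 / t\<^sup>2) = (1 - 1 / t)\<^sup>2 / t"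
      using \<open>1 \<le> t\<close> by (simp add: power2_eq_square field_simps)
    ultimately show "\<exists>y. (h has_real_derivative y) (at t) \<and> 0 \<le> y"
      using \<open>1 \<le> t\<close> by fastforce
  qed (use assms in auto)
  then show ?thesis by (simp add: h_def gain_def)
qed

lemma gain_pos:
  assumes "1 < x"
  shows "0 < gain x"
proof -
  have "0 < (1 - 1 / x)\<^sup>2 / 2" using assms by simp
  with gain_ge[OF assms] show ?thesis by linarith
qed

text \<open>Integrality: \<open>Q - C \<ge> 1\<close> gives \<open>1 - C / Q \<ge> 1 / Q\<close>.
  This crude bound serves where a polynomial estimate is enough.\<close>

lemma gain_quotient_ge:
  fixes C Q :: nat
  assumes "0 < C" "C < Q"
  shows "1 / (2 * real Q ^ 2) \<le> gain (real Q / real C)"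
proof -
  have "1 / real Q \<le> 1 - 1 / (real Q / real C)" using assms by (simp add: field_simps)
  then have "(1 / real Q)\<^sup>2 \<le> (1 - 1 / (real Q / real C))\<^sup>2" by (intro power_mono) auto
  moreover have "1 < real Q / real C" using assms by simp
  ultimately show ?thesis using gain_ge[of "real Q / real C"] by (simp add: power_divide)
qed

text \<open>Keeps counters and weights within words of logarithmic length. The exponent is 3 for the
  constant 26, as \<open>n \<ge> 3\<close>, plus 2 for \<open>C * ln n\<close> and 2 for
  \<open>Q^2\<close>.\<close>

lemma rounds_poly:
  fixes C Q n :: nat
  assumes "0 < C" "C < Q" "Q < n"
  shows "13 * real C * ln n / gain (Q / C) \<le> n ^ 7"
proof -
  note gQ = gain_quotient_ge[OF assms(1,2)]
  have "0 < gain (Q / C)" using assms by (intro gain_pos) simp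
  then have "13 * real C * ln n / gain (Q / C) \<le> 13 * real C * ln n / (1 / (2 * real Q ^ 2))"
    using gQ assms by (intro divide_left_mono mult_pos_pos mult_nonneg_nonneg) auto
  also have "\<dots> = 26 * ((real C * ln n) * (real Q * real Q))" by (simp add: power2_eq_square)
  also have "\<dots> \<le> (real n * (real n * real n)) * ((real n * real n) * (real n * real n))"
  proof (rule mult_mono)
    have "3 * (3 * 3) \<le> real n * (real n * real n)" using assms by (intro mult_mono) auto
    then show "26 \<le> real n * (real n * real n)" by simp
    have "ln n \<le> real n" using assms ln_le_minus_one[of "real n"] by simp
    then show "real C * ln (real n) * (real Q * real Q) \<le> (real n * real n) * (real n * real n)"
      using assms by (intro mult_mono) auto
  qed (use assms in auto)
  also have "\<dots> = n ^ 7" by (simp add: numeral_eq_Suc)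
  finally show ?thesis .
qed

text \<open>Hypothesis \<open>w\<close> compares the weight of one pair with a bound for its block.
  Its logarithm reads \<open>k * \<gamma> \<le> ln n + ln (1 + k)\<close> with
  \<open>\<gamma> = gain x / C\<close>; it remains to solve this for \<open>k\<close>.\<close>

lemma rounds_le:
  fixes k a C Q n :: nat
  assumes C: "0 < C" "C < Q" "Q < n" and "k \<le> C * a"
    and w: "(real (C * Q) / real (C * Q + Q - C)) ^ k * (real Q / real C) ^ a \<le> real n * (1 + real k)"
  shows "real k \<le> 13 * real C * ln n / gain (Q / C)"
proof -
  define x where "x = real Q / real C"
  have x: "1 < x" using C by (simp add: x_def)
  define \<gamma> where "\<gamma> = gain x / C"
  have g: "0 < gain x" using gain_pos[OF x] .
  have n: "3 \<le> n" using C by simp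
  have D: "real (C * Q + Q - C) = real C * Q + Q - C" using C by simp
  have "real C < real Q" "0 \<le> real C * real Q" using C by auto
  then have Dpos: "0 < real C * Q + Q - C" by linarith
  \<comment> \<open>\<open>r\<close> is the factor of every round, and each collision contributes
    another \<open>x\<close>. Since \<open>1 / r = 1 + (1 - 1 / x) / C\<close>, a round lowers the
    log-weight by at most \<open>(1 - 1 / x) / C\<close>.\<close>
  define r where "r = real (C * Q) / real (C * Q + Q - C)"
  have r: "0 < r" unfolding r_def D using C Dpos by (intro divide_pos_pos) auto
  have "1 / r = (real C * Q + Q - C) / (real C * Q)" unfolding r_def D by simp
  also have "\<dots> = 1 + (1 - 1 / x) / C" using C by (simp add: x_def field_simps)
  finally have r': "inverse r = 1 + (1 - 1 / x) / C" by (simp only: inverse_eq_divide)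
  have "ln (inverse r) \<le> inverse r - 1" using r by (intro ln_le_minus_one) simp
  then have "ln (inverse r) \<le> (1 - 1 / x) / C" unfolding r' by simp
  then have l1: "- ((1 - 1 / x) / C) \<le> ln r" using r by (simp add: ln_inverse)
  have "real k / C \<le> real a" using \<open>k \<le> C * a\<close> C
    by (simp add: field_simps flip: of_nat_mult)
  then have "real k / C * ln x \<le> real a * ln x" using x by (intro mult_right_mono) auto
  moreover have "real k * - ((1 - 1 / x) / C) \<le> real k * ln r"
    using l1 by (intro mult_left_mono) auto
  moreover have "real k * \<gamma> = real k * - ((1 - 1 / x) / C) + real k / C * ln x"
    using C by (simp add: \<gamma>_def gain_def field_simps)
  ultimately have "real k * \<gamma> \<le> real k * ln r + real a * ln x"
    by simp
  also have "\<dots> = ln (r ^ k * x ^ a)"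
    using r x by (simp add: ln_mult ln_realpow)
  also have "\<dots> \<le> ln (real n * (1 + real k))"
    using w r x C unfolding r_def[symmetric] x_def[symmetric]
    by (subst ln_le_cancel_iff) (auto intro!: mult_pos_pos add_pos_nonneg)
  also have "\<dots> = ln n + ln (1 + real k)" using n by (simp add: ln_mult)
  finally have 1: "real k * \<gamma> \<le> ln n + ln (1 + real k)" .
  have \<gamma>: "0 < \<gamma>" using g C by (simp add: \<gamma>_def)
  \<comment> \<open>The tangent bound \<open>ln y \<le> y - 1\<close> at
    \<open>y = \<gamma> / 2 * (1 + k)\<close> lets half of \<open>k * \<gamma>\<close> absorb
    \<open>ln (1 + k)\<close>, at the price of \<open>ln (2 / \<gamma>)\<close>.\<close>
  have "\<gamma> / 2 * (1 + real k) > 0" using \<gamma> by (simp add: add_pos_nonneg)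
  then have "ln (\<gamma> / 2 * (1 + real k)) \<le> \<gamma> / 2 * (1 + real k) - 1" by (rule ln_le_minus_one)
  moreover have "ln (\<gamma> / 2 * (1 + real k)) = ln (1 + real k) - ln (2 / \<gamma>)"
    using \<gamma> by (simp add: ln_mult ln_div)
  ultimately have 2: "ln (1 + real k) \<le> \<gamma> / 2 * (1 + real k) - 1 + ln (2 / \<gamma>)" by simp
  have "\<gamma> \<le> gain x" using C g by (simp add: \<gamma>_def field_simps)
  also have "\<dots> \<le> ln x" using x by (simp add: gain_def)
  also have "\<dots> \<le> ln n" using x C by (subst ln_le_cancel_iff) (auto simp: x_def field_simps intro: order_trans[of _ "real n * 1"])
  finally have 3: "\<gamma> \<le> ln n" .
  note gQ = gain_quotient_ge[OF C(1,2), folded x_def]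
  have "2 / \<gamma> = 2 * C / gain x" by (simp add: \<gamma>_def)
  also have "\<dots> \<le> 2 * C / (1 / (2 * real Q ^ 2))"
    using gQ C g by (intro divide_left_mono mult_pos_pos) auto
  also have "\<dots> = 4 * (real C * (real Q * real Q))" by (simp add: power2_eq_square)
  also have "\<dots> \<le> (real n * real n) * (real n * (real n * real n))"
  proof (rule mult_mono)
    show "real C * (real Q * real Q) \<le> real n * (real n * real n)"
      using C by (intro mult_mono) auto
    have "2 * 2 \<le> real n * real n" using n by (intro mult_mono) auto
    then show "4 \<le> real n * real n" by simp
  qed auto
  also have "\<dots> = real n ^ 5" by (simp add: numeral_eq_Suc)
  finally have "ln (2 / \<gamma>) \<le> ln (real n ^ 5)" using \<gamma> n by (subst ln_le_cancel_iff) auto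
  also have "\<dots> = 5 * ln n" using n by (simp add: ln_realpow)
  finally have 4: "ln (2 / \<gamma>) \<le> 5 * ln n" .
  \<comment> \<open>What remains is \<open>k * \<gamma> / 2 \<le> (1 + 5 + 1 / 2) * ln n\<close>,
    whence 13.\<close>
  have "real k * \<gamma> \<le> 13 * ln n" using 1 2 3 4 by (simp add: field_simps)
  then show ?thesis using \<gamma> C g by (simp add: \<gamma>_def x_def[symmetric] field_simps)
qed

section \<open>Bounds on the number of rounds\<close>

text \<open>One more than the bound of \<open>rounds_le\<close>; it belongs to the analysis and is
  never evaluated by the program. For \<open>Q \<ge> n\<close> the tables are the identity on all
  points, and the first round succeeds.\<close>

definition max_rounds :: "nat \<Rightarrow> nat \<Rightarrow> nat \<Rightarrow> nat" where
  "max_rounds n Q C = (if Q < n then nat \<lfloor>13 * real C * ln (real n) / gain (Q / C)\<rfloor> + 1 else 1)"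

text \<open>The additional round is absorbed by
  \<open>gain x \<le> ln x \<le> ln n \<le> C * ln n\<close>, which turns 13 into 14.\<close>

lemma max_rounds_le_real:
  assumes "0 < C" "C < Q" "0 < n"
  shows "real (max_rounds n Q C) \<le> max 1 (14 * real C * ln (real n) / gain (Q / C))"
proof (cases "Q < n")
  case True
  have g: "0 < gain (Q / C)" using assms by (intro gain_pos) simp
  have x: "1 \<le> real Q / real C" using assms by simp
  have "1 / (real Q / real C) \<le> 1 / 1" by (rule frac_le) (use x in auto)
  then have "gain (Q / C) \<le> ln (Q / C)" unfolding gain_def by linarith
  also have "\<dots> \<le> ln (real n)"
  proof (subst ln_le_cancel_iff)
    have "real Q \<le> real n * 1" using True by simp
    also have "\<dots> \<le> real n * real C" using assms by (intro mult_left_mono) auto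
    finally show "real Q / real C \<le> n" using assms by (simp add: divide_le_eq)
  qed (use assms True in auto)
  also have "\<dots> \<le> real C * ln (real n)" using assms by (simp add: mult_le_cancel_right1)
  finally have A: "1 \<le> real C * ln (real n) / gain (Q / C)" using g by (simp add: le_divide_eq)
  have eq: "k * real C * ln (real n) / gain (Q / C) = k * (real C * ln (real n) / gain (Q / C))" for k by simp
  have "real (nat \<lfloor>13 * real C * ln (real n) / gain (Q / C)\<rfloor>) \<le> 13 * real C * ln (real n) / gain (Q / C)"
    using g assms by (intro of_nat_floor) auto
  then have "real (nat \<lfloor>13 * real C * ln (real n) / gain (Q / C)\<rfloor> + 1) \<le> 14 * real C * ln (real n) / gain (Q / C)"
    using A unfolding eq of_nat_add by linarith
  then show ?thesis using True by (simp add: max_rounds_def)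
qed (simp add: max_rounds_def)

lemma max_rounds_le:
  assumes "0 < C" "C < Q" "0 < n"
  shows "max_rounds n Q C \<le> n ^ 7 + 1"
proof (cases "Q < n")
  case True
  have "13 * real C * ln (real n) / gain (Q / C) \<le> n ^ 7" using rounds_poly[of C Q n] assms True by simp
  then have "\<lfloor>13 * real C * ln (real n) / gain (Q / C)\<rfloor> \<le> \<lfloor>real (n ^ 7)\<rfloor>" by (rule floor_mono)
  then have "nat \<lfloor>13 * real C * ln (real n) / gain (Q / C)\<rfloor> \<le> n ^ 7" by (simp only: floor_of_nat nat_le_iff)
  then show ?thesis using True by (simp add: max_rounds_def)
qed (simp add: max_rounds_def)

section \<open>The size bounds in the individual ranges of \<open>q\<close>\<close>

definition pairs :: "nat \<Rightarrow> real" where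
  "pairs d = real d * (real d - 1) / 2"

lemma pairs_choose: "real (d choose 2) = pairs d"
proof -
  have "even (d * (d - 1))" by (cases d) auto
  then have "2 * (d choose 2) = d * (d - 1)" unfolding choose_two by (rule dvd_mult_div_cancel)
  then have "real (2 * (d choose 2)) = real (d * (d - 1))" by (rule arg_cong)
  then show ?thesis by (cases d) (simp_all add: pairs_def field_simps)
qed

lemma pairs_bounds:
  assumes "2 \<le> d"
  shows "1 \<le> pairs d" "pairs d \<le> (real d)\<^sup>2 / 2" "real d \<le> pairs d + 1"
proof -
  have d: "2 \<le> real d" using assms by simp
  then have "2 * 1 \<le> real d * (real d - 1)" by (intro mult_mono) auto
  then show "1 \<le> pairs d" by (simp add: pairs_def)
  show "pairs d \<le> (real d)\<^sup>2 / 2" using d by (simp add: pairs_def power2_eq_square algebra_simps)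
  have "0 \<le> (real d - 1) * (real d - 2)" using d by (intro mult_nonneg_nonneg) auto
  then show "real d \<le> pairs d + 1" by (simp add: pairs_def field_simps)
qed

text \<open>Reduces a range of \<open>q\<close> to a positive lower bound \<open>b\<close> for
  \<open>gain\<close>; 7 arises from 14 and \<open>pairs d \<le> d^2 / 2\<close>.\<close>

lemma bound_via:
  assumes "2 \<le> d" "0 < n" "0 < b" "b \<le> gain x"
  shows "14 * pairs d * ln (real n) / gain x \<le> 7 * (real d)\<^sup>2 * ln (real n) / b"
proof -
  note C = pairs_bounds[OF assms(1)]
  have ln: "0 \<le> ln (real n)" using assms by simp
  have "14 * pairs d * ln (real n) / gain x \<le> 14 * pairs d * ln (real n) / b"
    using assms C(1) ln by (intro divide_left_mono mult_pos_pos mult_nonneg_nonneg) auto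
  also have "\<dots> \<le> 7 * (real d)\<^sup>2 * ln (real n) / b"
    using C(2) ln assms by (intro divide_right_mono mult_right_mono) auto
  finally show ?thesis .
qed

text \<open>The factor \<open>exp 1\<close> under the logarithm is the \<open>- 1\<close> in
  \<open>gain\<close>; as \<open>exp 1 \<le> 3 < 4\<close>, the hypothesis on \<open>q\<close> makes
  that logarithm positive.\<close>

lemma bound_large_alphabet:
  assumes "2 \<le> d" "real q > 4 * (pairs d + 1)" "0 < n"
  shows "14 * pairs d * ln (real n) / gain (real q / pairs d) \<le>
    7 * ((real d)\<^sup>2 * ln (real n) / ln (real q / (exp 1 * (pairs d + 1))))"
proof -
  note C = pairs_bounds[OF assms(1)]
  define b where "b = ln (real q / (exp 1 * (pairs d + 1)))"
  have "0 < 4 * (pairs d + 1)" using C(1) by simp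
  then have q: "0 < real q" using assms(2) by (rule less_trans)
  have "exp 1 * (pairs d + 1) < 4 * (pairs d + 1)"
    using exp_le C by (intro mult_strict_right_mono) auto
  then have "1 < real q / (exp 1 * (pairs d + 1))" using assms C by (simp add: less_divide_eq)
  then have b: "0 < b" by (simp add: b_def)
  have "b = ln (real q / (pairs d + 1)) - 1"
    using q C by (simp add: b_def ln_div ln_mult)
  also have "\<dots> \<le> ln (real q / pairs d) - 1"
    using q C by (simp add: divide_left_mono)
  also have "\<dots> \<le> gain (real q / pairs d)" using q C by (simp add: gain_def)
  finally have "14 * pairs d * ln (real n) / gain (real q / pairs d) \<le> 7 * (real d)\<^sup>2 * ln (real n) / b"
    using assms b by (intro bound_via) auto
  then show ?thesis by (simp add: b_def mult.assoc)
qed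

text \<open>\<open>gain_ge\<close> with \<open>1 - 1 / x = (q - pairs d) / q\<close>: the cost is
  quadratic in the relative distance of \<open>q\<close> from \<open>pairs d\<close>.\<close>

lemma bound_quadratic:
  assumes "2 \<le> d" "pairs d < real q" "0 < n"
  shows "14 * pairs d * ln (real n) / gain (real q / pairs d) \<le>
    14 * ((real q)\<^sup>2 * (real d)\<^sup>2 * ln (real n) / (real q - pairs d)\<^sup>2)"
proof -
  note C = pairs_bounds[OF assms(1)]
  define b where "b = ((real q - pairs d) / real q)\<^sup>2 / 2"
  have q: "0 < real q" using assms(2) C(1) by linarith
  have b: "0 < b" using assms q by (simp add: b_def)
  have "1 < real q / pairs d" using assms C by (simp add: less_divide_eq)
  moreover have "1 - 1 / (real q / pairs d) = (real q - pairs d) / real q"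
    using q C by (simp add: field_simps)
  ultimately have "b \<le> gain (real q / pairs d)" using gain_ge[of "real q / pairs d"] by (simp add: b_def)
  then have "14 * pairs d * ln (real n) / gain (real q / pairs d) \<le> 7 * (real d)\<^sup>2 * ln (real n) / b"
    using assms b by (intro bound_via) auto
  also have "\<dots> = 14 * ((real q)\<^sup>2 * (real d)\<^sup>2 * ln (real n) / (real q - pairs d)\<^sup>2)"
    using q assms by (simp add: b_def power_divide field_simps)
  finally show ?thesis .
qed

lemma bound_quadratic':
  assumes "2 \<le> d" "pairs d + 1 < real q" "0 < n"
  shows "14 * pairs d * ln (real n) / gain (real q / pairs d) \<le>
    14 * ((real q)\<^sup>2 * (real d)\<^sup>2 * ln (real n) / (real q - pairs d - 1)\<^sup>2)"
proof -
  have "(real q)\<^sup>2 * (real d)\<^sup>2 * ln (real n) / (real q - pairs d)\<^sup>2 \<le> (real q)\<^sup>2 * (real d)\<^sup>2 * ln (real n) / (real q - pairs d - 1)\<^sup>2"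
    using assms by (intro divide_left_mono power_mono mult_pos_pos mult_nonneg_nonneg) auto
  then show ?thesis using bound_quadratic[of d q n] assms by linarith
qed

text \<open>Away from 1, \<open>gain\<close> has the order of \<open>ln\<close>. For
  \<open>x \<ge> 4\<close> the \<open>- 1\<close> is dominated, as \<open>ln x \<ge> 5 / 4\<close>;
  for smaller \<open>x\<close> the bounds \<open>gain x \<ge> 1 / 8\<close> and
  \<open>ln x \<le> 2\<close> dictate the 16.\<close>

lemma gain_ge_ln:
  assumes "2 \<le> x"
  shows "ln x / 16 \<le> gain x"
proof (cases "4 \<le> x")
  case True
  have "ln (exp 1) \<le> ln (3 :: real)" using exp_le by (subst ln_le_cancel_iff) auto
  moreover have "- ln (4 / 3) \<le> 3 / 4 - (1 :: real)"
    using ln_le_minus_one[of "3 / 4 :: real"] by (simp add: ln_div)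
  moreover have "ln 4 = ln (3 :: real) + ln (4 / 3)" using ln_mult[of 3 "4 / 3 :: real"] by simp
  moreover have "ln (4 :: real) \<le> ln x" using True by simp
  ultimately have "5 / 4 \<le> ln x" by simp
  moreover have "0 < 1 / x" using True by simp
  ultimately show ?thesis unfolding gain_def by linarith
next
  case False
  have "(1 / 2)\<^sup>2 \<le> (1 - 1 / x)\<^sup>2" using assms by (intro power_mono) (auto simp: field_simps)
  then have "1 / 8 \<le> gain x" using gain_ge[of x] assms by (simp add: power2_eq_square)
  moreover have "ln x \<le> ln 4" using False assms by simp
  moreover have "ln 4 = 2 * ln (2 :: real)" using ln_mult[of 2 "2 :: real"] by simp
  moreover have "ln (2 :: real) \<le> 1" using ln_le_minus_one[of 2] by simp
  ultimately show ?thesis by linarith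
qed

text \<open>As \<open>(2 + \<delta>) * ln d \<le> ln q\<close>, the logarithm of
  \<open>q / d^2\<close> retains the share \<open>\<delta> / (2 + \<delta>)\<close> of
  \<open>ln q\<close>; hence the dependence of the constant on \<open>\<delta>\<close>. The 112 is 7
  times the 16 of \<open>gain_ge_ln\<close>.\<close>

lemma bound_power:
  assumes "2 \<le> d" "0 < \<delta>" "real q \<ge> real d powr (2 + \<delta>)" "0 < n"
  shows "14 * pairs d * ln (real n) / gain (real q / pairs d) \<le>
    (112 * (2 + \<delta>) / \<delta>) * ((real d)\<^sup>2 * (ln (real n) / ln q))"
proof -
  note C = pairs_bounds[OF assms(1)]
  have d2: "(real d)\<^sup>2 \<le> real d powr (2 + \<delta>)"
    using assms powr_mono[of 2 "2 + \<delta>" "real d"] by (simp add: powr_numeral)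
  have "4 \<le> (real d)\<^sup>2" using assms power_mono[of 2 "real d" 2] by simp
  then have q: "4 \<le> real q" using d2 assms by linarith
  define b where "b = \<delta> / (2 + \<delta>) * ln q"
  have b: "0 < b" using assms q by (simp add: b_def)
  have x2: "2 \<le> real q / pairs d" using d2 C assms by (simp add: le_divide_eq)
  have "(2 + \<delta>) * ln d \<le> ln q"
  proof -
    have "(2 + \<delta>) * ln d = ln (real d powr (2 + \<delta>))" using assms by (simp add: ln_powr)
    also have "\<dots> \<le> ln q" using assms q by (subst ln_le_cancel_iff) auto
    finally show ?thesis .
  qed
  then have "2 * ln d \<le> 2 / (2 + \<delta>) * ln q" using assms by (simp add: field_simps)
  moreover have "b = ln q - 2 / (2 + \<delta>) * ln q" using assms by (simp add: b_def field_simps)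
  ultimately have "b \<le> ln q - 2 * ln d" by linarith
  also have "\<dots> = ln (real q / (real d)\<^sup>2)" using q assms by (simp add: ln_div ln_realpow)
  also have "\<dots> \<le> ln (real q / pairs d)"
  proof (subst ln_le_cancel_iff)
    have "0 \<le> (real d)\<^sup>2" by simp
    then have "pairs d \<le> (real d)\<^sup>2" using C(2) by linarith
    then show "real q / (real d)\<^sup>2 \<le> real q / pairs d" using q C assms by (intro divide_left_mono) auto
  qed (use q C assms in auto)
  finally have "b / 16 \<le> gain (real q / pairs d)" using gain_ge_ln[OF x2] by linarith
  then have "14 * pairs d * ln (real n) / gain (real q / pairs d) \<le> 7 * (real d)\<^sup>2 * ln (real n) / (b / 16)"
    using assms b by (intro bound_via) auto
  also have "\<dots> = (112 * (2 + \<delta>) / \<delta>) * ((real d)\<^sup>2 * (ln (real n) / ln q))"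
    using assms by (simp add: b_def)
  finally show ?thesis .
qed

text \<open>\<open>q / pairs d\<close> is at least the fixed \<open>c > 1\<close>, so
  \<open>gain\<close> is bounded below by a constant.\<close>

lemma bound_proportional:
  assumes "2 \<le> d" "1 < c" "real q \<ge> c / 2 * (real d)\<^sup>2" "0 < n"
  shows "14 * pairs d * ln (real n) / gain (real q / pairs d) \<le>
    (14 / (1 - 1 / c)\<^sup>2) * ((real d)\<^sup>2 * ln (real n))"
proof -
  note C = pairs_bounds[OF assms(1)]
  have "c * pairs d \<le> c * ((real d)\<^sup>2 / 2)" using C assms by (intro mult_left_mono) auto
  also have "\<dots> \<le> real q" using assms(3) by simp
  finally have x: "c \<le> real q / pairs d" using C(1) by (simp add: le_divide_eq)
  define b where "b = (1 - 1 / c)\<^sup>2 / 2"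
  have b: "0 < b" using assms by (simp add: b_def)
  have "1 / (real q / pairs d) \<le> 1 / c" using x assms by (intro divide_left_mono mult_pos_pos) auto
  then have "1 - 1 / c \<le> 1 - 1 / (real q / pairs d)" by simp
  then have "(1 - 1 / c)\<^sup>2 \<le> (1 - 1 / (real q / pairs d))\<^sup>2" using assms by (intro power_mono) auto
  then have "b \<le> gain (real q / pairs d)" using gain_ge[of "real q / pairs d"] x assms by (simp add: b_def)
  then have "14 * pairs d * ln (real n) / gain (real q / pairs d) \<le> 7 * (real d)\<^sup>2 * ln (real n) / b"
    using assms b by (intro bound_via) auto
  also have "\<dots> = (14 / (1 - 1 / c)\<^sup>2) * ((real d)\<^sup>2 * ln (real n))" by (simp add: b_def)
  finally show ?thesis .
qed

text \<open>The denominator in \<open>bound_quadratic'\<close> becomes the square of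
  \<open>d powr (2 * \<eta>)\<close>. By \<open>q \<le> 3 * d^2\<close> the numerator contributes
  \<open>9 * d^6\<close>, and 126 = 14 * 9.\<close>

lemma bound_near:
  assumes "2 \<le> d" "0 \<le> \<eta>" "\<eta> < 1" "real q = pairs d + 1 + real d powr (2 * \<eta>)" "0 < n"
  shows "14 * pairs d * ln (real n) / gain (real q / pairs d) \<le> 126 * (real d powr (6 - 4 * \<eta>) * ln (real n))"
proof -
  note C = pairs_bounds[OF assms(1)]
  define r where "r = real d powr (2 * \<eta>)"
  have r: "0 < r" using assms by (simp add: r_def)
  have "r \<le> real d powr 2" unfolding r_def using assms by (intro powr_mono) auto
  then have "r \<le> (real d)\<^sup>2" using assms by (simp add: powr_numeral)
  moreover have "1 \<le> (real d)\<^sup>2" using assms by simp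
  ultimately have "real q \<le> 3 * (real d)\<^sup>2" using C(2) assms(4) by (simp add: r_def)
  then have q2: "(real q)\<^sup>2 \<le> (3 * (real d)\<^sup>2)\<^sup>2" by (intro power_mono) auto
  have r2: "r\<^sup>2 = real d powr (4 * \<eta>)"
    by (simp add: r_def power2_eq_square flip: powr_add)
  have "14 * pairs d * ln (real n) / gain (real q / pairs d) \<le> 14 * ((real q)\<^sup>2 * (real d)\<^sup>2 * ln (real n) / (real q - pairs d - 1)\<^sup>2)"
    using assms r by (intro bound_quadratic') (auto simp: r_def)
  also have "real q - pairs d - 1 = r" using assms by (simp add: r_def)
  also have "14 * ((real q)\<^sup>2 * (real d)\<^sup>2 * ln (real n) / r\<^sup>2) \<le> 14 * ((3 * (real d)\<^sup>2)\<^sup>2 * (real d)\<^sup>2 * ln (real n) / r\<^sup>2)"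
    using q2 assms by (intro mult_left_mono divide_right_mono mult_right_mono) auto
  also have "\<dots> = 126 * (real d ^ 6 / r\<^sup>2 * ln (real n))" by (simp add: power_mult_distrib flip: power_mult power_add)
  also have "real d ^ 6 / r\<^sup>2 = real d powr (6 - 4 * \<eta>)"
    using assms by (simp add: r2 powr_diff powr_numeral)
  finally show ?thesis .
qed

text \<open>Now \<open>x = q^2 / pairs d \<ge> q \<ge> d\<close>, so
  \<open>gain x \<ge> ln d / 16\<close>. The maximum with 1 is absorbed because
  \<open>d \<le> q < n\<close> gives \<open>ln n / ln d \<ge> 1\<close>. The factor
  \<open>q * q\<close> bounds the number \<open>q^2 / p\<close> of second-stage maps.\<close>

lemma bound_smallest:
  assumes "2 \<le> d" "real q = pairs d + 2" "q < n"
  shows "real (q * q) * max 1 (14 * pairs d * ln (real n) / gain (real (q * q) / pairs d)) \<le>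
      112 * (real d ^ 6 * (ln (real n) / ln d))"
proof -
  note C = pairs_bounds[OF assms(1)]
  have d4: "4 \<le> (real d)\<^sup>2" using assms power_mono[of 2 "real d" 2] by simp
  have qd: "real q \<le> (real d)\<^sup>2" "real d \<le> real q" "pairs d \<le> real q" "2 \<le> real q"
    using C assms d4 by linarith+
  have lnd: "0 < ln (real d)" using assms by simp
  have dn: "real d \<le> real n" using qd assms by linarith
  have ln: "1 \<le> ln (real n) / ln d" using lnd dn assms by simp
  have "real q * pairs d \<le> real q * real q" using qd by (intro mult_left_mono) auto
  then have qq: "real q \<le> real (q * q) / pairs d" using C by (simp add: le_divide_eq)
  have "ln d \<le> ln (real (q * q) / pairs d)" using qd qq assms by (subst ln_le_cancel_iff) auto
  moreover have "2 \<le> real (q * q) / pairs d" using qq qd by linarith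
  ultimately have "ln d / 16 \<le> gain (real (q * q) / pairs d)"
    using gain_ge_ln[of "real (q * q) / pairs d"] by linarith
  then have "14 * pairs d * ln (real n) / gain (real (q * q) / pairs d) \<le> 7 * (real d)\<^sup>2 * ln (real n) / (ln d / 16)"
    using lnd assms by (intro bound_via) auto
  also have "\<dots> = 112 * (real d)\<^sup>2 * (ln (real n) / ln d)" by simp
  finally have 1: "14 * pairs d * ln (real n) / gain (real (q * q) / pairs d) \<le> 112 * (real d)\<^sup>2 * (ln (real n) / ln d)" .
  have "1 * 1 \<le> 112 * (real d)\<^sup>2 * (ln (real n) / ln d)" using d4 ln by (intro mult_mono) auto
  with 1 have "max 1 (14 * pairs d * ln (real n) / gain (real (q * q) / pairs d)) \<le> 112 * (real d)\<^sup>2 * (ln (real n) / ln d)"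
    by simp
  note max = this
  have "real (q * q) * max 1 (14 * pairs d * ln (real n) / gain (real (q * q) / pairs d))
      \<le> ((real d)\<^sup>2 * (real d)\<^sup>2) * (112 * (real d)\<^sup>2 * (ln (real n) / ln d))"
  proof (rule mult_mono)
    show "real (q * q) \<le> (real d)\<^sup>2 * (real d)\<^sup>2" unfolding of_nat_mult using qd by (intro mult_mono) auto
  qed (use max in auto)
  also have "\<dots> = 112 * (real d ^ 6 * (ln (real n) / ln d))" by (simp add: algebra_simps flip: power_add)
  finally show ?thesis .
qed

section \<open>Extending a linear table\<close>

notation Seq (infixr ";;" 60)

text \<open>Carry-free addition of \<open>v\<close> is tabulated once per column in the array \<open>S\<close>, since a digitwise
  addition per table entry would cost a factor \<open>e\<close>. The entry at \<open>a\<close> is obtained from the one at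
  \<open>a - b\<close>, \<open>b = p ^ i\<close>, by a cyclic increment of digit \<open>i\<close>.\<close>

definition add_perm_entry :: com where
  "add_perm_entry =
     Assign ''t'' (Elem ''S'' (Minus (Var ''a'') (Var ''b''))) ;;
     Store ''S'' (Var ''a'')
       (Plus (Times (Div (Var ''t'') (Var ''c'')) (Var ''c''))
          (Mod (Plus (Var ''t'') (Var ''b'')) (Var ''c'')))"

definition add_perm_block :: com where
  "add_perm_block =
     Assign ''c'' (Times (Var ''b'') (Var ''p'')) ;;
     for_loop ''a'' (Var ''b'') ''c'' add_perm_entry ;;
     Assign ''b'' (Var ''c'')"

definition add_perm :: com where
  "add_perm =
     Store ''S'' (Const 0) (Var ''v'') ;;
     Assign ''b'' (Const 1) ;;
     While (Less (Var ''b'') (Var ''R'')) add_perm_block"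

text \<open>The potential charges 9 per new entry: 4 for the entry and 5 for the overhead of its
  block, which has at least one entry.\<close>

lemma runs_add_perm:
  assumes p: "1 < p" and s: "vars s ''p'' = p" "vars s ''R'' = p ^ e" "vars s ''v'' = v"
    and v: "v < p ^ e" and W: "2 * p ^ e < W"
  shows "runs W add_perm s (9 * p ^ e) (\<lambda>s'. same {''a'', ''b'', ''c'', ''t''} {''S''} s s' \<and>
    (\<forall>a<p ^ e. arrs s' ''S'' a < p ^ e \<and>
      (\<forall>j<e. dig p (arrs s' ''S'' a) j = (dig p a j + dig p v j) mod p)))"
proof -
  define ok where "ok f a \<longleftrightarrow> f a < p ^ e \<and>
      (\<forall>j<e. dig p (f a) j = (dig p a j + dig p v j) mod p)" for f :: "nat \<Rightarrow> nat" and a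
  let ?V = "{''a'', ''b'', ''c'', ''t''}" and ?A = "{''S''}"
  let ?I = "\<lambda>s'. same ?V ?A s s' \<and> (\<exists>i\<le>e. vars s' ''b'' = p ^ i \<and> (\<forall>a<p ^ i. ok (arrs s' ''S'') a))"
  let ?\<phi> = "\<lambda>s'. 9 * (p ^ e - vars s' ''b'')"
  have "0 < p ^ e" using p by simp
  then have R: "9 * (p ^ e - 1) + 1 \<le> 9 * p ^ e - 1 - 1" "1 \<le> 9 * p ^ e - 1" by linarith+
  have le: "p ^ i \<le> p ^ e" if "i \<le> e" for i using that p by (simp add: power_increasing)
  have fin: "(\<forall>a<p ^ e. ok (arrs s' ''S'') a) \<and> same ?V ?A s s'"
    if "?I s'" "\<not> bval (Less (Var ''b'') (Var ''R'')) s'" for s'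
  proof -
    from that obtain i where i: "i \<le> e" "vars s' ''b'' = p ^ i" "\<forall>a<p ^ i. ok (arrs s' ''S'') a" "same ?V ?A s s'"
      by blast
    with that(2) s have "p ^ e \<le> p ^ i" by (simp add: same_var[OF i(4)])
    then have "p ^ i = p ^ e" using le[OF i(1)] by simp
    with i show ?thesis by simp
  qed
  have step: "runs W add_perm_block s1 (4 + (p ^ Suc i - p ^ i) * 4)
      (\<lambda>s'. same ?V ?A s s' \<and> vars s' ''b'' = p ^ Suc i \<and> (\<forall>a<p ^ Suc i. ok (arrs s' ''S'') a))"
    if I: "same ?V ?A s s1" "vars s1 ''b'' = p ^ i" "\<forall>a<p ^ i. ok (arrs s1 ''S'') a" "i < e" for s1 i
  proof -
    note vs = same_var[OF I(1)]
    define s2 where "s2 = set_var ''c'' (p ^ Suc i) s1"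
    have pi: "p ^ i < p ^ Suc i" "p ^ Suc i \<le> p ^ e" using p le[of "Suc i"] \<open>i < e\<close> by simp_all
    have "runs W (for_loop ''a'' (Var ''b'') ''c'' add_perm_entry ;;
        Assign ''b'' (Var ''c'')) s2 (3 + (p ^ Suc i - p ^ i) * 4)
      (\<lambda>s'. same ?V ?A s s' \<and> vars s' ''b'' = p ^ Suc i \<and> (\<forall>a<p ^ Suc i. ok (arrs s' ''S'') a))"
    proof (rule runs_Seq[where Ta = "2 + (p ^ Suc i - p ^ i) * (2 + 2)" and Tb = 1])
      let ?J = "\<lambda>k s'. same ?V ?A s s' \<and> vars s' ''b'' = p ^ i \<and> (\<forall>a<k. ok (arrs s' ''S'') a)"
      show "runs W (for_loop ''a'' (Var ''b'') ''c'' add_perm_entry)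
         s2 (2 + (p ^ Suc i - p ^ i) * (2 + 2)) (\<lambda>s'. ?J (p ^ Suc i) s' \<and> vars s' ''c'' = p ^ Suc i)"
      proof (rule runs_for[where I = ?J and l = "p ^ i" and h = "p ^ Suc i" and T = 2])
        show "?J (p ^ i) (set_var ''a'' (p ^ i) s2)"
          using I by (simp add: s2_def ok_def)
        fix k s' assume k: "p ^ i \<le> k" "k < p ^ Suc i" and J: "?J k s'"
          and a: "vars s' ''a'' = k" "vars s' ''c'' = p ^ Suc i"
        define t where "t = arrs s' ''S'' (k - p ^ i)"
        define t' where "t' = t div p ^ Suc i * p ^ Suc i + (t + p ^ i) mod p ^ Suc i"
        have "k - p ^ i < k" using k(1) p by (intro diff_less) (auto intro: less_le_trans[OF _ k(1)])
        then have "ok (arrs s' ''S'') (k - p ^ i)" using J by blast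
        then have t: "t < p ^ e" "\<And>j. j < e \<Longrightarrow> dig p t j = (dig p (k - p ^ i) j + dig p v j) mod p"
          by (simp_all add: ok_def t_def)
        have t': "t' < p ^ e" unfolding t'_def
          using dig_cyclic_add(2)[OF p t(1) \<open>i < e\<close>] .
        have "dig p t' j = (dig p k j + dig p v j) mod p" if "j < e" for j
          using dig_cyclic_add(1)[OF p, of t i j, folded t'_def] t(2)[OF that]
            dig_add_power[OF p, of "k - p ^ i" i j] k
          by (cases "j = i") (simp_all add: mod_Suc_eq)
        moreover have "t div p ^ Suc i * p ^ Suc i < W"
          using div_times_less_eq_dividend[of t "p ^ Suc i"] t(1) W by linarith
        ultimately show "runs W add_perm_entry
            s' 2 (\<lambda>s''. vars s'' ''a'' = k \<and> vars s'' ''c'' = p ^ Suc i \<and> ?J (Suc k) (set_var ''a'' (Suc k) s''))"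
          using J a k t t' W pi
          by (simp add: add_perm_entry_def t_def[symmetric] t'_def[symmetric] ok_def less_Suc_eq del: power_Suc)
      qed (use I W pi le[of i] in \<open>simp_all add: s2_def del: power_Suc\<close>)
    qed (use pi W in simp_all)
    moreover have pW: "p ^ i < W" "p < W" using le[of i] le[of 1] \<open>i < e\<close> W by simp_all
    ultimately show ?thesis using I pi W vs s unfolding s2_def
      by (simp add: add_perm_block_def mult.commute pW)
  qed
  have "runs W (While (Less (Var ''b'') (Var ''R''))
       add_perm_block) (set_var ''b'' 1 (set_arr ''S'' 0 v s)) (9 * p ^ e - 1 - 1)
     (\<lambda>s'. (\<forall>a<p ^ e. ok (arrs s' ''S'') a) \<and> same ?V ?A s s')"
  proof (rule runs_While[where I = ?I and \<phi> = ?\<phi>])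
    show "?I (set_var ''b'' 1 (set_arr ''S'' 0 v s))"
      using v by (auto simp: ok_def dig_def intro!: exI[of _ 0])
    show "bfits W (Less (Var ''b'') (Var ''R'')) s'" if "?I s'" for s'
    proof -
      from that obtain i where i: "i \<le> e" "vars s' ''b'' = p ^ i" "same ?V ?A s s'" by blast
      then show ?thesis using W s le[OF i(1)] by (simp add: same_var[OF i(3)])
    qed
    show "?\<phi> (set_var ''b'' 1 (set_arr ''S'' 0 v s)) + 1 \<le> 9 * p ^ e - 1 - 1" using R by simp
    fix s1 assume "?I s1" "bval (Less (Var ''b'') (Var ''R'')) s1"
    then obtain i where i: "i \<le> e" "vars s1 ''b'' = p ^ i" "same ?V ?A s s1" "\<forall>a<p ^ i. ok (arrs s1 ''S'') a"
      and lt: "p ^ i < p ^ e" using s by (auto simp: agree_def)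
    have "i < e" using lt p by simp
    have pi: "p ^ i < p ^ Suc i" "p ^ Suc i \<le> p ^ e" using p le[of "Suc i"] \<open>i < e\<close> by simp_all
    show "\<exists>T. runs W add_perm_block s1 T (\<lambda>s'. ?I s' \<and> T + 1 + ?\<phi> s' \<le> ?\<phi> s1)"
    proof (rule exI, rule runs_mono[OF step[OF i(3,2,4) \<open>i < e\<close>]])
      fix s' assume *: "same ?V ?A s s' \<and> vars s' ''b'' = p ^ Suc i \<and> (\<forall>a<p ^ Suc i. ok (arrs s' ''S'') a)"
      have "4 + (p ^ Suc i - p ^ i) * 4 + 1 + 9 * (p ^ e - p ^ Suc i) \<le> 9 * (p ^ e - p ^ i)"
        using pi by (simp del: power_Suc)
      with * i \<open>i < e\<close> show "?I s' \<and> 4 + (p ^ Suc i - p ^ i) * 4 + 1 + ?\<phi> s' \<le> ?\<phi> s1"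
        by (simp del: power_Suc) (metis Suc_leI)
    qed simp
  qed (use fin in blast)
  then show ?thesis using W v s R
    unfolding add_perm_def by (simp add: ok_def conj_commute)
qed

definition extend :: "vname \<Rightarrow> com" where
  "extend X =
     add_perm ;;
     Assign ''h'' (Times (Var ''P'') (Var ''p'')) ;;
     (Cond (Less (Var ''M'') (Var ''h'')) (Assign ''h'' (Var ''M'')) Skip ;;
      for_loop ''x'' (Var ''P'') ''h''
        (Store X (Var ''x'') (Elem ''S'' (Elem X (Minus (Var ''x'') (Var ''P''))))) ;;
      Assign ''P'' (Times (Var ''P'') (Var ''p'')))"

text \<open>By linearity the new entries are \<open>X (x - p ^ l) + v\<close> without carries, one
  lookup in \<open>S\<close> each. Building \<open>S\<close> costs \<open>9 * p ^ e\<close>, and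
  \<open>e \<le> l\<close> makes this at most proportional to the part of the table already
  present.\<close>

lemma runs_extend:
  assumes p: "1 < p" and s: "vars s ''p'' = p" "vars s ''R'' = p ^ e" "vars s ''v'' = v"
      "vars s ''P'' = p ^ l" "vars s ''M'' = M"
    and v: "v < p ^ e" and l: "e \<le> l" and lM: "p ^ l < M" and M: "M \<le> p ^ L" and X: "X \<noteq> ''S''"
    and lin: "linear_on p e L (p ^ l) (arrs s X)"
    and W: "2 * p ^ e < W" "p * M < W"
  shows "runs W (extend X) s (18 * min M (p ^ Suc l)) (\<lambda>s'.
      same {''a'', ''b'', ''c'', ''t'', ''h'', ''x'', ''P''} {''S'', X} s s' \<and>
      vars s' ''P'' = p ^ Suc l \<and> linear_on p e L (min M (p ^ Suc l)) (arrs s' X) \<and>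
      (\<forall>x<p ^ l. arrs s' X x = arrs s X x) \<and> arrs s' X (p ^ l) = v)"
proof -
  define h where "h = min M (p ^ Suc l)"
  have el: "p ^ e \<le> p ^ l" using l p by (simp add: power_increasing)
  have plh: "p ^ l < h" using lM p by (simp add: h_def)
  have "M \<le> p * M" "1 * M \<le> p * M" "p * p ^ l \<le> p * M" "p * 1 \<le> p * M"
    using p lM by (auto intro!: mult_le_mono simp del: One_nat_def)
  moreover have "h \<le> M" by (simp add: h_def)
  ultimately have MW: "M < W" "p * p ^ l < W" "p ^ l < W" "h < W" "p < W"
    using W(2) lM by linarith+
  let ?V = "{''a'', ''b'', ''c'', ''t'', ''h'', ''x'', ''P''}" and ?A = "{''S'', X}"
  let ?copy = "for_loop ''x'' (Var ''P'') ''h'' (Store X (Var ''x'') (Elem ''S'' (Elem X (Minus (Var ''x'') (Var ''P'')))))"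
  let ?post = "\<lambda>s'. same ?V ?A s s' \<and> vars s' ''P'' = p ^ Suc l \<and> linear_on p e L h (arrs s' X) \<and>
      (\<forall>x<p ^ l. arrs s' X x = arrs s X x) \<and> arrs s' X (p ^ l) = v"
  let ?perm = "\<lambda>s'. \<forall>a<p ^ e. arrs s' ''S'' a < p ^ e \<and>
      (\<forall>j<e. dig p (arrs s' ''S'' a) j = (dig p a j + dig p v j) mod p)"
  have X0: "arrs s X 0 = 0" using lin el p by (simp add: linear_on_def)
  have loop: "runs W (?copy ;;
      Assign ''P'' (Times (Var ''P'') (Var ''p''))) s1 (2 + (h - p ^ l) * (1 + 2) + 1)
      ?post"
    if s1: "same ?V ?A s s1" "vars s1 ''P'' = p ^ l" "vars s1 ''h'' = h" "arrs s1 X = arrs s X" "?perm s1" for s1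
  proof (rule runs_Seq)
    let ?J = "\<lambda>k s'. same ?V ?A s s' \<and> vars s' ''P'' = p ^ l \<and> ?perm s' \<and> linear_on p e L k (arrs s' X) \<and>
      (\<forall>x<p ^ l. arrs s' X x = arrs s X x) \<and> (p ^ l < k \<longrightarrow> arrs s' X (p ^ l) = v)"
    show "runs W (?copy)
        s1 (2 + (h - p ^ l) * (1 + 2)) (?J h)"
    proof (rule runs_for[where I = ?J and l = "p ^ l" and h = h and T = 1])
      show "?J (p ^ l) (set_var ''x'' (p ^ l) s1)" using s1 lin by simp
      fix k s' assume k: "p ^ l \<le> k" "k < h" and J: "?J k s'" and x: "vars s' ''x'' = k" "vars s' ''h'' = h"
      define f where "f = arrs s' X"
      define u where "u = arrs s' ''S'' (f (k - p ^ l))"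
      have "k - p ^ l < k" using k(1) p by (intro diff_less) (auto intro: less_le_trans[OF _ k(1)])
      then have fk: "f (k - p ^ l) < p ^ e" using J by (simp add: linear_on_def f_def)
      then have u: "u < p ^ e" "\<And>j. j < e \<Longrightarrow> dig p u j = (dig p (f (k - p ^ l)) j + dig p v j) mod p"
        using J by (simp_all add: u_def)
      \<comment> \<open>At \<open>k = p ^ l\<close> the lookup is at \<open>X 0 = 0\<close> and
        yields \<open>v\<close> itself; so column \<open>l\<close> of the table is
        \<open>v\<close>.\<close>
      have f': "(f(k := u)) (p ^ l) = v"
      proof (cases "k = p ^ l")
        case True
        then have "f (k - p ^ l) = 0" using J X0 p by (simp add: f_def)
        then have "dig p u j = dig p v j" if "j < e" for j
          using u(2)[OF that] p by (simp add: dig_less)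
        then show ?thesis using u(1) v True by (auto intro: digits_eqI)
      next
        case False
        then show ?thesis using J k by (simp add: f_def)
      qed
      have "linear_on p e L (Suc k) (f(k := u))"
      proof (rule linear_on_extend[OF p l _ k(1)])
        show "linear_on p e L k (f(k := u))"
          by (rule linear_on_cong[of _ _ _ _ f]) (use J f_def in auto)
        show "k < p ^ Suc l" "k < p ^ L" using k M by (auto simp: h_def)
        show "(f(k := u)) k < p ^ e" using u by simp
        show "dig p ((f(k := u)) k) j = (dig p ((f(k := u)) (k - p ^ l)) j + dig p ((f(k := u)) (p ^ l)) j) mod p"
          if "j < e" for j
          using u(2)[OF that] \<open>k - p ^ l < k\<close> unfolding f' by simp
      qed
      then show "runs W (Store X (Var ''x'') (Elem ''S'' (Elem X (Minus (Var ''x'') (Var ''P''))))) s' 1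
         (\<lambda>s''. vars s'' ''x'' = k \<and> vars s'' ''h'' = h \<and> ?J (Suc k) (set_var ''x'' (Suc k) s''))"
        using J x k fk u W MW X f' \<open>k - p ^ l < k\<close>
        by (auto simp: f_def[symmetric] u_def[symmetric])
    qed (use s1 plh MW in auto)
    fix s' assume J: "?J h s'"
    then have "vars s' ''p'' = p" using s by (simp add: agree_def)
    then show "runs W (Assign ''P'' (Times (Var ''P'') (Var ''p''))) s' 1
      ?post"
      using J plh MW by (simp add: mult.commute)
  qed simp
  have t: "9 * p ^ e + (1 + (2 + (2 + (h - p ^ l) * (1 + 2) + 1))) \<le> 18 * h"
    using plh el by simp
  show ?thesis unfolding extend_def h_def[symmetric]
  proof (rule runs_Seq[OF runs_add_perm[OF p s(1-3) v W(1)] _ t])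
    fix s1 assume s1: "same {''a'', ''b'', ''c'', ''t''} {''S''} s s1 \<and> ?perm s1"
    then have s1': "same ?V ?A s s1" "vars s1 ''P'' = p ^ l" "vars s1 ''p'' = p" "vars s1 ''M'' = M"
        "arrs s1 X = arrs s X"
      using s X by (auto simp: agree_def)
    show "runs W (Assign ''h'' (Times (Var ''P'') (Var ''p'')) ;;
       (Cond (Less (Var ''M'') (Var ''h'')) (Assign ''h'' (Var ''M'')) Skip ;;
        ?copy ;;
        Assign ''P'' (Times (Var ''P'') (Var ''p'')))) s1 (1 + (2 + (2 + (h - p ^ l) * (1 + 2) + 1)))
        ?post"
      unfolding runs_Seq_unit
    proof (intro conjI)
      show "runs W
       (Cond (Less (Var ''M'') (Var ''h'')) (Assign ''h'' (Var ''M'')) Skip ;;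
        ?copy ;;
        Assign ''P'' (Times (Var ''P'') (Var ''p''))) (set_var ''h'' (aval (Times (Var ''P'') (Var ''p'')) s1) s1)
        (1 + (2 + (2 + (h - p ^ l) * (1 + 2) + 1)) - 1)
        ?post"
      proof (rule runs_Seq[where R = "\<lambda>s'. same ?V ?A s s' \<and> vars s' ''P'' = p ^ l \<and>
            vars s' ''h'' = h \<and> arrs s' X = arrs s X \<and> ?perm s'" and Ta = 2 and Tb = "2 + (h - p ^ l) * (1 + 2) + 1"])
        show "runs W (Cond (Less (Var ''M'') (Var ''h'')) (Assign ''h'' (Var ''M'')) Skip)
         (set_var ''h'' (aval (Times (Var ''P'') (Var ''p'')) s1) s1) 2
         (\<lambda>s'. same ?V ?A s s' \<and> vars s' ''P'' = p ^ l \<and>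
            vars s' ''h'' = h \<and> arrs s' X = arrs s X \<and> ?perm s')"
          by (rule runs_Cond[where T = 1]) (use s1 s1' MW in \<open>auto simp: h_def mult.commute\<close>)
      qed (rule loop, auto)
    qed (use s1' MW in \<open>auto simp: mult.commute\<close>)
  qed
qed

section \<open>Resetting a table, choosing a lightest column value and updating weights\<close>

definition ident :: "vname \<Rightarrow> com" where
  "ident X = for_loop ''x'' (Const 0) ''M'' (Store X (Var ''x'') (Var ''x''))"

lemma runs_ident:
  assumes "vars s ''M'' = M" "M < W"
  shows "runs W (ident X) s (2 + 3 * M)
    (\<lambda>s'. same {''x''} {X} s s' \<and> (\<forall>x<M. arrs s' X x = x))"
  unfolding ident_def
  by (rule runs_for[where I = "\<lambda>k s'. same {''x''} {X} s s' \<and> (\<forall>x<k. arrs s' X x = x)" and T = 1])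
    (use assms in \<open>auto simp: less_Suc_eq\<close>)

definition lightest :: com where
  "lightest =
     for_loop ''a'' (Const 0) ''R'' (Store ''H'' (Var ''a'') (Const 0)) ;;
     for_loop ''y'' (Const 0) ''P''
       (Store ''H'' (Elem ''T'' (Var ''y''))
         (Plus (Elem ''H'' (Elem ''T'' (Var ''y''))) (Elem ''w'' (Plus (Var ''P'') (Var ''y''))))) ;;
     Assign ''v'' (Const 0) ;;
     for_loop ''a'' (Const 0) ''R''
       (Cond (Less (Elem ''H'' (Var ''a'')) (Elem ''H'' (Var ''v''))) (Assign ''v'' (Var ''a'')) Skip)"

text \<open>\<open>H\<close> is the histogram of the block's weight over the values of
  \<open>T\<close>. The hypothesis \<open>R \<le> P\<close> lets the block pay for clearing and
  scanning it, and the total weight of the block bounds each of its entries.\<close>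

lemma runs_lightest:
  assumes s: "vars s ''R'' = R" "vars s ''P'' = P" and "0 < R" "R \<le> P" "2 * P < W"
    and T: "\<And>y. y < P \<Longrightarrow> arrs s ''T'' y < R"
    and w: "(\<Sum>y<P. arrs s ''w'' (P + y)) < W"
  shows "runs W lightest s (18 * P) (\<lambda>s'. same {''a'', ''y'', ''v''} {''H''} s s' \<and> vars s' ''v'' < R \<and>
    R * (\<Sum>y<P. if arrs s ''T'' y = vars s' ''v'' then arrs s ''w'' (P + y) else 0) \<le> (\<Sum>y<P. arrs s ''w'' (P + y)))"
proof -
  let ?add = "Store ''H'' (Elem ''T'' (Var ''y''))
    (Plus (Elem ''H'' (Elem ''T'' (Var ''y''))) (Elem ''w'' (Plus (Var ''P'') (Var ''y''))))"
  let ?fill = "for_loop ''y'' (Const 0) ''P'' ?add"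
  let ?test = "Cond (Less (Elem ''H'' (Var ''a'')) (Elem ''H'' (Var ''v''))) (Assign ''v'' (Var ''a'')) Skip"
  let ?search = "for_loop ''a'' (Const 0) ''R'' ?test"
  let ?post = "\<lambda>s'. same {''a'', ''y'', ''v''} {''H''} s s' \<and> vars s' ''v'' < R \<and>
    R * (\<Sum>y<P. if arrs s ''T'' y = vars s' ''v'' then arrs s ''w'' (P + y) else 0) \<le> (\<Sum>y<P. arrs s ''w'' (P + y))"
  let ?V = "{''a'', ''y'', ''v''}" and ?A = "{''H''}"
  define w' where "w' y = arrs s ''w'' (P + y)" for y
  define h where "h k a = (\<Sum>y<k. if arrs s ''T'' y = a then w' y else 0)" for k a
  have hW: "h k a < W" if "k \<le> P" for k a
  proof -
    have "h k a \<le> (\<Sum>y<k. w' y)" unfolding h_def by (rule sum_mono) simp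
    also have "\<dots> \<le> (\<Sum>y<P. w' y)" using that by (intro sum_mono2) auto
    finally show ?thesis using w by (simp add: w'_def)
  qed
  have w'W: "w' y < W" if "y < P" for y
  proof -
    have "w' y \<le> (\<Sum>y<P. w' y)" using that by (intro member_le_sum) auto
    then show ?thesis using w by (simp add: w'_def)
  qed
  have RW: "R < W" "P < W" using assms by simp_all
  have 1: "runs W (for_loop ''a'' (Const 0) ''R'' (Store ''H'' (Var ''a'') (Const 0))) s (2 + R * 3)
      (\<lambda>s'. same ?V ?A s s' \<and> (\<forall>a<R. arrs s' ''H'' a = h 0 a))"
    by (rule runs_for[where I = "\<lambda>k s'. same ?V ?A s s' \<and> (\<forall>a<k. arrs s' ''H'' a = h 0 a)" and T = 1])
      (use s RW in \<open>auto simp: less_Suc_eq h_def\<close>)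
  have 2: "runs W (?fill)
       s1 (2 + P * 3) (\<lambda>s'. same ?V ?A s s' \<and> (\<forall>a<R. arrs s' ''H'' a = h P a))"
    if s1: "same ?V ?A s s1 \<and> (\<forall>a<R. arrs s1 ''H'' a = h 0 a)" for s1
  proof (rule runs_for[where I = "\<lambda>k s'. same ?V ?A s s' \<and> (\<forall>a<R. arrs s' ''H'' a = h k a)" and T = 1])
    fix k s' assume k: "k < P" and I: "same ?V ?A s s' \<and> (\<forall>a<R. arrs s' ''H'' a = h k a)" and
      y: "vars s' ''y'' = k" "vars s' ''P'' = P"
    have TT: "arrs s' ''T'' = arrs s ''T''" "arrs s' ''w'' = arrs s ''w''" using I by (auto simp: agree_def)
    have "h k (arrs s ''T'' k) + w' k = h (Suc k) (arrs s ''T'' k)" by (simp add: h_def)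
    moreover have "h (Suc k) a = h k a" if "a \<noteq> arrs s ''T'' k" for a using that by (auto simp: h_def)
    ultimately show "runs W ?add
         s' 1 (\<lambda>s''. vars s'' ''y'' = k \<and> vars s'' ''P'' = P \<and>
            same ?V ?A s (set_var ''y'' (Suc k) s'') \<and> (\<forall>a<R. arrs (set_var ''y'' (Suc k) s'') ''H'' a = h (Suc k) a))"
      using I y TT T[OF k] hW[of k] hW[of "Suc k" "arrs s ''T'' k"] w'W[OF k] k RW assms(5)
      by (auto simp: w'_def[symmetric])
  qed (use s1 s RW in \<open>auto simp: agree_def\<close>)
  have 3: "runs W (?search)
       s1 (2 + R * 4) (\<lambda>s'. same ?V ?A s s' \<and> vars s' ''v'' < R \<and> (\<forall>a<R. h P (vars s' ''v'') \<le> h P a))"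
    if s1: "same ?V ?A s s1 \<and> (\<forall>a<R. arrs s1 ''H'' a = h P a)" "vars s1 ''v'' = 0" for s1
  proof (rule runs_for[where I = "\<lambda>k s'. same ?V ?A s s' \<and> (\<forall>a<R. arrs s' ''H'' a = h P a) \<and>
      vars s' ''v'' < R \<and> (\<forall>a<k. h P (vars s' ''v'') \<le> h P a)" and T = 2])
    fix k s' assume "k < R" "same ?V ?A s s' \<and> (\<forall>a<R. arrs s' ''H'' a = h P a) \<and>
      vars s' ''v'' < R \<and> (\<forall>a<k. h P (vars s' ''v'') \<le> h P a)" "vars s' ''a'' = k" "vars s' ''R'' = R"
    then show "runs W ?test
       s' 2 (\<lambda>s''. vars s'' ''a'' = k \<and> vars s'' ''R'' = R \<and>
         same ?V ?A s (set_var ''a'' (Suc k) s'') \<and> (\<forall>a<R. arrs (set_var ''a'' (Suc k) s'') ''H'' a = h P a) \<and>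
      vars (set_var ''a'' (Suc k) s'') ''v'' < R \<and> (\<forall>a<Suc k. h P (vars (set_var ''a'' (Suc k) s'') ''v'') \<le> h P a))"
      using RW hW[of P]
      by (intro runs_Cond[where T = 1]) (auto simp: less_Suc_eq intro: order_trans less_imp_le)
  qed (use s1 s RW \<open>0 < R\<close> in \<open>auto simp: agree_def\<close>)
  show ?thesis unfolding lightest_def
  proof (rule runs_Seq[OF 1, where Tb = "3 + P * 3 + (2 + R * 4)"])
    fix s1 assume s1: "same ?V ?A s s1 \<and> (\<forall>a<R. arrs s1 ''H'' a = h 0 a)"
    show "runs W (?fill ;;
     Assign ''v'' (Const 0) ;;
     ?search)
     s1 (3 + P * 3 + (2 + R * 4)) ?post"
    proof (rule runs_Seq[OF 2[OF s1], where Tb = "1 + (2 + R * 4)"])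
      fix s2 assume s2: "same ?V ?A s s2 \<and> (\<forall>a<R. arrs s2 ''H'' a = h P a)"
      have "runs W (?search)
       (set_var ''v'' 0 s2) (2 + R * 4) ?post"
      proof (rule runs_mono[OF 3 order_refl])
        fix s' assume s': "same ?V ?A s s' \<and> vars s' ''v'' < R \<and> (\<forall>a<R. h P (vars s' ''v'') \<le> h P a)"
        then have "R * h P (vars s' ''v'') \<le> (\<Sum>y<P. w' y)"
          by (intro lightest_bucket[of P "arrs s ''T''"] T) (auto simp: h_def)
        with s' show "?post s'"
          unfolding h_def w'_def by simp
      qed (use s2 in auto)
      then show "runs W (Assign ''v'' (Const 0) ;; ?search)
       s2 (1 + (2 + R * 4)) ?post"
        using RW by simp
    qed simp
  qed (use assms in simp)
qed

definition reweight :: com where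
  "reweight =
     for_loop ''y'' (Const 0) ''P''
       (Assign ''t'' (Elem ''w'' (Plus (Var ''P'') (Var ''y''))) ;;
        Cond (Conj (Neg (Less (Elem ''T'' (Var ''y'')) (Var ''v''))) (Neg (Less (Var ''v'') (Elem ''T'' (Var ''y'')))))
          (Store ''w'' (Plus (Var ''P'') (Var ''y''))
             (Plus (Div (Times (Times (Var ''t'') (Var ''Q'')) (Var ''Q'')) (Var ''D'')) (Const 1)) ;;
           Store ''K'' (Plus (Var ''P'') (Var ''y'')) (Plus (Elem ''K'' (Plus (Var ''P'') (Var ''y''))) (Const 1)))
          (Store ''w'' (Plus (Var ''P'') (Var ''y''))
             (Plus (Div (Times (Times (Var ''t'') (Var ''C'')) (Var ''Q'')) (Var ''D'')) (Const 1))))"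

lemma runs_reweight:
  assumes s: "vars s ''P'' = P" "vars s ''v'' = v" "vars s ''C'' = C" "vars s ''Q'' = Q" "vars s ''D'' = D"
    and "0 < Q" "C \<le> Q" and W: "2 * P < W" "v < W" "D < W" "B * Q * Q + 1 < W"
    and T: "\<And>y. y < P \<Longrightarrow> arrs s ''T'' y < W"
    and w: "\<And>y. y < P \<Longrightarrow> arrs s ''w'' (P + y) \<le> B" and K: "\<And>y. y < P \<Longrightarrow> arrs s ''K'' (P + y) + 1 < W"
    and "1 \<le> B"
  shows "runs W reweight s (2 + 6 * P) (\<lambda>s'. same {''y'', ''t''} {''w'', ''K''} s s' \<and>
    (\<forall>z. arrs s' ''w'' z = (if P \<le> z \<and> z < P + P then
        if arrs s ''T'' (z - P) = v then arrs s ''w'' z * Q * Q div D + 1 else arrs s ''w'' z * C * Q div D + 1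
      else arrs s ''w'' z)) \<and>
    (\<forall>z. arrs s' ''K'' z = (if P \<le> z \<and> z < P + P \<and> arrs s ''T'' (z - P) = v
      then arrs s ''K'' z + 1 else arrs s ''K'' z)))"
  unfolding reweight_def
proof (rule runs_for[where T = 4 and I = "\<lambda>k s'. same {''y'', ''t''} {''w'', ''K''} s s' \<and>
    (\<forall>z. arrs s' ''w'' z = (if P \<le> z \<and> z < P + k then
        if arrs s ''T'' (z - P) = v then arrs s ''w'' z * Q * Q div D + 1 else arrs s ''w'' z * C * Q div D + 1
      else arrs s ''w'' z)) \<and>
    (\<forall>z. arrs s' ''K'' z = (if P \<le> z \<and> z < P + k \<and> arrs s ''T'' (z - P) = v
      then arrs s ''K'' z + 1 else arrs s ''K'' z))"])
  fix k s'
  assume k: "k < P" and y: "vars s' ''y'' = k" "vars s' ''P'' = P"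
    and I: "same {''y'', ''t''} {''w'', ''K''} s s' \<and>
    (\<forall>z. arrs s' ''w'' z = (if P \<le> z \<and> z < P + k then
        if arrs s ''T'' (z - P) = v then arrs s ''w'' z * Q * Q div D + 1 else arrs s ''w'' z * C * Q div D + 1
      else arrs s ''w'' z)) \<and>
    (\<forall>z. arrs s' ''K'' z = (if P \<le> z \<and> z < P + k \<and> arrs s ''T'' (z - P) = v
      then arrs s ''K'' z + 1 else arrs s ''K'' z))"
  define b where "b = arrs s ''w'' (P + k)"
  have fr: "arrs s' ''T'' = arrs s ''T''" "vars s' ''v'' = v" "vars s' ''C'' = C" "vars s' ''Q'' = Q" "vars s' ''D'' = D"
    using I s by (auto simp: agree_def)
  have at: "arrs s' ''w'' (P + k) = b" "arrs s' ''K'' (P + k) = arrs s ''K'' (P + k)" using I by (simp_all add: b_def)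
  have bB: "b \<le> B" using w[OF k] by (simp add: b_def)
  \<comment> \<open>\<open>reweight\<close> multiplies before it divides, so the intermediate
    products must be words too; \<open>B * Q * Q\<close> dominates them all.\<close>
  have "b * C \<le> b * Q" "b * Q \<le> b * Q * Q" "Q \<le> B * Q * Q" "b \<le> b * Q"  "b * Q * Q \<le> B * Q * Q"
    "b * C * Q \<le> b * Q * Q"
    using \<open>0 < Q\<close> \<open>C \<le> Q\<close> \<open>1 \<le> B\<close> bB by (auto simp: mult_le_mono)
  moreover have "b * Q * Q div D \<le> b * Q * Q" "b * C * Q div D \<le> b * C * Q" by simp_all
  ultimately have bW: "b * C < W" "b * Q < W" "Q < W" "C < W" "b < W" "b * Q * Q < W" "b * C * Q < W"
     "Suc (b * Q * Q div D) < W" "Suc (b * C * Q div D) < W" "Suc 0 < W"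
    using W \<open>C \<le> Q\<close> by linarith+
  show "runs W (Assign ''t'' (Elem ''w'' (Plus (Var ''P'') (Var ''y''))) ;;
        Cond (Conj (Neg (Less (Elem ''T'' (Var ''y'')) (Var ''v''))) (Neg (Less (Var ''v'') (Elem ''T'' (Var ''y'')))))
          (Store ''w'' (Plus (Var ''P'') (Var ''y''))
             (Plus (Div (Times (Times (Var ''t'') (Var ''Q'')) (Var ''Q'')) (Var ''D'')) (Const 1)) ;;
           Store ''K'' (Plus (Var ''P'') (Var ''y'')) (Plus (Elem ''K'' (Plus (Var ''P'') (Var ''y''))) (Const 1)))
          (Store ''w'' (Plus (Var ''P'') (Var ''y''))
             (Plus (Div (Times (Times (Var ''t'') (Var ''C'')) (Var ''Q'')) (Var ''D'')) (Const 1)))) s' 4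
     (\<lambda>s''. vars s'' ''y'' = k \<and> vars s'' ''P'' = P \<and>
       same {''y'', ''t''} {''w'', ''K''} s (set_var ''y'' (Suc k) s'') \<and>
    (\<forall>z. arrs (set_var ''y'' (Suc k) s'') ''w'' z = (if P \<le> z \<and> z < P + Suc k then
        if arrs s ''T'' (z - P) = v then arrs s ''w'' z * Q * Q div D + 1 else arrs s ''w'' z * C * Q div D + 1
      else arrs s ''w'' z)) \<and>
    (\<forall>z. arrs (set_var ''y'' (Suc k) s'') ''K'' z = (if P \<le> z \<and> z < P + Suc k \<and> arrs s ''T'' (z - P) = v
      then arrs s ''K'' z + 1 else arrs s ''K'' z)))"
    unfolding runs_Seq_unit
  proof (intro conjI, goal_cases)
    case 3
    show ?case
      by (rule runs_Cond[where T = 2])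
        (use y fr at bW W T[OF k] K[OF k] k I in \<open>auto simp: b_def[symmetric] less_Suc_eq\<close>)
  qed (use y fr at bW W k in simp_all)
qed (use s W in auto)

section \<open>The greedy phase\<close>

text \<open>\<open>P\<close> is used as a point: for \<open>P = p ^ l\<close> its image is column
  \<open>l\<close> of the table.\<close>

definition collisions :: "(nat \<Rightarrow> nat) list \<Rightarrow> nat \<Rightarrow> nat \<Rightarrow> nat" where
  "collisions Ts P y = length (filter (\<lambda>T. T y = T P) Ts)"

lemma collisions_simps [simp]:
  "collisions [] P y = 0"
  "collisions (T # Ts) P y = collisions Ts P y + (if T y = T P then 1 else 0)"
  by (simp_all add: collisions_def)

lemma collisions_le: "collisions Ts P y \<le> length Ts"
  by (simp add: collisions_def)

text \<open>\<open>w\<close>, \<open>K\<close> and \<open>N\<close> persist from round to round,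
  while \<open>T\<close> is rebuilt from the identity.\<close>

definition greedy :: com where
  "greedy =
     Assign ''N'' (Plus (Var ''N'') (Const 1)) ;;
     Assign ''R'' (Var ''Q'') ;;
     Assign ''M'' (Var ''n'') ;;
     ident ''T'' ;;
     Assign ''P'' (Var ''R'') ;;
     While (Less (Var ''P'') (Var ''M'')) (lightest ;; reweight ;; extend ''T'')"

text \<open>\<open>NM\<close> will bound the number of rounds. The last assumption on
  \<open>W\<close> leaves room for multiplying a weight, which is at most
  \<open>n * (NM + 1)\<close>, by \<open>Q * Q\<close>.\<close>

locale greedy_params =
  fixes n p C E Q D W NM :: nat
  assumes p: "prime p" and C: "0 < C" "C < Q" and Q: "Q = p ^ E" and D: "D = C * Q + Q - C"
    and n: "0 < n"
    and W: "2 * Q < W" "p * n < W" "2 * n < W" "D < W" "n * (NM + 2) * Q * Q + 1 < W"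
begin

text \<open>A block \<open>P = p ^ l\<close> holds the pairs with highest digit position \<open>l\<close>: entry \<open>P + u\<close> of the arrays
  \<open>w\<close> and \<open>K\<close> contains the weight and the number of collisions \<open>T u = T P\<close>.\<close>

definition block :: "nat \<Rightarrow> bool" where
  "block P \<longleftrightarrow> (\<exists>l\<ge>E. P = p ^ l \<and> P < n)"

text \<open>In the last bound, 1 is the initial weight of a pair and \<open>length Ts\<close> its
  rounding units. The lower bound ignores rounding, which only increases weights.\<close>

definition weighted :: "(nat \<Rightarrow> nat) list \<Rightarrow> (nat \<Rightarrow> nat) \<Rightarrow> (nat \<Rightarrow> nat) \<Rightarrow> nat \<Rightarrow> bool" where
  "weighted Ts wa ka P \<longleftrightarrow>
     (\<forall>y<P. ka (P + y) = collisions Ts P y \<and>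
       (real (C * Q) / real D) ^ length Ts * (real Q / real C) ^ collisions Ts P y \<le> real (wa (P + y))) \<and>
     (\<Sum>y<P. wa (P + y)) \<le> P * (1 + length Ts)"

text \<open>\<open>check\<close> scans all indices below \<open>2 * n\<close>, including those in no
  block; zeros there cannot prolong the loop.\<close>

definition outside_zero :: "(nat \<Rightarrow> nat) \<Rightarrow> bool" where
  "outside_zero ka \<longleftrightarrow> (\<forall>z. (\<forall>P. block P \<longrightarrow> \<not> (P \<le> z \<and> z < P + P)) \<longrightarrow> ka z = 0)"

lemma p1: "1 < p"
  using p by (rule prime_gt_1_nat)

lemma weighted_cong:
  assumes "weighted Ts wa ka P" and "\<And>y. y < P \<Longrightarrow> wa' (P + y) = wa (P + y)"
    and "\<And>y. y < P \<Longrightarrow> ka' (P + y) = ka (P + y)"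
    and "length Ts' = length Ts" and "\<And>y. y < P \<Longrightarrow> collisions Ts' P y = collisions Ts P y"
  shows "weighted Ts' wa' ka' P"
  using assms by (simp add: weighted_def)

text \<open>\<open>T P\<close> is the chosen column value, so colliding with \<open>P\<close> means
  lying in the light bucket. \<open>potential_step\<close> bounds the total; the lower bound
  survives because \<open>x div D + 1\<close> is at least the exact quotient.\<close>

lemma weighted_step:
  assumes "weighted Ts wa ka P"
    and light: "Q * (\<Sum>y<P. if T y = T P then wa (P + y) else 0) \<le> (\<Sum>y<P. wa (P + y))"
    and wa': "\<And>y. y < P \<Longrightarrow> wa' (P + y) =
      (if T y = T P then wa (P + y) * Q * Q div D + 1 else wa (P + y) * C * Q div D + 1)"
    and ka': "\<And>y. y < P \<Longrightarrow> ka' (P + y) = (if T y = T P then ka (P + y) + 1 else ka (P + y))"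
  shows "weighted (T # Ts) wa' ka' P"
  unfolding weighted_def
proof (intro conjI allI impI)
  have Dpos: "0 < D" using C D by simp
  show "(\<Sum>y<P. wa' (P + y)) \<le> P * (1 + length (T # Ts))"
    using potential_step[OF C(2,1) D light wa'] assms(1) by (simp add: weighted_def)
  fix y assume y: "y < P"
  show "ka' (P + y) = collisions (T # Ts) P y"
    using ka'[OF y] assms(1) y by (simp add: weighted_def)
  define a where "a = real (C * Q) / real D"
  define b where "b = real Q / real C"
  let ?c = "collisions Ts P y" and ?k = "length Ts"
  have IH: "a ^ ?k * b ^ ?c \<le> real (wa (P + y))" using assms(1) y by (simp add: weighted_def a_def b_def)
  have div: "real x / real D \<le> real (x div D + 1)" for x
  proof -
    have "x \<le> D * (x div D + 1)" using dividend_less_times_div[OF Dpos, of x] by simp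
    then have "real x \<le> real D * real (x div D + 1)" unfolding of_nat_mult[symmetric] of_nat_le_iff .
    then show ?thesis using Dpos by (simp add: divide_le_eq mult.commute)
  qed
  have "a ^ length (T # Ts) * b ^ collisions (T # Ts) P y
      = a * (if T y = T P then b else 1) * (a ^ ?k * b ^ ?c)" by simp
  also have "\<dots> \<le> a * (if T y = T P then b else 1) * real (wa (P + y))"
    by (rule mult_left_mono[OF IH]) (simp add: a_def b_def)
  also have "\<dots> \<le> real (wa' (P + y))"
  proof (cases "T y = T P")
    case True
    have "a * b * real (wa (P + y)) = real (wa (P + y) * Q * Q) / real D"
      using C by (simp add: a_def b_def)
    then show ?thesis using div[of "wa (P + y) * Q * Q"] True wa'[OF y] by simp
  next
    case False
    have "a * real (wa (P + y)) = real (wa (P + y) * C * Q) / real D"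
      by (simp add: a_def)
    then show ?thesis using div[of "wa (P + y) * C * Q"] False wa'[OF y] by simp
  qed
  finally show "(real (C * Q) / real D) ^ length (T # Ts) * (real Q / real C) ^ collisions (T # Ts) P y
      \<le> real (wa' (P + y))" unfolding a_def b_def .
qed

lemma blocks_disjoint: "l < l' \<Longrightarrow> p ^ l + p ^ l \<le> p ^ l'"
proof -
  assume "l < l'"
  then have "p ^ Suc l \<le> p ^ l'" using p1 by (intro power_increasing) auto
  moreover have "2 * p ^ l \<le> p * p ^ l" using p1 by (intro mult_right_mono) auto
  ultimately show ?thesis unfolding power_Suc by linarith
qed

definition env :: "state \<Rightarrow> bool" where
  "env s \<longleftrightarrow> vars s ''p'' = p \<and> vars s ''R'' = Q \<and> vars s ''Q'' = Q \<and> vars s ''C'' = C \<and> vars s ''D'' = D \<and>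
     vars s ''M'' = n"

text \<open>In the middle of a round: the blocks below \<open>p ^ l\<close> already count the new
  table, the others only the completed rounds \<open>Ts\<close>.\<close>

definition step_inv :: "(nat \<Rightarrow> nat) list \<Rightarrow> nat \<Rightarrow> state \<Rightarrow> bool" where
  "step_inv Ts l s \<longleftrightarrow> E \<le> l \<and> vars s ''P'' = p ^ l \<and> linear_on p E n (min n (p ^ l)) (arrs s ''T'') \<and>
     (\<forall>P. block P \<longrightarrow> weighted (if P < p ^ l then arrs s ''T'' # Ts else Ts) (arrs s ''w'') (arrs s ''K'') P) \<and>
     outside_zero (arrs s ''K'')"

lemma n_le: "n \<le> p ^ n"
  using power_gt_expt[of p n] p1 by simp

text \<open>The values of \<open>T\<close> below \<open>P = p ^ l\<close> are settled when
  \<open>T P\<close> is chosen, so the choice decides exactly the collisions of block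
  \<open>P\<close>. All other blocks are either done or depend on a later column; hence a local
  minimum suffices.\<close>

lemma runs_greedy_step:
  assumes env: "env s" and I: "step_inv Ts l s" and ln: "p ^ l < n" and k: "length Ts < NM"
  shows "runs W (lightest ;; reweight ;; extend ''T'') s (44 * min n (p ^ Suc l))
    (\<lambda>s'. same {''a'', ''y'', ''v'', ''t'', ''b'', ''c'', ''h'', ''x'', ''P''} {''H'', ''w'', ''K'', ''S'', ''T''} s s' \<and>
      step_inv Ts (Suc l) s')"
proof -
  let ?V = "{''a'', ''y'', ''v'', ''t'', ''b'', ''c'', ''h'', ''x'', ''P''}"
  let ?A = "{''H'', ''w'', ''K'', ''S'', ''T''}"
  define P where "P = p ^ l"
  define T where "T = arrs s ''T''"
  define wa where "wa = arrs s ''w''"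
  define ka where "ka = arrs s ''K''"
  have El: "E \<le> l" and sP: "vars s ''P'' = P" and lin: "linear_on p E n P T"
    and wt: "\<And>P'. block P' \<Longrightarrow> weighted (if P' < P then T # Ts else Ts) wa ka P'" and oz: "outside_zero ka"
    using I ln by (auto simp: step_inv_def P_def T_def wa_def ka_def)
  have P: "block P" "0 < P" "P < n" using El ln p1 by (auto simp: block_def P_def)
  have QP: "0 < Q" "Q \<le> P" using C El p1 by (auto simp: Q P_def power_increasing)
  have TQ: "T y < Q" if "y < P" for y using lin that by (simp add: linear_on_def Q)
  have wtP: "weighted Ts wa ka P" using wt[OF P(1)] by simp
  \<comment> \<open>A single weight is at most the total of its block, which is at most
    \<open>P * (1 + length Ts) \<le> B\<close>.\<close>
  define B where "B = n * (NM + 1)"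
  have sum: "(\<Sum>y<P. wa (P + y)) \<le> B"
  proof -
    have "(\<Sum>y<P. wa (P + y)) \<le> P * (1 + length Ts)" using wtP by (simp add: weighted_def)
    also have "\<dots> \<le> B" unfolding B_def using P k by (intro mult_le_mono) auto
    finally show ?thesis .
  qed
  have BQ: "B \<le> B * Q * Q" "B * Q * Q + 1 < W" "NM + 2 < W"
  proof -
    show "B \<le> B * Q * Q" using QP by simp
    have "B * Q * Q \<le> n * (NM + 2) * Q * Q" unfolding B_def by (intro mult_le_mono) auto
    then show "B * Q * Q + 1 < W" using W by linarith
    have "NM + 2 = 1 * (NM + 2) * 1 * 1" by simp
    also have "\<dots> \<le> n * (NM + 2) * Q * Q" using QP n by (intro mult_le_mono) auto
    also have "\<dots> < W" using W(5) by (rule add_lessD1)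
    finally show "NM + 2 < W" .
  qed
  have sumW: "(\<Sum>y<P. arrs s ''w'' (P + y)) < W"
    using sum BQ(1,2) unfolding wa_def by linarith
  define \<mu> where "\<mu> = min n (p ^ Suc l)"
  have \<mu>: "P \<le> \<mu>" using P p1 by (simp add: \<mu>_def P_def)
  have 1: "runs W lightest s (18 * P) (\<lambda>s'. same {''a'', ''y'', ''v''} {''H''} s s' \<and> vars s' ''v'' < Q \<and>
    Q * (\<Sum>y<P. if T y = vars s' ''v'' then wa (P + y) else 0) \<le> (\<Sum>y<P. wa (P + y)))"
    unfolding T_def wa_def
    by (rule runs_lightest) (use env sP QP W P TQ sumW in \<open>auto simp: env_def T_def\<close>)
  show ?thesis unfolding \<mu>_def[symmetric]
  proof (rule runs_Seq[OF 1])
    fix s1 assume s1: "same {''a'', ''y'', ''v''} {''H''} s s1 \<and> vars s1 ''v'' < Q \<and>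
      Q * (\<Sum>y<P. if T y = vars s1 ''v'' then wa (P + y) else 0) \<le> (\<Sum>y<P. wa (P + y))"
    then have a1: "same {''a'', ''y'', ''v''} {''H''} s s1" by blast
    define v where "v = vars s1 ''v''"
    have s1': "vars s1 ''P'' = P" "vars s1 ''C'' = C" "vars s1 ''Q'' = Q" "vars s1 ''D'' = D"
      "arrs s1 ''T'' = T" "arrs s1 ''w'' = wa" "arrs s1 ''K'' = ka"
      using a1 env sP by (simp_all add: agree_def env_def T_def wa_def ka_def)
    have v: "v < Q" and light: "Q * (\<Sum>y<P. if T y = v then wa (P + y) else 0) \<le> (\<Sum>y<P. wa (P + y))"
      using s1 by (auto simp: v_def)
    define wa' where "wa' z = (if P \<le> z \<and> z < P + P then
        if T (z - P) = v then wa z * Q * Q div D + 1 else wa z * C * Q div D + 1 else wa z)" for z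
    define ka' where "ka' z = (if P \<le> z \<and> z < P + P \<and> T (z - P) = v then ka z + 1 else ka z)" for z
    have 2: "runs W reweight s1 (2 + 6 * P) (\<lambda>s'. same {''y'', ''t''} {''w'', ''K''} s1 s' \<and>
        (\<forall>z. arrs s' ''w'' z = wa' z) \<and> (\<forall>z. arrs s' ''K'' z = ka' z))"
      unfolding wa'_def ka'_def s1'(5-7)[symmetric]
    proof (rule runs_reweight[where B = B])
      show "arrs s1 ''w'' (P + y) \<le> B" if "y < P" for y
      proof -
        have "wa (P + y) \<le> (\<Sum>y<P. wa (P + y))" using that by (intro member_le_sum) auto
        then show ?thesis using sum s1' by simp
      qed
      show "arrs s1 ''K'' (P + y) + 1 < W" if "y < P" for y
      proof -
        have "ka (P + y) \<le> length Ts" using wtP that collisions_le by (simp add: weighted_def)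
        then show ?thesis using s1' BQ k by simp
      qed
      show "arrs s1 ''T'' y < W" if "y < P" for y using TQ[OF that] W s1' by simp
    qed (use s1' QP C W P v BQ n in \<open>auto simp: v_def B_def\<close>)
    show "runs W (reweight ;; extend ''T'') s1 (2 + 6 * P + 18 * \<mu>)
      (\<lambda>s'. same ?V ?A s s' \<and> step_inv Ts (Suc l) s')"
    proof (rule runs_Seq[OF 2])
      fix s2 assume s2: "same {''y'', ''t''} {''w'', ''K''} s1 s2 \<and>
        (\<forall>z. arrs s2 ''w'' z = wa' z) \<and> (\<forall>z. arrs s2 ''K'' z = ka' z)"
      then have a2: "same {''y'', ''t''} {''w'', ''K''} s1 s2" by blast
      have s2': "vars s2 ''p'' = p" "vars s2 ''R'' = p ^ E" "vars s2 ''v'' = v" "vars s2 ''P'' = p ^ l"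
          "vars s2 ''M'' = n" "arrs s2 ''T'' = T"
        using a1 a2 s1' env by (simp_all add: agree_def env_def v_def flip: Q P_def)
      have s2'': "arrs s2 ''w'' = wa'" "arrs s2 ''K'' = ka'" using s2 by blast+
      have ext: "runs W (extend ''T'') s2 (18 * \<mu>) (\<lambda>s'.
          same {''a'', ''b'', ''c'', ''t'', ''h'', ''x'', ''P''} {''S'', ''T''} s2 s' \<and>
          vars s' ''P'' = p ^ Suc l \<and> linear_on p E n \<mu> (arrs s' ''T'') \<and>
          (\<forall>x<p ^ l. arrs s' ''T'' x = arrs s2 ''T'' x) \<and> arrs s' ''T'' (p ^ l) = v)"
        unfolding \<mu>_def
        by (rule runs_extend[OF p1 s2'(1-5)])
          (use v El ln n_le lin W s2'(6) in \<open>simp_all add: P_def flip: Q\<close>)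
      show "runs W (extend ''T'') s2 (18 * \<mu>) (\<lambda>s'. same ?V ?A s s' \<and> step_inv Ts (Suc l) s')"
      proof (rule runs_mono[OF ext order_refl])
        fix s3 assume s3: "same {''a'', ''b'', ''c'', ''t'', ''h'', ''x'', ''P''} {''S'', ''T''} s2 s3 \<and>
          vars s3 ''P'' = p ^ Suc l \<and> linear_on p E n \<mu> (arrs s3 ''T'') \<and>
          (\<forall>x<p ^ l. arrs s3 ''T'' x = arrs s2 ''T'' x) \<and> arrs s3 ''T'' (p ^ l) = v"
        then have a3: "same {''a'', ''b'', ''c'', ''t'', ''h'', ''x'', ''P''} {''S'', ''T''} s2 s3" by blast
        define T' where "T' = arrs s3 ''T''"
        have T': "\<And>x. x < P \<Longrightarrow> T' x = T x" "T' P = v" using s3 s2'(6) by (simp_all add: T'_def P_def)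
        have s3': "arrs s3 ''w'' = wa'" "arrs s3 ''K'' = ka'" using a3 s2'' by (simp_all add: agree_def)
        have "weighted (if P' < p ^ Suc l then T' # Ts else Ts) wa' ka' P'" if "block P'" for P'
        proof -
          from that obtain l' where l': "E \<le> l'" "P' = p ^ l'" by (auto simp: block_def)
          have iff: "P' < p ^ Suc l \<longleftrightarrow> l' \<le> l" using p1 unfolding l' by (subst power_strict_increasing_iff) auto
          \<comment> \<open>Disjointness of the blocks: reweighting \<open>P\<close> leaves every
            other block unchanged.\<close>
          have off: "wa' (P' + y) = wa (P' + y)" "ka' (P' + y) = ka (P' + y)" if "l' \<noteq> l" "y < P'" for y
          proof -
            have "\<not> (P \<le> P' + y \<and> P' + y < P + P)"
            proof (cases "l < l'")
              case True
              from blocks_disjoint[OF this] show ?thesis by (simp add: P_def l')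
            next
              case False
              then have "l' < l" using that by simp
              from blocks_disjoint[OF this] that show ?thesis by (simp add: P_def l')
            qed
            then show "wa' (P' + y) = wa (P' + y)" "ka' (P' + y) = ka (P' + y)" by (auto simp: wa'_def ka'_def)
          qed
          consider "l' < l" | "l' = l" | "l < l'" by linarith
          then show ?thesis
          proof cases
            case 1
            \<comment> \<open>A finished block looks only at arguments up to \<open>P' < P\<close>,
              where the extended table agrees with the old one.\<close>
            then have P'P: "P' < P" using p1 by (simp add: l' P_def)
            have "weighted (T' # Ts) wa' ka' P'"
            proof (rule weighted_cong)
              show "weighted (T # Ts) wa ka P'" using wt[OF that] P'P by simp
              show "collisions (T' # Ts) P' y = collisions (T # Ts) P' y" if "y < P'" for y
                using T'(1)[of y] T'(1)[of P'] that P'P by simp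
            qed (use off 1 in auto)
            then show ?thesis using 1 iff by simp
          next
            case 2
            then have "P' = P" using l' by (simp add: P_def)
            moreover have "weighted (T' # Ts) wa' ka' P"
            proof (rule weighted_step[OF wtP])
              have "(\<Sum>y<P. if T' y = T' P then wa (P + y) else 0) = (\<Sum>y<P. if T y = v then wa (P + y) else 0)"
                by (rule sum.cong) (auto simp: T')
              then show "Q * (\<Sum>y<P. if T' y = T' P then wa (P + y) else 0) \<le> (\<Sum>y<P. wa (P + y))"
                using light by simp
            qed (simp_all add: wa'_def ka'_def T')
            ultimately show ?thesis using iff 2 by simp
          next
            case 3
            then have "\<not> P' < P" using blocks_disjoint[OF 3] l' by (simp add: P_def)
            then have "weighted Ts wa ka P'" using wt[OF that] by simp
            then have "weighted Ts wa' ka' P'"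
              by (rule weighted_cong) (use off 3 in auto)
            then show ?thesis using 3 iff by simp
          qed
        qed
        moreover have "outside_zero ka'" using oz P(1) by (auto simp: outside_zero_def ka'_def)
        ultimately have "step_inv Ts (Suc l) s3"
          unfolding step_inv_def s3' T'_def[symmetric] using El s3 by (simp add: T'_def \<mu>_def)
        moreover have "same ?V ?A s s3"
          using a1 a2 a3 by (simp add: agree_def)
        ultimately show "same ?V ?A s s3 \<and> step_inv Ts (Suc l) s3" by blast
      qed
    qed simp
  qed (use \<mu> P in simp)
qed

text \<open>The blocks grow geometrically; this is the decrease of the potential that pays for one of them.\<close>

lemma amortize:
  fixes X Y :: nat
  assumes "X + X \<le> Y" "0 < X" "X < n"
  shows "44 * min n Y + 1 + (if Y < n then 46 * (3 * n - 2 * Y) else 0) \<le> 46 * (3 * n - 2 * X)"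
  using assms by (cases "Y < n") simp_all

lemma NM_less: "NM + 2 < W"
proof -
  have "NM + 2 = 1 * (NM + 2) * 1 * 1" by simp
  also have "\<dots> \<le> n * (NM + 2) * Q * Q" using n C by (intro mult_le_mono) auto
  also have "\<dots> < W" using W(5) by (rule add_lessD1)
  finally show ?thesis .
qed

lemma runs_greedy:
  assumes s: "vars s ''p'' = p" "vars s ''Q'' = Q" "vars s ''C'' = C" "vars s ''D'' = D" "vars s ''n'' = n"
      "vars s ''N'' = length Ts"
    and k: "length Ts < NM"
    and wt: "\<And>P. block P \<Longrightarrow> weighted Ts (arrs s ''w'') (arrs s ''K'') P" and oz: "outside_zero (arrs s ''K'')"
  shows "runs W greedy s (150 * n)
    (\<lambda>s'. same {''N'', ''R'', ''M'', ''a'', ''y'', ''v'', ''t'', ''b'', ''c'', ''h'', ''x'', ''P''}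
        {''H'', ''w'', ''K'', ''S'', ''T''} s s' \<and>
      vars s' ''N'' = Suc (length Ts) \<and> linear_on p E n n (arrs s' ''T'') \<and>
      (\<forall>P. block P \<longrightarrow> weighted (arrs s' ''T'' # Ts) (arrs s' ''w'') (arrs s' ''K'') P) \<and>
      outside_zero (arrs s' ''K''))"
proof -
  let ?V = "{''a'', ''y'', ''v'', ''t'', ''b'', ''c'', ''h'', ''x'', ''P''}"
  let ?V' = "{''N'', ''R'', ''M'', ''a'', ''y'', ''v'', ''t'', ''b'', ''c'', ''h'', ''x'', ''P''}"
  let ?A = "{''H'', ''w'', ''K'', ''S'', ''T''}"
  let ?Q = "\<lambda>s'. same ?V' ?A s s' \<and>
      vars s' ''N'' = Suc (length Ts) \<and> linear_on p E n n (arrs s' ''T'') \<and>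
      (\<forall>P. block P \<longrightarrow> weighted (arrs s' ''T'' # Ts) (arrs s' ''w'') (arrs s' ''K'') P) \<and>
      outside_zero (arrs s' ''K'')"
  let ?W = "While (Less (Var ''P'') (Var ''M'')) (lightest ;; reweight ;; extend ''T'')"
  define s0 where "s0 = s\<lparr>vars := (vars s)(''N'' := Suc (length Ts), ''R'' := Q, ''M'' := n)\<rparr>"
  have s0: "same ?V' ?A s s0" "env s0" "vars s0 ''N'' = Suc (length Ts)" "arrs s0 = arrs s"
    using s by (simp_all add: s0_def env_def)
  have nW: "n < W" "Q < W" using W by simp_all
  have loop: "runs W ?W s1 (138 * n + 1) ?Q"
    if s1: "same ?V ?A s0 s1" "step_inv Ts E s1" for s1
  proof (rule runs_While[where I = "\<lambda>s'. same ?V ?A s0 s' \<and> (\<exists>l. step_inv Ts l s') \<and> vars s' ''P'' < W"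
        and \<phi> = "\<lambda>s'. if vars s' ''P'' < n then 46 * (3 * n - 2 * vars s' ''P'') else 0"])
    have en: "env s'" if "same ?V ?A s0 s'" for s'
      using that s0(2) by (simp add: env_def agree_def)
    then have M: "vars s' ''M'' = n" if "same ?V ?A s0 s'" for s'
      using that by (simp add: env_def)
    show "same ?V ?A s0 s1 \<and> (\<exists>l. step_inv Ts l s1) \<and> vars s1 ''P'' < W"
    proof -
      have "vars s1 ''P'' = Q" using s1(2) by (simp add: step_inv_def flip: Q)
      with s1 nW show ?thesis by auto
    qed
    show "bfits W (Less (Var ''P'') (Var ''M'')) s'"
      if "same ?V ?A s0 s' \<and> (\<exists>l. step_inv Ts l s') \<and> vars s' ''P'' < W" for s'
      using that M[of s'] nW by simp
    show "?Q s'" if I: "same ?V ?A s0 s' \<and> (\<exists>l. step_inv Ts l s') \<and> vars s' ''P'' < W"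
      and b: "\<not> bval (Less (Var ''P'') (Var ''M'')) s'" for s'
    proof -
      from I obtain l where l: "step_inv Ts l s'" by blast
      have "n \<le> p ^ l" using b M[of s'] I l by (simp add: step_inv_def)
      moreover have "P < p ^ l" if "block P" for P using that \<open>n \<le> p ^ l\<close> by (auto simp: block_def)
      moreover have "same ?V' ?A s s'" "vars s' ''N'' = Suc (length Ts)"
        using I s0 by (simp_all add: agree_def)
      ultimately show ?thesis using l by (simp add: step_inv_def min_absorb1)
    qed
    show "(if vars s1 ''P'' < n then 46 * (3 * n - 2 * vars s1 ''P'') else 0) + 1 \<le> 138 * n + 1" by auto
    fix s' assume I: "same ?V ?A s0 s' \<and> (\<exists>l. step_inv Ts l s') \<and> vars s' ''P'' < W"
      and b: "bval (Less (Var ''P'') (Var ''M'')) s'"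
    from I obtain l where l: "step_inv Ts l s'" by blast
    then have P: "vars s' ''P'' = p ^ l" by (simp add: step_inv_def)
    have ln: "p ^ l < n" using b M[of s'] I P by simp
    show "\<exists>T. runs W (lightest ;; reweight ;; extend ''T'') s' T (\<lambda>s''.
        (same ?V ?A s0 s'' \<and> (\<exists>l. step_inv Ts l s'') \<and> vars s'' ''P'' < W) \<and>
        T + 1 + (if vars s'' ''P'' < n then 46 * (3 * n - 2 * vars s'' ''P'') else 0)
          \<le> (if vars s' ''P'' < n then 46 * (3 * n - 2 * vars s' ''P'') else 0))"
    proof (rule exI, rule runs_mono[OF runs_greedy_step[OF _ l ln k] order_refl])
      show "env s'" using en I by blast
      fix s'' assume s'': "same ?V ?A s' s'' \<and> step_inv Ts (Suc l) s''"
      then have P': "vars s'' ''P'' = p ^ Suc l" by (simp add: step_inv_def)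
      have "same ?V ?A s0 s''" using I s'' by (simp add: agree_def)
      moreover have "p ^ Suc l < W"
      proof -
        have "p * p ^ l \<le> p * n" using ln by simp
        with W(2) show ?thesis unfolding power_Suc by linarith
      qed
      moreover have "44 * min n (p ^ Suc l) + 1 + (if p ^ Suc l < n then 46 * (3 * n - 2 * p ^ Suc l) else 0)
          \<le> 46 * (3 * n - 2 * p ^ l)"
        by (rule amortize) (use ln blocks_disjoint[of l "Suc l"] p1 in auto)
      ultimately show "(same ?V ?A s0 s'' \<and> (\<exists>l. step_inv Ts l s'') \<and> vars s'' ''P'' < W) \<and>
        44 * min n (p ^ Suc l) + 1 + (if vars s'' ''P'' < n then 46 * (3 * n - 2 * vars s'' ''P'') else 0)
          \<le> (if vars s' ''P'' < n then 46 * (3 * n - 2 * vars s' ''P'') else 0)"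
        using s'' unfolding P P' if_P[OF ln] by blast
    qed
  qed
  have rest: "runs W (ident ''T'' ;; Assign ''P'' (Var ''R'') ;; ?W) s0 (2 + 3 * n + (1 + (138 * n + 1))) ?Q"
  proof (rule runs_Seq[OF runs_ident[of _ n]])
    fix s1 assume s1: "same {''x''} {''T''} s0 s1 \<and> (\<forall>x<n. arrs s1 ''T'' x = x)"
    then have R: "vars s1 ''R'' = Q" using s0(2) by (simp add: env_def agree_def)
    have "arrs s1 ''w'' = arrs s ''w''" "arrs s1 ''K'' = arrs s ''K''"
      using s1 s0(4) by (simp_all add: agree_def)
    moreover have "\<not> P < p ^ E" if "block P" for P
      using that p1 by (auto simp: block_def not_less power_increasing)
    moreover have "linear_on p E n (min n (p ^ E)) (arrs s1 ''T'')"
      using s1 n_le by (intro linear_on_id[OF p1]) auto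
    ultimately have "step_inv Ts E (set_var ''P'' Q s1)"
      using wt oz by (simp add: step_inv_def flip: Q)
    moreover have "same ?V ?A s0 (set_var ''P'' Q s1)" using s1 by (simp add: agree_def)
    ultimately have "runs W ?W (set_var ''P'' Q s1) (138 * n + 1) ?Q" by (intro loop)
    then show "runs W (Assign ''P'' (Var ''R'') ;; ?W) s1 (1 + (138 * n + 1)) ?Q"
      using R nW by simp
  qed (use s0(2) nW in \<open>simp_all add: env_def\<close>)
  have "runs W (ident ''T'' ;; Assign ''P'' (Var ''R'') ;; ?W) s0 (150 * n - 1 - 1 - 1) ?Q"
    by (rule runs_mono[OF rest]) (use n in auto)
  moreover have "1 \<le> 150 * n - 1" "1 \<le> 150 * n - 1 - 1" using n by linarith+
  ultimately show ?thesis
    unfolding greedy_def using s nW NM_less k n by (simp add: s0_def)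
qed

end

section \<open>Output through Hankel tables\<close>

definition inner_table :: com where
  "inner_table =
     ident ''G'' ;;
     Assign ''P'' (Var ''R'') ;;
     Assign ''B'' (Var ''A'') ;;
     While (Less (Var ''P'') (Var ''M''))
       (Assign ''v'' (Mod (Var ''B'') (Var ''R'')) ;;
        Assign ''B'' (Div (Var ''B'') (Var ''p'')) ;;
        extend ''G'')"

text \<open>Column \<open>e + i\<close> consists of the digits \<open>i, \<dots>, i + e - 1\<close> of \<open>A\<close>, hence a Hankel matrix.\<close>

definition hankel :: "nat \<Rightarrow> nat \<Rightarrow> nat \<Rightarrow> nat \<Rightarrow> nat \<Rightarrow> (nat \<Rightarrow> nat) \<Rightarrow> bool" where
  "hankel p e L m A X \<longleftrightarrow> linear_on p e L m X \<and>
     (\<forall>i. p ^ (e + i) < m \<longrightarrow> X (p ^ (e + i)) = A div p ^ i mod p ^ e)"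

lemma amortize_inner:
  fixes X Y n :: nat
  assumes "X + X \<le> Y" "0 < X" "X < n"
  shows "2 + 18 * min n Y + 1 + (if Y < n then 21 * (3 * n - 2 * Y) else 0) \<le> 21 * (3 * n - 2 * X)"
  using assms by (cases "Y < n") simp_all

text \<open>After \<open>i\<close> columns \<open>B\<close> is \<open>A\<close> without its
  \<open>i\<close> lowest digits, so \<open>B mod p ^ e\<close> is the next Hankel column. The time
  is again a geometric series.\<close>

lemma runs_inner_table:
  assumes p: "1 < p" and s: "vars s ''p'' = p" "vars s ''R'' = p ^ e" "vars s ''M'' = m" "vars s ''A'' = A"
    and m: "m \<le> p ^ L" "0 < m" and W: "2 * p ^ e < W" "p * m < W" "A < W"
  shows "runs W inner_table s (66 * m + 5) (\<lambda>s'.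
    same {''x'', ''P'', ''B'', ''v'', ''a'', ''b'', ''c'', ''t'', ''h''} {''S'', ''G''} s s' \<and>
    hankel p e L m A (arrs s' ''G''))"
proof -
  let ?V = "{''x'', ''P'', ''B'', ''v'', ''a'', ''b'', ''c'', ''t'', ''h''}" and ?A = "{''S'', ''G''}"
  let ?body = "Assign ''v'' (Mod (Var ''B'') (Var ''R'')) ;; Assign ''B'' (Div (Var ''B'') (Var ''p'')) ;; extend ''G''"
  let ?W = "While (Less (Var ''P'') (Var ''M'')) ?body"
  let ?Q = "\<lambda>s'. same ?V ?A s s' \<and> hankel p e L m A (arrs s' ''G'')"
  have "1 * m \<le> p * m" "p * 1 \<le> p * m" using p m by (auto intro!: mult_le_mono simp del: One_nat_def)
  then have W': "m < W" "p < W" "p ^ e < W" using W by linarith+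
  define J where "J i s' \<longleftrightarrow> same ?V ?A s s' \<and> vars s' ''P'' = p ^ (e + i) \<and> vars s' ''B'' = A div p ^ i \<and>
      linear_on p e L (min m (p ^ (e + i))) (arrs s' ''G'') \<and>
      (\<forall>j<i. p ^ (e + j) < m \<longrightarrow> arrs s' ''G'' (p ^ (e + j)) = A div p ^ j mod p ^ e)" for i s'
  have step: "runs W ?body s1 (2 + 18 * min m (p ^ Suc (e + i))) (J (Suc i))"
    if J: "J i s1" and lt: "p ^ (e + i) < m" for i s1
  proof -
    define s2 where "s2 = s1\<lparr>vars := (vars s1)(''v'' := A div p ^ i mod p ^ e, ''B'' := A div p ^ Suc i)\<rparr>"
    have s1: "vars s1 ''p'' = p" "vars s1 ''R'' = p ^ e" "vars s1 ''M'' = m" "vars s1 ''P'' = p ^ (e + i)"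
        "vars s1 ''B'' = A div p ^ i"
      using J s by (simp_all add: J_def agree_def)
    have lin: "linear_on p e L (p ^ (e + i)) (arrs s2 ''G'')"
      using J lt by (simp add: J_def s2_def)
    have "runs W (extend ''G'') s2 (18 * min m (p ^ Suc (e + i))) (J (Suc i))"
    proof (rule runs_mono[OF runs_extend[OF p _ _ _ _ _ _ _ lt m(1) _ lin] order_refl])
      fix s3 assume s3: "same {''a'', ''b'', ''c'', ''t'', ''h'', ''x'', ''P''} {''S'', ''G''} s2 s3 \<and>
        vars s3 ''P'' = p ^ Suc (e + i) \<and> linear_on p e L (min m (p ^ Suc (e + i))) (arrs s3 ''G'') \<and>
        (\<forall>x<p ^ (e + i). arrs s3 ''G'' x = arrs s2 ''G'' x) \<and>
        arrs s3 ''G'' (p ^ (e + i)) = A div p ^ i mod p ^ e"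
      have "arrs s3 ''G'' (p ^ (e + j)) = A div p ^ j mod p ^ e" if "j < Suc i" "p ^ (e + j) < m" for j
      proof (cases "j = i")
        case False
        then have "p ^ (e + j) < p ^ (e + i)" using that p by simp
        then show ?thesis using s3 J that False by (simp add: J_def s2_def)
      qed (use s3 in simp)
      moreover have "same ?V ?A s s3" "vars s3 ''B'' = A div p ^ Suc i"
        using s3 J by (simp_all add: J_def s2_def agree_def)
      ultimately show "J (Suc i) s3" using s3 by (simp add: J_def)
    qed (use s1 p W in \<open>simp_all add: s2_def\<close>)
    moreover have "A div p ^ i < W" by (rule le_less_trans[OF div_le_dividend W(3)])
    moreover have "A div p ^ i mod p ^ e < W" by (rule le_less_trans[OF mod_less_eq_dividend \<open>A div p ^ i < W\<close>])
    moreover have "A div p ^ i div p = A div p ^ Suc i" by (simp only: power_Suc2 div_mult2_eq)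
    ultimately show ?thesis using s1 W W' by (simp add: s2_def)
  qed
  have loop: "runs W ?W s1 (63 * m + 1) ?Q" if "J 0 s1" for s1
  proof (rule runs_While[where I = "\<lambda>s'. (\<exists>i. J i s') \<and> vars s' ''P'' < W"
        and \<phi> = "\<lambda>s'. if vars s' ''P'' < m then 21 * (3 * m - 2 * vars s' ''P'') else 0"])
    have M: "vars s' ''M'' = m" if "J i s'" for s' i
      using that s by (simp add: J_def agree_def)
    have "vars s1 ''P'' < W" using that W' by (simp add: J_def)
    with that show "(\<exists>i. J i s1) \<and> vars s1 ''P'' < W" by blast
    show "bfits W (Less (Var ''P'') (Var ''M'')) s'" if "(\<exists>i. J i s') \<and> vars s' ''P'' < W" for s'
      using that M W' by auto
    show "(if vars s1 ''P'' < m then 21 * (3 * m - 2 * vars s1 ''P'') else 0) + 1 \<le> 63 * m + 1" by auto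
    show "?Q s'" if I: "(\<exists>i. J i s') \<and> vars s' ''P'' < W" and b: "\<not> bval (Less (Var ''P'') (Var ''M'')) s'" for s'
    proof -
      from I obtain i where i: "J i s'" by blast
      with b M[OF i] have le: "m \<le> p ^ (e + i)" by (simp add: J_def)
      have "j < i" if "p ^ (e + j) < m" for j
      proof (rule ccontr)
        assume "\<not> j < i"
        then have "p ^ (e + i) \<le> p ^ (e + j)" using p by (intro power_increasing) auto
        with le that show False by simp
      qed
      with i le show ?thesis by (simp add: J_def hankel_def min_absorb1)
    qed
    fix s' assume I: "(\<exists>i. J i s') \<and> vars s' ''P'' < W" and b: "bval (Less (Var ''P'') (Var ''M'')) s'"
    from I obtain i where i: "J i s'" by blast
    then have P: "vars s' ''P'' = p ^ (e + i)" by (simp add: J_def)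
    have lt: "p ^ (e + i) < m" using b M[OF i] P by simp
    show "\<exists>T. runs W ?body s' T (\<lambda>s''. ((\<exists>i. J i s'') \<and> vars s'' ''P'' < W) \<and>
      T + 1 + (if vars s'' ''P'' < m then 21 * (3 * m - 2 * vars s'' ''P'') else 0)
      \<le> (if vars s' ''P'' < m then 21 * (3 * m - 2 * vars s' ''P'') else 0))"
    proof (rule exI, rule runs_mono[OF step[OF i lt] order_refl])
      fix s'' assume J: "J (Suc i) s''"
      then have P': "vars s'' ''P'' = p * p ^ (e + i)" by (simp add: J_def)
      have "p * p ^ (e + i) \<le> p * m" using lt by simp
      then have "p * p ^ (e + i) < W" using W by linarith
      moreover have "p ^ (e + i) + p ^ (e + i) \<le> p * p ^ (e + i)"
        using mult_le_mono1[of 2 p "p ^ (e + i)"] p by linarith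
      then have "2 + 18 * min m (p ^ Suc (e + i)) + 1 + (if p * p ^ (e + i) < m then 21 * (3 * m - 2 * (p * p ^ (e + i))) else 0)
         \<le> 21 * (3 * m - 2 * p ^ (e + i))"
        unfolding power_Suc using lt p by (intro amortize_inner) auto
      ultimately show "((\<exists>i. J i s'') \<and> vars s'' ''P'' < W) \<and>
        2 + 18 * min m (p ^ Suc (e + i)) + 1 + (if vars s'' ''P'' < m then 21 * (3 * m - 2 * vars s'' ''P'') else 0)
        \<le> (if vars s' ''P'' < m then 21 * (3 * m - 2 * vars s' ''P'') else 0)"
        using J unfolding P P' if_P[OF lt] by blast
    qed
  qed
  show ?thesis unfolding inner_table_def
  proof (rule runs_Seq[OF runs_ident[OF s(3) W'(1)], where Tb = "63 * m + 3"])
    fix s1 assume s1: "same {''x''} {''G''} s s1 \<and> (\<forall>x<m. arrs s1 ''G'' x = x)"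
    define s2 where "s2 = s1\<lparr>vars := (vars s1)(''P'' := p ^ e, ''B'' := A)\<rparr>"
    have "linear_on p e L (min m (p ^ e)) (arrs s1 ''G'')"
      using s1 m by (intro linear_on_id[OF p]) auto
    then have "J 0 s2" using s1 by (simp add: J_def s2_def agree_def)
    then have "runs W ?W s2 (63 * m + 1) ?Q" by (rule loop)
    moreover have "vars s1 ''R'' = p ^ e" "vars s1 ''A'' = A" using s1 s by (simp_all add: agree_def)
    ultimately show "runs W (Assign ''P'' (Var ''R'') ;; Assign ''B'' (Var ''A'') ;; ?W) s1 (63 * m + 3) ?Q"
      using W W' by (simp add: s2_def numeral_3_eq_3)
  qed simp
qed

definition emit_row :: com where
  "emit_row = for_loop ''x'' (Const 0) ''n'' (Emit (Elem ''G'' (Elem ''T'' (Var ''x''))))"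

lemma runs_emit_row:
  assumes "vars s ''n'' = n" "n < W" and "\<And>x. x < n \<Longrightarrow> arrs s ''T'' x < W"
    and "\<And>x. x < n \<Longrightarrow> arrs s ''G'' (arrs s ''T'' x) < W"
  shows "runs W emit_row s (2 + 3 * n) (\<lambda>s'. agree {''x''} (vars s) (vars s') \<and> arrs s' = arrs s \<and>
    outp s' = outp s @ map (\<lambda>x. arrs s ''G'' (arrs s ''T'' x)) [0..<n])"
  unfolding emit_row_def
  by (rule runs_for[where T = 1 and I = "\<lambda>k s'. agree {''x''} (vars s) (vars s') \<and> arrs s' = arrs s \<and>
      outp s' = outp s @ map (\<lambda>x. arrs s ''G'' (arrs s ''T'' x)) [0..<k]"])
    (use assms in auto)

text \<open>\<open>M\<close> is lowered to \<open>m\<close> because the second stage acts on values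
  of \<open>T\<close>. If \<open>m \<le> q\<close>, the loop of \<open>inner_table\<close> stops at
  once and \<open>G\<close> is the identity; so the construction with \<open>Q = q\<close> and
  \<open>L = 1\<close> uses the same code.\<close>

definition emit_all :: com where
  "emit_all =
     Assign ''R'' (Var ''q'') ;;
     Assign ''M'' (Var ''m'') ;;
     for_loop ''A'' (Const 0) ''L'' (inner_table ;; emit_row)"

text \<open>Rebuilding \<open>G\<close> costs O(m); by \<open>m \<le> n\<close> the following row of
  \<open>n\<close> outputs pays for it.\<close>

lemma runs_emit_all:
  assumes p: "1 < p" and s: "vars s ''p'' = p" "vars s ''q'' = p ^ e" "vars s ''m'' = m" "vars s ''n'' = n"
      "vars s ''L'' = N"
    and m: "0 < m" "m \<le> n" "m \<le> p ^ L" and W: "2 * p ^ e < W" "p * n < W" "N < W"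
    and T: "\<And>x. x < n \<Longrightarrow> arrs s ''T'' x < m" and N: "0 < N"
  shows "runs W emit_all s (90 * (N * n)) (\<lambda>s'.
    agree {''R'', ''M'', ''A'', ''x'', ''P'', ''B'', ''v'', ''a'', ''b'', ''c'', ''t'', ''h''} (vars s) (vars s') \<and>
    agree {''S'', ''G''} (arrs s) (arrs s') \<and>
    (\<exists>G. (\<forall>A<N. hankel p e L m A (G A)) \<and>
      outp s' = outp s @ concat (map (\<lambda>A. map (\<lambda>x. G A (arrs s ''T'' x)) [0..<n]) [0..<N])))"
proof -
  let ?V = "{''R'', ''M'', ''A'', ''x'', ''P'', ''B'', ''v'', ''a'', ''b'', ''c'', ''t'', ''h''}"
  let ?A = "{''S'', ''G''}"
  let ?out = "\<lambda>G k. outp s @ concat (map (\<lambda>A. map (\<lambda>x. G A (arrs s ''T'' x)) [0..<n]) [0..<k])"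
  let ?J = "\<lambda>k (s' :: state). agree ?V (vars s) (vars s') \<and> agree ?A (arrs s) (arrs s') \<and> vars s' ''R'' = p ^ e \<and>
    vars s' ''M'' = m \<and> (\<exists>G. (\<forall>A<k. hankel p e L m A (G A)) \<and> outp s' = ?out G k)"
  have "1 * n \<le> p * n" "p * m \<le> p * n" using p m by (auto intro!: mult_le_mono simp del: One_nat_def)
  then have W': "n < W" "p * m < W" "p ^ e < W" "m < W" using W m by linarith+
  define s1 where "s1 = s\<lparr>vars := (vars s)(''R'' := p ^ e, ''M'' := m)\<rparr>"
  have "runs W (for_loop ''A'' (Const 0) ''L'' (inner_table ;; emit_row)) s1 (2 + N * (66 * m + 5 + (2 + 3 * n) + 2))
     (\<lambda>s'. agree ?V (vars s) (vars s') \<and> agree ?A (arrs s) (arrs s') \<and>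
      (\<exists>G. (\<forall>A<N. hankel p e L m A (G A)) \<and> outp s' = ?out G N))"
  proof (rule runs_for[where I = ?J and l = 0 and h = N and T = "66 * m + 5 + (2 + 3 * n)"])
    show "?J 0 (set_var ''A'' 0 s1)" using s by (simp add: s1_def)
    fix k s'
    assume k: "k < N" and J: "?J k s'" and v: "vars s' ''A'' = k" "vars s' ''L'' = N"
    from J obtain G where G: "\<forall>A<k. hankel p e L m A (G A)" "outp s' = ?out G k" by blast
    have s': "vars s' ''p'' = p" "vars s' ''n'' = n" "arrs s' ''T'' = arrs s ''T''"
      using J s by (simp_all add: agree_def)
    show "runs W (inner_table ;; emit_row) s' (66 * m + 5 + (2 + 3 * n))
      (\<lambda>s''. vars s'' ''A'' = k \<and> vars s'' ''L'' = N \<and> ?J (Suc k) (set_var ''A'' (Suc k) s''))"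
    proof (rule runs_Seq[OF runs_inner_table[OF p s'(1) _ _ v(1) m(3,1)] _ order_refl])
      fix s2 assume s2: "same {''x'', ''P'', ''B'', ''v'', ''a'', ''b'', ''c'', ''t'', ''h''} {''S'', ''G''} s' s2 \<and>
        hankel p e L m k (arrs s2 ''G'')"
      have s2': "vars s2 ''n'' = n" "arrs s2 ''T'' = arrs s ''T''" using s2 s' by (simp_all add: agree_def)
      define g where "g = arrs s2 ''G''"
      have gW: "g y < W" if "y < m" for y
        using s2 that W' by (auto simp: hankel_def linear_on_def g_def intro: less_trans)
      show "runs W emit_row s2 (2 + 3 * n)
        (\<lambda>s''. vars s'' ''A'' = k \<and> vars s'' ''L'' = N \<and> ?J (Suc k) (set_var ''A'' (Suc k) s''))"
      proof (rule runs_mono[OF runs_emit_row[OF s2'(1) W'(1)] order_refl])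
        show "arrs s2 ''T'' x < W" if "x < n" for x using T[OF that] s2' W' by simp
        show "arrs s2 ''G'' (arrs s2 ''T'' x) < W" if "x < n" for x using gW T[OF that] s2' by (simp add: g_def)
        fix s3 :: state assume s3: "agree {''x''} (vars s2) (vars s3) \<and> arrs s3 = arrs s2 \<and>
          outp s3 = outp s2 @ map (\<lambda>x. arrs s2 ''G'' (arrs s2 ''T'' x)) [0..<n]"
        define G' where "G' = G(k := g)"
        have "\<forall>A<Suc k. hankel p e L m A (G' A)" using G s2 by (auto simp: G'_def g_def less_Suc_eq)
        moreover have "concat (map (\<lambda>A. map (\<lambda>x. G' A (arrs s ''T'' x)) [0..<n]) [0..<k])
            = concat (map (\<lambda>A. map (\<lambda>x. G A (arrs s ''T'' x)) [0..<n]) [0..<k])"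
          by (intro arg_cong[of _ _ concat] map_cong) (auto simp: G'_def)
        then have "outp s3 = ?out G' (Suc k)" using s3 s2 G(2) s2' by (simp add: G'_def g_def)
        moreover have "agree ?V (vars s) (vars s3)" "agree ?A (arrs s) (arrs s3)" "vars s3 ''R'' = p ^ e"
          "vars s3 ''M'' = m" "vars s3 ''A'' = k" "vars s3 ''L'' = N"
          using s3 s2 J v by (simp_all add: agree_def)
        ultimately show "vars s3 ''A'' = k \<and> vars s3 ''L'' = N \<and> ?J (Suc k) (set_var ''A'' (Suc k) s3)"
          by auto
      qed
    qed (use J k W W' in auto)
  qed (use s W N in \<open>auto simp: s1_def\<close>)
  then have "runs W (for_loop ''A'' (Const 0) ''L'' (inner_table ;; emit_row)) s1 (90 * (N * n) - 1 - 1)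
     (\<lambda>s'. agree ?V (vars s) (vars s') \<and> agree ?A (arrs s) (arrs s') \<and>
      (\<exists>G. (\<forall>A<N. hankel p e L m A (G A)) \<and> outp s' = ?out G N))"
  proof (rule runs_mono)
    have "66 * m + 5 + (2 + 3 * n) + 2 \<le> 78 * n" using m by simp
    then have "N * (66 * m + 5 + (2 + 3 * n) + 2) \<le> N * (78 * n)" by (rule mult_le_mono2)
    also have "N * (78 * n) = 78 * (N * n)" by simp
    finally have 1: "N * (66 * m + 5 + (2 + 3 * n) + 2) \<le> 78 * (N * n)" .
    have 2: "1 * 1 \<le> N * n" using N m by (intro mult_le_mono) auto
    have "2 + x \<le> 90 * y - 1 - 1" if "x \<le> 78 * y" "1 * 1 \<le> y" for x y :: nat
      using that by linarith
    from this[OF 1 2] show "2 + N * (66 * m + 5 + (2 + 3 * n) + 2) \<le> 90 * (N * n) - 1 - 1" .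
  qed
  moreover have "1 \<le> 90 * (N * n)" "1 \<le> 90 * (N * n) - 1"
  proof -
    have "1 * 1 \<le> N * n" using N m by (intro mult_le_mono) auto
    then show "1 \<le> 90 * (N * n)" "1 \<le> 90 * (N * n) - 1" by linarith+
  qed
  ultimately show ?thesis unfolding emit_all_def using s W' by (simp add: s1_def)
qed

section \<open>The main loop\<close>

definition rows :: "nat \<Rightarrow> (nat \<Rightarrow> nat) list \<Rightarrow> nat list" where
  "rows n fs = concat (map (\<lambda>f. map f [0..<n]) fs)"

lemma length_rows [simp]: "length (rows n fs) = length fs * n"
  by (induction fs) (simp_all add: rows_def)

lemma rows_append [simp]: "rows n (fs @ gs) = rows n fs @ rows n gs"
  by (simp add: rows_def)

lemma nth_rows: "i < length fs \<Longrightarrow> x < n \<Longrightarrow> rows n fs ! (i * n + x) = (fs ! i) x"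
proof (induction fs arbitrary: i)
  case (Cons f fs)
  have eq: "rows n (f # fs) = map f [0..<n] @ rows n fs" by (simp add: rows_def)
  show ?case
  proof (cases i)
    case 0
    then show ?thesis using Cons.prems by (simp add: eq nth_append)
  next
    case (Suc j)
    then have "\<not> i * n + x < n" "i * n + x - n = j * n + x" by auto
    then show ?thesis using Cons Suc by (simp add: eq nth_append)
  qed
qed simp

lemma perfect_hash_family_rows:
  assumes "d \<le> q" and range: "\<And>f x. f \<in> set fs \<Longrightarrow> x < n \<Longrightarrow> f x < q"
    and inj: "\<And>S. S \<subseteq> {..<n} \<Longrightarrow> card S = d \<Longrightarrow> \<exists>f\<in>set fs. inj_on f S"
  shows "perfect_hash_family n q d (family_of_table n (length fs) (rows n fs))"
proof -
  let ?F = "family_of_table n (length fs) (rows n fs)"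
  have F: "set ?F = (\<lambda>i x. rows n fs ! (i * n + x)) ` {..<length fs}"
    by (simp add: family_of_table_def atLeast0LessThan)
  have "\<exists>h\<in>set ?F. inj_on h S" if S: "S \<subseteq> {..<n}" "card S = d" for S
  proof -
    obtain i where i: "i < length fs" "inj_on (fs ! i) S"
      using inj[OF S] by (auto simp: in_set_conv_nth)
    then have "inj_on (\<lambda>x. rows n fs ! (i * n + x)) S"
      using S(1) by (subst inj_on_cong[where g = "fs ! i"]) (auto simp: nth_rows)
    then show ?thesis using i F by auto
  qed
  moreover have "set ?F \<subseteq> {..<n} \<rightarrow> {..<q}"
    using range by (auto simp: F nth_rows)
  ultimately show ?thesis using \<open>d \<le> q\<close> by (simp add: perfect_hash_family_def)
qed

text \<open>The stopping rule "collision share below \<open>1 / C\<close>" with the denominator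
  cleared, hence free of rounding.\<close>

definition check :: com where
  "check =
     Assign ''go'' (Const 0) ;;
     for_loop ''z'' (Const 0) ''Z''
       (Cond (Less (Times (Var ''C'') (Elem ''K'' (Var ''z''))) (Var ''N'')) Skip (Assign ''go'' (Const 1)))"

lemma runs_check:
  assumes s: "vars s ''C'' = C" "vars s ''N'' = k" "vars s ''Z'' = Z" and W: "Z < W" "k < W" "1 < W" "C < W"
    and K: "\<And>z. z < Z \<Longrightarrow> arrs s ''K'' z < W" "\<And>z. z < Z \<Longrightarrow> C * arrs s ''K'' z < W"
  shows "runs W check s (3 + 4 * Z) (\<lambda>s'. same {''go'', ''z''} {} s s' \<and>
    vars s' ''go'' \<le> 1 \<and> (0 < vars s' ''go'' \<longleftrightarrow> (\<exists>z<Z. k \<le> C * arrs s ''K'' z)))"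
proof -
  let ?test = "Cond (Less (Times (Var ''C'') (Elem ''K'' (Var ''z''))) (Var ''N'')) Skip (Assign ''go'' (Const 1))"
  have "runs W (for_loop ''z'' (Const 0) ''Z''
       ?test)
      (set_var ''go'' 0 s) (2 + 4 * Z) (\<lambda>s'. same {''go'', ''z''} {} s s' \<and>
      vars s' ''go'' \<le> 1 \<and> (0 < vars s' ''go'' \<longleftrightarrow> (\<exists>z<Z. k \<le> C * arrs s ''K'' z)))"
  proof (rule runs_for[where T = 2 and I = "\<lambda>j s'. same {''go'', ''z''} {} s s' \<and>
      vars s' ''go'' \<le> 1 \<and> (0 < vars s' ''go'' \<longleftrightarrow> (\<exists>z<j. k \<le> C * arrs s ''K'' z))"])
    fix j s' assume j: "j < Z" and I: "same {''go'', ''z''} {} s s' \<and>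
      vars s' ''go'' \<le> 1 \<and> (0 < vars s' ''go'' \<longleftrightarrow> (\<exists>z<j. k \<le> C * arrs s ''K'' z))" and v: "vars s' ''z'' = j" "vars s' ''Z'' = Z"
    have s': "vars s' ''C'' = C" "vars s' ''N'' = k" "arrs s' = arrs s" using I s by (auto simp: agree_def)
    have ex: "(\<exists>z<Suc j. Q z) \<longleftrightarrow> Q j \<or> (\<exists>z<j. Q z)" for Q :: "nat \<Rightarrow> bool" by (auto simp: less_Suc_eq)
    show "runs W ?test
       s' 2 (\<lambda>s''. vars s'' ''z'' = j \<and> vars s'' ''Z'' = Z \<and> same {''go'', ''z''} {} s (set_var ''z'' (Suc j) s'') \<and>
         vars (set_var ''z'' (Suc j) s'') ''go'' \<le> 1 \<and> (0 < vars (set_var ''z'' (Suc j) s'') ''go'' \<longleftrightarrow> (\<exists>z<Suc j. k \<le> C * arrs s ''K'' z)))"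
      by (rule runs_Cond[where T = 1]) (use s' v I j K[OF j] W in \<open>simp_all add: ex\<close>)
  qed (use s W in auto)
  then show ?thesis unfolding check_def using W by simp
qed

text \<open>The output follows the test and leaves \<open>go\<close> alone, so the functions of the
  last round are emitted as well.\<close>

definition rounds :: com where
  "rounds = While (Less (Const 0) (Var ''go'')) (greedy ;; check ;; emit_all)"

text \<open>\<open>inner\<close> is the whole interface to the second stage: two distinct values
  below \<open>m\<close> collide under less than a share \<open>1 / C\<close> of the
  \<open>L\<close> maps. One identity map and the Hankel family both satisfy it.\<close>

locale hash_params = greedy_params +
  fixes q e L m d :: nat
  assumes NM: "NM = max_rounds n Q C"
    and q: "q = p ^ e" "q \<le> Q" and m: "m = min n Q" and L: "0 < L"
    and d: "C = d choose 2" "d \<le> q"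
    and inner: "\<And>G x y. (\<And>A. A < L \<Longrightarrow> hankel p e n m A (G A)) \<Longrightarrow> x < m \<Longrightarrow> y < m \<Longrightarrow> x \<noteq> y \<Longrightarrow>
      C * card {A. A < L \<and> G A x = G A y} < L"
    and W': "L < W" "C * (NM + 1) < W"
begin

definition family :: "((nat \<Rightarrow> nat) \<times> (nat \<Rightarrow> nat \<Rightarrow> nat)) list \<Rightarrow> (nat \<Rightarrow> nat) list" where
  "family rs = concat (map (\<lambda>(T, G). map (\<lambda>A x. G A (T x)) [0..<L]) rs)"

definition good_round :: "(nat \<Rightarrow> nat) \<times> (nat \<Rightarrow> nat \<Rightarrow> nat) \<Rightarrow> bool" where
  "good_round = (\<lambda>(T, G). linear_on p E n n T \<and> (\<forall>A<L. hankel p e n m A (G A)))"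

lemma length_family [simp]: "length (family rs) = length rs * L"
  by (induction rs) (auto simp: family_def)

lemma table_less:
  assumes "linear_on p E n n T" "x < n"
  shows "T x < m"
  using assms by (cases "x < Q") (auto simp: linear_on_def m Q min_def)

lemma NM_pos: "0 < NM"
  by (simp add: NM max_rounds_def)

lemma outside_zeroD:
  assumes "outside_zero ka" "ka z \<noteq> 0"
  obtains P where "block P" "P \<le> z" "z < P + P"
proof -
  have "(\<forall>P. block P \<longrightarrow> \<not> (P \<le> z \<and> z < P + P)) \<longrightarrow> ka z = 0"
    using assms(1) unfolding outside_zero_def by (rule spec)
  with assms(2) show thesis by (metis that)
qed

text \<open>A count that fails the test forces a large weight on its pair, but the pair weighs no
  more than its block; \<open>rounds_le\<close> then bounds the number of rounds. This is why the
  main loop terminates.\<close>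

lemma stuck_less:
  assumes wt: "\<And>P. block P \<Longrightarrow> weighted Ts wa ka P" and oz: "outside_zero ka"
    and "length Ts \<le> C * ka z" "Ts \<noteq> []"
  shows "length Ts < NM"
proof -
  \<comment> \<open>After at least one round a zero count passes the test; so \<open>z\<close> lies
    in a block.\<close>
  have "ka z \<noteq> 0" using assms(3,4) by (metis le_zero_eq length_0_conv mult_0_right)
  then obtain P where P: "block P" "P \<le> z" "z < P + P" by (rule outside_zeroD[OF oz])
  define y where "y = z - P"
  have y: "y < P" "z = P + y" using P by (auto simp: y_def)
  define k where "k = length Ts"
  define a where "a = collisions Ts P y"
  have wP: "ka z = a" "(real (C * Q) / real D) ^ k * (real Q / real C) ^ a \<le> real (wa z)"
    "(\<Sum>y<P. wa (P + y)) \<le> P * (1 + k)"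
    using wt[OF P(1)] y by (auto simp: weighted_def a_def k_def)
  obtain l where l: "E \<le> l" "P = p ^ l" "P < n" using P(1) by (auto simp: block_def)
  then have "Q \<le> P" using p1 by (simp add: Q power_increasing)
  \<comment> \<open>A block exists only for \<open>Q < n\<close>, the case in which
    \<open>max_rounds\<close> is the logarithmic bound.\<close>
  then have Qn: "Q < n" using l by simp
  have "wa z \<le> (\<Sum>y<P. wa (P + y))" unfolding y(2) by (rule member_le_sum) (use y in auto)
  also have "\<dots> \<le> P * (1 + k)" by (rule wP(3))
  also have "\<dots> \<le> n * (1 + k)" using l by (intro mult_right_mono) auto
  finally have "real (wa z) \<le> real (n * (1 + k))" unfolding of_nat_le_iff .
  then have "(real (C * Q) / real D) ^ k * (real Q / real C) ^ a \<le> real (n * (1 + k))"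
    by (rule order_trans[OF wP(2)])
  then have "(real (C * Q) / real D) ^ k * (real Q / real C) ^ a \<le> real n * (1 + real k)"
    unfolding of_nat_mult of_nat_add of_nat_1 .
  then have "real k \<le> 13 * real C * ln n / gain (Q / C)"
    using rounds_le[OF C Qn, of k a] assms(3) wP(1) by (simp add: D k_def)
  then have "k \<le> nat \<lfloor>13 * real C * ln n / gain (Q / C)\<rfloor>" by linarith
  then show ?thesis using Qn by (simp add: NM max_rounds_def k_def)
qed

text \<open>Few collisions are used twice. Some \<open>T\<close> separates \<open>S\<close>, since
  each pair of points is represented by a counted pair \<open>u\<close>, \<open>p ^ l\<close>. The
  image of \<open>S\<close> again has \<open>d\<close> points, and by \<open>inner\<close> some
  \<open>G A\<close> of the same round separates these.\<close>

lemma finished_perfect: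
  assumes rs: "\<And>r. r \<in> set rs \<Longrightarrow> good_round r" "rs \<noteq> []"
    and wt: "\<And>P. block P \<Longrightarrow> weighted (map fst rs) wa ka P"
    and few: "\<And>z. z < 2 * n \<Longrightarrow> C * ka z < length rs"
  shows "perfect_hash_family n q d (family_of_table n (length rs * L) (rows n (family (rev rs))))"
proof -
  have "perfect_hash_family n q d (family_of_table n (length (family (rev rs))) (rows n (family (rev rs))))"
  proof (rule perfect_hash_family_rows[OF d(2)])
    fix f x assume f: "f \<in> set (family (rev rs))" and x: "x < n"
    then obtain T G A where r: "(T, G) \<in> set rs" "A < L" "f = (\<lambda>x. G A (T x))" by (auto simp: family_def)
    then have "T x < m" "linear_on p e n m (G A)"
      using rs(1)[OF r(1)] table_less x by (auto simp: good_round_def hankel_def)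
    then show "f x < q" using r by (simp add: linear_on_def q)
  next
    fix S assume S: "S \<subseteq> {..<n}" "card S = d"
    have finS: "finite S" using S(1) finite_subset by blast
    have "\<exists>T\<in>set (map fst rs). inj_on T S"
    proof (rule ex_inj_on_of_few_collisions[OF finS])
      fix x y assume xy: "x \<in> S" "y \<in> S" "x \<noteq> y"
      then have xyn: "x < n" "y < n" using S by auto
      obtain l u where l: "u < p ^ l" "p ^ l < n"
        and coll: "\<And>X e L. linear_on p e L n X \<Longrightarrow> X x = X y \<Longrightarrow> e \<le> l \<and> X u = X (p ^ l)"
        using linear_on_collision[OF p xy(3) xyn] by metis
      let ?c = "length (filter (\<lambda>T. T x = T y) (map fst rs))"
      have lin: "linear_on p E n n T" if "T \<in> set (map fst rs)" for T
        using that rs(1) by (auto simp: good_round_def)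
      have "C * ?c < length rs"
      proof (cases "?c = 0")
        case False
        then obtain T where "T \<in> set (map fst rs)" "T x = T y" by (auto simp: filter_empty_conv)
        then have "E \<le> l" using coll lin by blast
        then have "block (p ^ l)" using l by (auto simp: block_def)
        have imp: "\<forall>T\<in>set Ts. T x = T y \<longrightarrow> T u = T (p ^ l) \<Longrightarrow>
          length (filter (\<lambda>T. T x = T y) Ts) \<le> collisions Ts (p ^ l) u" for Ts
          by (induction Ts) auto
        have "?c \<le> collisions (map fst rs) (p ^ l) u" by (rule imp) (use coll lin in blast)
        also have "\<dots> = ka (p ^ l + u)" using wt[OF \<open>block (p ^ l)\<close>] l by (simp add: weighted_def)
        finally have "C * ?c \<le> C * ka (p ^ l + u)" by simp
        also have "\<dots> < length rs" using l by (intro few) simp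
        finally show ?thesis .
      qed (use rs(2) in simp)
      then show "(card S choose 2) * ?c < length (map fst rs)" using S(2) d(1) by simp
    qed (use rs(2) in simp)
    then obtain T G where TG: "(T, G) \<in> set rs" "inj_on T S" by auto
    have TS: "T ` S \<subseteq> {..<m}" using S(1) rs(1)[OF TG(1)] table_less by (auto simp: good_round_def)
    have G: "hankel p e n m A (G A)" if "A < L" for A using rs(1)[OF TG(1)] that by (auto simp: good_round_def)
    have "\<exists>g\<in>set (map G [0..<L]). inj_on g (T ` S)"
    proof (rule ex_inj_on_of_few_collisions)
      fix x y assume xy: "x \<in> T ` S" "y \<in> T ` S" "x \<noteq> y"
      have "length (filter (\<lambda>g. g x = g y) (map G [0..<L])) = length (filter (\<lambda>A. G A x = G A y) [0..<L])"
        by (simp add: filter_map comp_def)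
      also have "\<dots> = card (set (filter (\<lambda>A. G A x = G A y) [0..<L]))" by (rule distinct_card[symmetric]) simp
      also have "set (filter (\<lambda>A. G A x = G A y) [0..<L]) = {A. A < L \<and> G A x = G A y}" by auto
      finally show "(card (T ` S) choose 2) * length (filter (\<lambda>g. g x = g y) (map G [0..<L])) < length (map G [0..<L])"
        using inner[OF G, of x y] xy TS card_image[OF TG(2)] S(2) d(1) by auto
    qed (use finS L in auto)
    then obtain A where A: "A < L" "inj_on (G A) (T ` S)" by auto
    have "(\<lambda>x. G A (T x)) \<in> set (family (rev rs))" using TG(1) A(1) by (force simp: family_def)
    moreover have "inj_on (\<lambda>x. G A (T x)) S"
      using comp_inj_on[OF TG(2) A(2)] by (simp add: comp_def)
    ultimately show "\<exists>f\<in>set (family (rev rs)). inj_on f S" by blast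
  qed
  then show ?thesis by simp
qed

definition fixed :: "state \<Rightarrow> bool" where
  "fixed s \<longleftrightarrow> vars s ''p'' = p \<and> vars s ''q'' = q \<and> vars s ''Q'' = Q \<and> vars s ''C'' = C \<and> vars s ''D'' = D \<and>
     vars s ''n'' = n \<and> vars s ''m'' = m \<and> vars s ''L'' = L \<and> vars s ''Z'' = 2 * n"

text \<open>\<open>rs\<close> lists the rounds latest first, hence the \<open>rev\<close> in the
  output. The case \<open>rs = []\<close> reflects that \<open>go\<close> starts as 1.\<close>

definition round_inv :: "((nat \<Rightarrow> nat) \<times> (nat \<Rightarrow> nat \<Rightarrow> nat)) list \<Rightarrow> state \<Rightarrow> bool" where
  "round_inv rs s \<longleftrightarrow> fixed s \<and> vars s ''N'' = length rs \<and>
     (\<forall>P. block P \<longrightarrow> weighted (map fst rs) (arrs s ''w'') (arrs s ''K'') P) \<and> outside_zero (arrs s ''K'') \<and>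
     (\<forall>r\<in>set rs. good_round r) \<and> outp s = rows n (family (rev rs)) \<and>
     vars s ''go'' \<le> 1 \<and> (0 < vars s ''go'' \<longleftrightarrow> rs = [] \<or> (\<exists>z<2 * n. length rs \<le> C * arrs s ''K'' z)) \<and> length rs \<le> NM"

lemma runs_round:
  assumes inv: "round_inv rs s" and go: "0 < vars s ''go''"
  shows "runs W (greedy ;; check ;; emit_all) s (150 * n + (3 + 4 * (2 * n) + 90 * (L * n)))
    (\<lambda>s'. \<exists>r. round_inv (r # rs) s')"
proof -
  have fx: "fixed s" and wt: "\<And>P. block P \<Longrightarrow> weighted (map fst rs) (arrs s ''w'') (arrs s ''K'') P"
    and oz: "outside_zero (arrs s ''K'')" and good: "\<And>r. r \<in> set rs \<Longrightarrow> good_round r"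
    and out: "outp s = rows n (family (rev rs))" and N: "vars s ''N'' = length rs"
    using inv by (auto simp: round_inv_def)
  have k: "length (map fst rs) < NM"
  proof (cases "rs = []")
    case False
    then obtain z where "length rs \<le> C * arrs s ''K'' z" using inv go by (auto simp: round_inv_def)
    then show ?thesis using stuck_less[OF wt oz] False by simp
  qed (simp add: NM_pos)
  have W1: "C < W" "2 * n < W" "m < W" "0 < m" "m \<le> n" "q \<le> Q" "NM + 1 < W"
    using W C n NM_less q by (auto simp: m)
  let ?V1 = "{''N'', ''R'', ''M'', ''a'', ''y'', ''v'', ''t'', ''b'', ''c'', ''h'', ''x'', ''P''}"
  let ?A1 = "{''H'', ''w'', ''K'', ''S'', ''T''}"
  have "runs W greedy s (150 * n) (\<lambda>s'. same ?V1 ?A1 s s' \<and>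
      vars s' ''N'' = Suc (length (map fst rs)) \<and> linear_on p E n n (arrs s' ''T'') \<and>
      (\<forall>P. block P \<longrightarrow> weighted (arrs s' ''T'' # map fst rs) (arrs s' ''w'') (arrs s' ''K'') P) \<and>
      outside_zero (arrs s' ''K''))"
    by (rule runs_greedy) (use fx N k wt oz in \<open>auto simp: fixed_def\<close>)
  then show ?thesis
  proof (rule runs_Seq[OF _ _ order_refl])
    fix s1 assume s1: "same ?V1 ?A1 s s1 \<and>
      vars s1 ''N'' = Suc (length (map fst rs)) \<and> linear_on p E n n (arrs s1 ''T'') \<and>
      (\<forall>P. block P \<longrightarrow> weighted (arrs s1 ''T'' # map fst rs) (arrs s1 ''w'') (arrs s1 ''K'') P) \<and>
      outside_zero (arrs s1 ''K'')"
    define T where "T = arrs s1 ''T''"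
    have linT: "linear_on p E n n T" and wt1: "\<And>P. block P \<Longrightarrow> weighted (T # map fst rs) (arrs s1 ''w'') (arrs s1 ''K'') P"
      and oz1: "outside_zero (arrs s1 ''K'')" and N1: "vars s1 ''N'' = Suc (length rs)" and a1: "same ?V1 ?A1 s s1"
      using s1 by (simp_all add: T_def)
    have fx1: "fixed s1" using fx a1 by (simp add: fixed_def agree_def)
    have K: "arrs s1 ''K'' z \<le> NM" for z
    proof (cases "arrs s1 ''K'' z = 0")
      case False
      then obtain P where P: "block P" "P \<le> z" "z < P + P" by (rule outside_zeroD[OF oz1])
      define y where "y = z - P"
      have y: "y < P" "z = P + y" using P by (auto simp: y_def)
      then have "arrs s1 ''K'' z = collisions (T # map fst rs) P y" using wt1[OF P(1)] by (simp add: weighted_def)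
      also have "\<dots> \<le> length (T # map fst rs)" by (rule collisions_le)
      finally show ?thesis using k by simp
    qed simp
    have CK: "C * arrs s1 ''K'' z < W" for z
    proof -
      have "C * arrs s1 ''K'' z \<le> C * (NM + 1)" using K[of z] by (intro mult_le_mono2) simp
      with W'(2) show ?thesis by linarith
    qed
    have KW: "arrs s1 ''K'' z < W" for z using K[of z] W1 by linarith
    have "runs W check s1 (3 + 4 * (2 * n)) (\<lambda>s'. same {''go'', ''z''} {} s1 s' \<and>
      vars s' ''go'' \<le> 1 \<and> (0 < vars s' ''go'' \<longleftrightarrow> (\<exists>z<2 * n. Suc (length rs) \<le> C * arrs s1 ''K'' z)))"
      by (rule runs_check) (use fx1 N1 W1 CK KW k in \<open>auto simp: fixed_def\<close>)
    then show "runs W (check ;; emit_all) s1 (3 + 4 * (2 * n) + 90 * (L * n)) (\<lambda>s'. \<exists>r. round_inv (r # rs) s')"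
    proof (rule runs_Seq[OF _ _ order_refl])
      fix s2 assume s2: "same {''go'', ''z''} {} s1 s2 \<and>
        vars s2 ''go'' \<le> 1 \<and> (0 < vars s2 ''go'' \<longleftrightarrow> (\<exists>z<2 * n. Suc (length rs) \<le> C * arrs s1 ''K'' z))"
      have fx2: "fixed s2" using fx1 s2 by (simp add: fixed_def agree_def)
      have A2: "arrs s2 = arrs s1" using s2 by (simp add: agree_def fun_eq_iff)
      have N2: "vars s2 ''N'' = Suc (length rs)" using s2 N1 by (simp add: agree_def)
      let ?V3 = "{''R'', ''M'', ''A'', ''x'', ''P'', ''B'', ''v'', ''a'', ''b'', ''c'', ''t'', ''h''}"
      have "runs W emit_all s2 (90 * (L * n)) (\<lambda>s'. agree ?V3 (vars s2) (vars s') \<and>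
        agree {''S'', ''G''} (arrs s2) (arrs s') \<and> (\<exists>G. (\<forall>A<L. hankel p e n m A (G A)) \<and>
        outp s' = outp s2 @ concat (map (\<lambda>A. map (\<lambda>x. G A (arrs s2 ''T'' x)) [0..<n]) [0..<L])))"
      proof (rule runs_emit_all[OF p1])
        show "m \<le> p ^ n" using W1 n_le by simp
        show "arrs s2 ''T'' x < m" if "x < n" for x using table_less[OF linT that] by (simp add: A2 T_def)
        show "2 * p ^ e < W" using W q by linarith
        show "vars s2 ''q'' = p ^ e" using fx2 by (simp add: fixed_def flip: q(1))
      qed (use fx2 W W' W1 L in \<open>auto simp: fixed_def\<close>)
      then show "runs W emit_all s2 (90 * (L * n)) (\<lambda>s'. \<exists>r. round_inv (r # rs) s')"
      proof (rule runs_mono[OF _ order_refl])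
        fix s3 :: state assume s3: "agree ?V3 (vars s2) (vars s3) \<and>
          agree {''S'', ''G''} (arrs s2) (arrs s3) \<and> (\<exists>G. (\<forall>A<L. hankel p e n m A (G A)) \<and>
          outp s3 = outp s2 @ concat (map (\<lambda>A. map (\<lambda>x. G A (arrs s2 ''T'' x)) [0..<n]) [0..<L]))"
        then obtain G where G: "\<forall>A<L. hankel p e n m A (G A)"
          "outp s3 = outp s2 @ concat (map (\<lambda>A. map (\<lambda>x. G A (arrs s2 ''T'' x)) [0..<n]) [0..<L])" by blast
        have v3: "agree ?V3 (vars s2) (vars s3)" "agree {''S'', ''G''} (arrs s2) (arrs s3)" using s3 by blast+
        have "outp s2 = rows n (family (rev rs))" using s2 a1 out by simp
        then have out3: "outp s3 = rows n (family (rev ((T, G) # rs)))"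
          by (simp add: G(2) A2 T_def family_def rows_def comp_def)
        have fx3: "fixed s3" using fx2 v3 by (simp add: fixed_def agree_def)
        have N3: "vars s3 ''N'' = Suc (length rs)" "vars s3 ''go'' = vars s2 ''go''"
          "arrs s3 ''w'' = arrs s1 ''w''" "arrs s3 ''K'' = arrs s1 ''K''"
          using v3 N2 by (simp_all add: agree_def A2)
        have "round_inv ((T, G) # rs) s3"
          unfolding round_inv_def out3 N3 using fx3 wt1 oz1 good G(1) linT s2 k
          by (auto simp: good_round_def)
        then show "\<exists>r. round_inv (r # rs) s3" by blast
      qed
    qed
  qed
qed

text \<open>A round takes O(L * n) steps and emits \<open>L * n\<close> entries, so the time is
  linear in the output whatever the number of rounds; \<open>NM\<close> enters only into the size
  and the termination measure.\<close>

lemma exec_rounds: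
  assumes "round_inv [] s"
  shows "\<exists>t s' N. exec W rounds s t s' \<and> length (outp s') = N * n \<and>
    perfect_hash_family n q d (family_of_table n N (outp s')) \<and> 0 < N \<and> N \<le> L * NM \<and> t \<le> 1 + 262 * (N * n)"
proof -
  define T where "T = 150 * n + (3 + 4 * (2 * n) + 90 * (L * n))"
  have "1 * n \<le> L * n" using L by (intro mult_le_mono1) simp
  then have T: "1 + T \<le> 262 * (L * n)" unfolding T_def using n by linarith
  let ?I = "\<lambda>t s. \<exists>rs. round_inv rs s \<and> t \<le> length rs * (1 + T)"
  have "\<exists>t s'. exec W rounds s t s' \<and> (\<exists>u. ?I u s' \<and> 0 + t = u + 1) \<and>
      \<not> bval (Less (Const 0) (Var ''go'')) s'"
    unfolding rounds_def
  proof (rule exec_While[where \<mu> = "\<lambda>s. NM - vars s ''N''" and I = ?I])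
    show "?I 0 s" using assms by (intro exI[of _ "[]"]) simp
    show "bfits W (Less (Const 0) (Var ''go'')) s1" if "?I t s1" for t s1
      using that NM_less by (auto simp: round_inv_def)
    fix t s1 assume I: "?I t s1" and b: "bval (Less (Const 0) (Var ''go'')) s1"
    then obtain rs where rs: "round_inv rs s1" "t \<le> length rs * (1 + T)" by blast
    have "0 < vars s1 ''go''" using b by simp
    from runs_round[OF rs(1) this] obtain t' s' r where
      s': "exec W (greedy ;; check ;; emit_all) s1 t' s'" "t' \<le> T" "round_inv (r # rs) s'"
      unfolding runs_def T_def by blast
    have "?I (t + 1 + t') s'" using rs(2) s' by (intro exI[of _ "r # rs"]) simp
    moreover have "NM - vars s' ''N'' < NM - vars s1 ''N''"
    proof -
      have "vars s' ''N'' = Suc (length rs)" "vars s1 ''N'' = length rs" "Suc (length rs) \<le> NM"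
        using rs(1) s'(3) by (simp_all add: round_inv_def)
      then show ?thesis by linarith
    qed
    ultimately show "\<exists>t' s'. exec W (greedy ;; check ;; emit_all) s1 t' s' \<and> ?I (t + 1 + t') s' \<and>
        NM - vars s' ''N'' < NM - vars s1 ''N''"
      using s'(1) by blast
  qed
  then obtain t s' rs where ex: "exec W rounds s t s'" and rs: "round_inv rs s'" "t \<le> length rs * (1 + T) + 1"
    and go: "vars s' ''go'' = 0"
    by auto
  have ne: "rs \<noteq> []" and few: "\<And>z. z < 2 * n \<Longrightarrow> C * arrs s' ''K'' z < length rs"
    using rs(1) go unfolding round_inv_def by (auto simp: not_le)
  have out: "outp s' = rows n (family (rev rs))" using rs(1) by (simp add: round_inv_def)
  have phf: "perfect_hash_family n q d (family_of_table n (length rs * L) (outp s'))"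
    unfolding out using rs(1) ne few by (intro finished_perfect) (auto simp: round_inv_def)
  have len: "length (outp s') = length rs * L * n" unfolding out by simp
  have "length rs \<le> NM" using rs(1) by (simp add: round_inv_def)
  then have NMle: "length rs * L \<le> L * NM" by simp
  have "length rs * (1 + T) \<le> length rs * (262 * (L * n))" using T by (rule mult_le_mono2)
  then have "t \<le> 1 + 262 * (length rs * L * n)" using rs(2) by (simp add: algebra_simps)
  then show ?thesis using ex len phf NMle ne L by (intro exI[of _ t] exI[of _ s'] exI[of _ "length rs * L"]) simp
qed

end

section \<open>The program\<close>

definition find_prime :: com where
  "find_prime =
     Assign ''p'' (Const 2) ;;
     While (Less (Const 0) (Mod (Var ''q'') (Var ''p''))) (Assign ''p'' (Plus (Var ''p'') (Const 1)))"

text \<open>The least divisor from 2 on of a power of \<open>p\<close> is \<open>p\<close>. Trial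
  division takes O(q) steps, affordable because the program gets here only for
  \<open>q < n\<close>.\<close>

lemma runs_find_prime:
  assumes s: "vars s ''q'' = q" and p: "prime p" and q: "q = p ^ e" "0 < e" and W: "2 * q < W"
  shows "runs W find_prime s (2 * q + 2) (\<lambda>s'. same {''p''} {} s s' \<and> vars s' ''p'' = p)"
proof -
  have p1: "1 < p" using p by (rule prime_gt_1_nat)
  have "p ^ 1 \<le> p ^ e" using p1 q by (intro power_increasing) auto
  then have pq: "p \<le> q" by (simp add: q)
  have "p dvd q" using q by (cases e) auto
  let ?I = "\<lambda>s'. same {''p''} {} s s' \<and> 2 \<le> vars s' ''p'' \<and> vars s' ''p'' \<le> p"
  have "runs W (While (Less (Const 0) (Mod (Var ''q'') (Var ''p''))) (Assign ''p'' (Plus (Var ''p'') (Const 1))))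
    (set_var ''p'' 2 s) (2 * q + 1) (\<lambda>s'. same {''p''} {} s s' \<and> vars s' ''p'' = p)"
  proof (rule runs_While[where I = ?I and \<phi> = "\<lambda>s'. 2 * (p - vars s' ''p'')"])
    have vq: "vars s' ''q'' = q" if "?I s'" for s' using that s by (simp add: agree_def)
    show "?I (set_var ''p'' 2 s)" using p1 by simp
    show "bfits W (Less (Const 0) (Mod (Var ''q'') (Var ''p''))) s'" if "?I s'" for s'
      using that vq[OF that] W pq p1 by simp
    show "2 * (p - vars (set_var ''p'' 2 s) ''p'') + 1 \<le> 2 * q + 1" using pq by simp
    show "same {''p''} {} s s' \<and> vars s' ''p'' = p"
      if I: "?I s'" and b: "\<not> bval (Less (Const 0) (Mod (Var ''q'') (Var ''p''))) s'" for s'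
    proof -
      have "vars s' ''p'' dvd p ^ e" using b vq[OF I] q by (simp add: mod_eq_0_iff_dvd)
      then obtain i where i: "vars s' ''p'' = p ^ i" using divides_primepow_nat[OF p] by auto
      have "i \<noteq> 0" by (rule notI) (use i I in simp)
      then have "p ^ 1 \<le> p ^ i" using p1 by (intro power_increasing) auto
      then show ?thesis using I i by simp
    qed
    fix s' assume I: "?I s'" and b: "bval (Less (Const 0) (Mod (Var ''q'') (Var ''p''))) s'"
    have "vars s' ''p'' \<noteq> p" using b vq[OF I] \<open>p dvd q\<close> by auto
    then have lt: "vars s' ''p'' < p" using I by simp
    then show "\<exists>T. runs W (Assign ''p'' (Plus (Var ''p'') (Const 1))) s' T
       (\<lambda>s''. ?I s'' \<and> T + 1 + 2 * (p - vars s'' ''p'') \<le> 2 * (p - vars s' ''p''))"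
      using I W pq by (intro exI[of _ 1]) auto
  qed
  then show ?thesis unfolding find_prime_def using W pq p1 by simp
qed

definition prepare :: "aexp \<Rightarrow> aexp \<Rightarrow> com" where
  "prepare Qe Le =
     Assign ''C'' (Div (Times (Var ''d'') (Minus (Var ''d'') (Const 1))) (Const 2)) ;;
     Assign ''Q'' Qe ;;
     Assign ''L'' Le ;;
     Assign ''D'' (Minus (Plus (Times (Var ''C'') (Var ''Q'')) (Var ''Q'')) (Var ''C'')) ;;
     Assign ''Z'' (Plus (Var ''n'') (Var ''n'')) ;;
     Assign ''go'' (Const 1) ;;
     Assign ''m'' (Var ''n'') ;;
     Cond (Less (Var ''Q'') (Var ''m'')) (Assign ''m'' (Var ''Q'')) Skip ;;
     for_loop ''z'' (Const 0) ''Z'' (Store ''w'' (Var ''z'') (Const 1))"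

text \<open>The two constructions differ only in the range \<open>Qe\<close> of the greedy tables
  and the number \<open>Le\<close> of second-stage maps. The other branch handles
  \<open>n \<le> q\<close>, and also \<open>d = 1\<close>, where \<open>C\<close> would be
  0.\<close>

definition phf_prog :: "aexp \<Rightarrow> aexp \<Rightarrow> com" where
  "phf_prog Qe Le =
     Cond (Conj (Less (Var ''q'') (Var ''n'')) (Less (Const 1) (Var ''d'')))
       (find_prime ;; prepare Qe Le ;; rounds)
       (for_loop ''x'' (Const 0) ''n'' (Emit (Mod (Var ''x'') (Var ''q''))))"

lemma runs_prepare:
  assumes s: "vars s ''n'' = n" "vars s ''d'' = d"
    and Qe: "\<And>C. afits W Qe (set_var ''C'' C s)" "\<And>C. aval Qe (set_var ''C'' C s) = Q"
    and Le: "\<And>C. afits W Le (s\<lparr>vars := (vars s)(''C'' := C, ''Q'' := Q)\<rparr>)"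
      "\<And>C. aval Le (s\<lparr>vars := (vars s)(''C'' := C, ''Q'' := Q)\<rparr>) = L"
    and W: "d * (d - 1) < W" "C * Q + Q < W" "Q < W" "2 * n < W" "2 < W" "d < W"
    and C: "C = d choose 2"
  shows "runs W (prepare Qe Le) s (11 + 6 * n) (\<lambda>s'. agree {''C'', ''Q'', ''L'', ''D'', ''Z'', ''go'', ''m'', ''z''} (vars s) (vars s') \<and>
    agree {''w''} (arrs s) (arrs s') \<and> outp s' = outp s \<and>
    vars s' ''C'' = C \<and> vars s' ''Q'' = Q \<and> vars s' ''L'' = L \<and> vars s' ''D'' = C * Q + Q - C \<and> vars s' ''Z'' = 2 * n \<and>
    vars s' ''go'' = 1 \<and> vars s' ''m'' = min n Q \<and> (\<forall>z<2 * n. arrs s' ''w'' z = 1))"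
proof -
  have C': "C = d * (d - Suc 0) div 2" by (simp add: C choose_two)
  define s1 where "s1 = s\<lparr>vars := (vars s)(''C'' := C, ''Q'' := Q, ''L'' := L, ''D'' := C * Q + Q - C, ''Z'' := 2 * n,
    ''go'' := 1, ''m'' := n)\<rparr>"
  let ?V = "{''C'', ''Q'', ''L'', ''D'', ''Z'', ''go'', ''m'', ''z''}"
  let ?R = "\<lambda>s'. agree ?V (vars s) (vars s') \<and> agree {''w''} (arrs s) (arrs s') \<and> outp s' = outp s \<and>
    vars s' ''C'' = C \<and> vars s' ''Q'' = Q \<and> vars s' ''L'' = L \<and> vars s' ''D'' = C * Q + Q - C \<and> vars s' ''Z'' = 2 * n \<and>
    vars s' ''go'' = 1 \<and> vars s' ''m'' = min n Q"
  have CW: "C < W" unfolding C' by (rule le_less_trans[OF div_le_dividend]) (use W(1) in simp)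
  have "C * Q \<le> C * Q + Q" "C * Q + Q - C \<le> C * Q + Q" by simp_all
  then have DW: "C * Q < W" "C * Q + Q - C < W" using W(2) by linarith+
  have "runs W (Cond (Less (Var ''Q'') (Var ''m'')) (Assign ''m'' (Var ''Q'')) Skip ;;
     for_loop ''z'' (Const 0) ''Z'' (Store ''w'' (Var ''z'') (Const 1))) s1 (2 + (2 + 2 * n * (1 + 2)))
     (\<lambda>s'. ?R s' \<and> (\<forall>z<2 * n. arrs s' ''w'' z = 1))"
  proof (rule runs_Seq[where R = ?R])
    show "runs W (Cond (Less (Var ''Q'') (Var ''m'')) (Assign ''m'' (Var ''Q'')) Skip) s1 2 ?R"
      by (rule runs_Cond[where T = 1]) (use W in \<open>auto simp: s1_def\<close>)
    fix s2 :: state assume s2: "?R s2"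
    show "runs W (for_loop ''z'' (Const 0) ''Z'' (Store ''w'' (Var ''z'') (Const 1))) s2 (2 + 2 * n * (1 + 2))
      (\<lambda>s'. ?R s' \<and> (\<forall>z<2 * n. arrs s' ''w'' z = 1))"
      by (rule runs_for[where T = 1 and I = "\<lambda>k s'. ?R s' \<and> (\<forall>z<k. arrs s' ''w'' z = 1)"])
        (use s2 W in \<open>auto simp: less_Suc_eq\<close>)
  qed simp
  then have "runs W (Cond (Less (Var ''Q'') (Var ''m'')) (Assign ''m'' (Var ''Q'')) Skip ;;
     for_loop ''z'' (Const 0) ''Z'' (Store ''w'' (Var ''z'') (Const 1))) s1 (4 + 6 * n)
     (\<lambda>s'. ?R s' \<and> (\<forall>z<2 * n. arrs s' ''w'' z = 1))"
    by (rule runs_mono) simp_all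
  then show ?thesis unfolding prepare_def using s Qe Le W CW DW
    by (simp add: s1_def flip: C' mult_2)
qed

text \<open>In powers of \<open>U\<close>: \<open>Q\<close> and \<open>L\<close> count 2,
  \<open>NM + 2\<close> counts 8. The critical product \<open>n * (NM + 2) * Q * Q\<close> has
  exponent 13, and its successor needs one more, safely below 16.\<close>

lemma word_bounds:
  fixes n q U p C Q L d NM :: nat
  assumes U: "U = n + q" and "q < n" "2 \<le> q" "C < q" "Q \<le> q\<^sup>2" "L \<le> q\<^sup>2" "d \<le> q" "p \<le> q" "NM \<le> n ^ 7 + 1"
  shows "2 * Q < U ^ 16" "p * n < U ^ 16" "2 * n < U ^ 16" "C * Q + Q < U ^ 16"
    "n * (NM + 2) * Q * Q + 1 < U ^ 16" "L < U ^ 16" "C * (NM + 1) < U ^ 16"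
    "d * (d - 1) < U ^ 16" "q * q < U ^ 16" "2 < U ^ 16" "d < U ^ 16" "q < U ^ 16"
proof -
  have U5: "5 \<le> U" "q \<le> U" "n \<le> U" using assms by simp_all
  have lt: "x < U ^ 16" if "x \<le> U ^ i" "i < 16" for x i
    using that U5 power_strict_increasing[of i 16 U] by linarith
  have QU: "Q \<le> U\<^sup>2" "L \<le> U\<^sup>2" using assms power_mono[of q U 2] U5 by linarith+
  have "2 * Q \<le> U * U\<^sup>2" using QU U5 by (intro mult_le_mono) auto
  then show "2 * Q < U ^ 16" by (intro lt[of _ 3]) (auto simp: power3_eq_cube power2_eq_square)
  have "p * n \<le> U * U" using assms U5 by (intro mult_le_mono) auto
  then show "p * n < U ^ 16" by (intro lt[of _ 2]) (auto simp: power2_eq_square)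
  have "2 * n \<le> U * U" using U5 by (intro mult_le_mono) auto
  then show "2 * n < U ^ 16" by (intro lt[of _ 2]) (auto simp: power2_eq_square)
  have "(C + 1) * Q \<le> U * U\<^sup>2" using assms QU U5 by (intro mult_le_mono) auto
  then show "C * Q + Q < U ^ 16" by (intro lt[of _ 3]) (auto simp: power3_eq_cube power2_eq_square)
  have "1 \<le> U ^ 7" using U5 by simp
  moreover have "n ^ 7 \<le> U ^ 7" using U5 by (intro power_mono) auto
  ultimately have "NM + 2 \<le> 5 * U ^ 7" using assms by linarith
  also have "\<dots> \<le> U * U ^ 7" using U5 by (intro mult_le_mono) auto
  finally have NM: "NM + 2 \<le> U ^ 8" by (simp flip: power_Suc)
  then have "n * (NM + 2) * Q * Q \<le> U * U ^ 8 * U\<^sup>2 * U\<^sup>2" using QU U5 by (intro mult_le_mono) auto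
  also have "\<dots> = U ^ 13" by (simp add: flip: power_add power_Suc)
  finally have "n * (NM + 2) * Q * Q + 1 \<le> 2 * U ^ 13" using U5 one_le_power[of U 13] by linarith
  also have "\<dots> \<le> U * U ^ 13" using U5 by (intro mult_le_mono) auto
  finally show "n * (NM + 2) * Q * Q + 1 < U ^ 16" by (intro lt[of _ 14]) (auto simp flip: power_Suc)
  show "L < U ^ 16" using QU by (intro lt[of _ 2]) auto
  have "C * (NM + 1) \<le> U * U ^ 8" using assms U5 NM by (intro mult_le_mono) auto
  then show "C * (NM + 1) < U ^ 16" by (intro lt[of _ 9]) (auto simp flip: power_Suc)
  have "d * (d - 1) \<le> U * U" using assms U5 by (intro mult_le_mono) auto
  then show "d * (d - 1) < U ^ 16" by (intro lt[of _ 2]) (auto simp: power2_eq_square)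
  have "q * q \<le> U * U" using U5 by (intro mult_le_mono) auto
  then show "q * q < U ^ 16" by (intro lt[of _ 2]) (auto simp: power2_eq_square)
  show "2 < U ^ 16" by (rule lt[of _ 1]) (use U5 in simp_all)
  show "d < U ^ 16" by (rule lt[of _ 1]) (use assms in simp_all)
  show "q < U ^ 16" by (rule lt[of _ 1]) (use U5 in simp_all)
qed

text \<open>For \<open>n \<le> q\<close> reduction modulo \<open>q\<close> is the identity on all
  points; for \<open>d = 1\<close> every function is injective on a singleton.\<close>

lemma exec_phf_prog_trivial:
  assumes "n \<le> q \<or> d = 1" "0 < n" "0 < d" "d \<le> q" "2 \<le> q"
  shows "\<exists>t s. exec ((n + q) ^ 16) (phf_prog Qe Le) (init_state n q d) t s \<and> length (outp s) = 1 * n \<and>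
    perfect_hash_family n q d (family_of_table n 1 (outp s)) \<and> t \<le> 300 * (1 * n)"
proof -
  let ?W = "(n + q) ^ 16" and ?s = "init_state n q d"
  have "n + q \<le> ?W" using assms by (intro self_le_power) auto
  then have W: "n < ?W" "q < ?W" "d < ?W" "1 < ?W" using assms by linarith+
  have "runs ?W (phf_prog Qe Le) ?s (1 + (2 + 3 * n)) (\<lambda>s'. outp s' = rows n [\<lambda>x. x mod q])"
    unfolding phf_prog_def
  proof (rule runs_Cond[OF _ _ _ order_refl])
    show "runs ?W (for_loop ''x'' (Const 0) ''n'' (Emit (Mod (Var ''x'') (Var ''q'')))) ?s (2 + 3 * n)
      (\<lambda>s'. outp s' = rows n [\<lambda>x. x mod q])"
      by (rule runs_for[where T = 1 and l = 0 and h = n and I = "\<lambda>k s'. vars s' ''q'' = q \<and> outp s' = map (\<lambda>x. x mod q) [0..<k]"])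
        (use W in \<open>auto simp: init_state_def rows_def\<close>)
  qed (use assms W in \<open>auto simp: init_state_def\<close>)
  then obtain t s where ts: "exec ?W (phf_prog Qe Le) ?s t s" "t \<le> 1 + (2 + 3 * n)" "outp s = rows n [\<lambda>x. x mod q]"
    unfolding runs_def by blast
  have "perfect_hash_family n q d (family_of_table n (length [\<lambda>x. x mod q]) (rows n [\<lambda>x. x mod q]))"
  proof (rule perfect_hash_family_rows[OF \<open>d \<le> q\<close>])
    fix S assume S: "S \<subseteq> {..<n}" "card S = d"
    have "inj_on (\<lambda>x. x mod q) S"
    proof (cases "n \<le> q")
      case True
      show ?thesis
      proof (rule inj_onI)
        fix x y assume "x \<in> S" "y \<in> S" "x mod q = y mod q"
        moreover from this S True have "x < q" "y < q" by auto
        ultimately show "x = y" by simp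
      qed
    next
      case False
      then show ?thesis using S assms(1) by (auto simp: card_1_singleton_iff)
    qed
    then show "\<exists>f\<in>set [\<lambda>x. x mod q]. inj_on f S" by simp
  qed (use assms in auto)
  then show ?thesis using ts \<open>0 < n\<close> by (intro exI[of _ t] exI[of _ s]) simp
qed

lemma exec_phf_prog:
  assumes n: "q < n" and d: "2 \<le> d" and p: "prime p" and q: "q = p ^ e" "0 < e"
    and C: "C = d choose 2" "C < q" and Q: "Q = p ^ E" "q \<le> Q" "Q \<le> q\<^sup>2" and L: "0 < L" "L \<le> q\<^sup>2"
    and Qe: "\<And>s W. vars s ''q'' = q \<Longrightarrow> q * q < W \<Longrightarrow> q < W \<Longrightarrow> afits W Qe s \<and> aval Qe s = Q"
    and Le: "\<And>s W. vars s ''q'' = q \<Longrightarrow> vars s ''p'' = p \<Longrightarrow> q * q < W \<Longrightarrow> q < W \<Longrightarrow> p < W \<Longrightarrow> 1 < W \<Longrightarrow>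
      afits W Le s \<and> aval Le s = L"
    and inner: "\<And>G x y. (\<And>A. A < L \<Longrightarrow> hankel p e n (min n Q) A (G A)) \<Longrightarrow> x < min n Q \<Longrightarrow> y < min n Q \<Longrightarrow>
      x \<noteq> y \<Longrightarrow> C * card {A. A < L \<and> G A x = G A y} < L"
  shows "\<exists>t s N. exec ((n + q) ^ 16) (phf_prog Qe Le) (init_state n q d) t s \<and> length (outp s) = N * n \<and>
    perfect_hash_family n q d (family_of_table n N (outp s)) \<and> N \<le> L * max_rounds n Q C \<and> t \<le> 300 * (N * n)"
proof -
  define W where "W = (n + q) ^ 16"
  define NM where "NM = max_rounds n Q C"
  have p1: "1 < p" using p by (rule prime_gt_1_nat)
  have "p ^ 1 \<le> p ^ e" using p1 q by (intro power_increasing) auto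
  then have pq: "p \<le> q" by (simp add: q)
  have dq: "d \<le> q"
    using pairs_bounds(3)[OF d] C by (simp flip: pairs_choose)
  have C0: "0 < C" using d C by simp
  have "2 \<le> q" using pq p1 by simp
  have NM: "NM \<le> n ^ 7 + 1" unfolding NM_def using C0 C Q n by (intro max_rounds_le) auto
  note wb = word_bounds[OF refl n \<open>2 \<le> q\<close> C(2) Q(3) L(2) dq pq NM, folded W_def]
  have W: "p < W" "1 < W" "n < W" using wb pq by linarith+
  interpret H: hash_params n p C E Q "C * Q + Q - C" W NM q e L "min n Q" d
  proof
    show "C * Q + Q - C < W" using wb(4) by linarith
  qed (use p C0 C Q n wb L q dq inner in \<open>simp_all add: NM_def\<close>)
  define s0 where "s0 = init_state n q d"
  have sq: "vars s0 ''q'' = q" "vars s0 ''n'' = n" "vars s0 ''d'' = d" "vars s0 ''N'' = 0" "arrs s0 = (\<lambda>_ _. 0)" "outp s0 = []"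
    by (simp_all add: s0_def init_state_def)
  have prepare: "runs W (find_prime ;; prepare Qe Le) s0 (2 * q + 2 + (11 + 6 * n)) (H.round_inv [])"
  proof (rule runs_Seq[OF runs_find_prime[OF sq(1) p q] _ order_refl])
    show "2 * q < W" using wb(1) Q(2) by linarith
    fix s1 assume s1: "same {''p''} {} s0 s1 \<and> vars s1 ''p'' = p"
    then have s1': "vars s1 ''q'' = q" "vars s1 ''n'' = n" "vars s1 ''d'' = d" "vars s1 ''N'' = 0"
        "arrs s1 = (\<lambda>_ _. 0)" "outp s1 = []" "vars s1 ''p'' = p"
      using sq by (auto simp: agree_def fun_eq_iff)
    show "runs W (prepare Qe Le) s1 (11 + 6 * n) (H.round_inv [])"
    proof (rule runs_mono[OF runs_prepare[where C = C and Q = Q and L = L and d = d and n = n] order_refl])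
      fix s2 :: state assume s2: "agree {''C'', ''Q'', ''L'', ''D'', ''Z'', ''go'', ''m'', ''z''} (vars s1) (vars s2) \<and>
        agree {''w''} (arrs s1) (arrs s2) \<and> outp s2 = outp s1 \<and>
        vars s2 ''C'' = C \<and> vars s2 ''Q'' = Q \<and> vars s2 ''L'' = L \<and> vars s2 ''D'' = C * Q + Q - C \<and> vars s2 ''Z'' = 2 * n \<and>
        vars s2 ''go'' = 1 \<and> vars s2 ''m'' = min n Q \<and> (\<forall>z<2 * n. arrs s2 ''w'' z = 1)"
      then have "H.fixed s2" "vars s2 ''N'' = 0" "arrs s2 ''K'' = (\<lambda>_. 0)" "outp s2 = []"
        using s1' by (simp_all add: H.fixed_def agree_def)
      moreover have "H.weighted [] (arrs s2 ''w'') (\<lambda>_. 0) P" if "H.block P" for P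
      proof -
        have one: "arrs s2 ''w'' (P + y) = 1" if "y < P" for y
          using s2 \<open>H.block P\<close> that by (auto simp: H.block_def)
        then show ?thesis by (simp add: H.weighted_def)
      qed
      ultimately show "H.round_inv [] s2" using s2
        by (simp add: H.round_inv_def H.outside_zero_def H.family_def rows_def)
    qed (use s1' wb Qe Le W C in auto)
  qed
  then obtain t1 s1 where t1: "exec W (find_prime ;; prepare Qe Le) s0 t1 s1" "t1 \<le> 2 * q + 2 + (11 + 6 * n)" "H.round_inv [] s1"
    unfolding runs_def by blast
  obtain t2 s2 N where t2: "exec W rounds s1 t2 s2" "length (outp s2) = N * n"
    "perfect_hash_family n q d (family_of_table n N (outp s2))" "0 < N" "N \<le> L * NM" "t2 \<le> 1 + 262 * (N * n)"
    using H.exec_rounds[OF t1(3)] by blast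
  obtain a b s' where ab: "exec W find_prime s0 a s'" "exec W (prepare Qe Le) s' b s1" "t1 = a + b"
    using t1(1) by (rule exec_SeqE)
  have "exec W (phf_prog Qe Le) s0 (1 + (a + (b + t2))) s2"
    unfolding phf_prog_def
    by (intro exec.CondTrue exec.Seq[OF ab(1)] exec.Seq[OF ab(2)] t2(1)) (use sq n d wb W in auto)
  moreover have "1 + (a + (b + t2)) \<le> 300 * (N * n)"
  proof -
    \<comment> \<open>The set-up time O(q + n) is charged to the output, which has at least
      \<open>n > q\<close> entries.\<close>
    have "1 * n \<le> N * n" using t2(4) by (intro mult_le_mono1) simp
    then show ?thesis using t2(6) t1(2) ab(3) n \<open>2 \<le> q\<close> by linarith
  qed
  ultimately show ?thesis using t2 unfolding W_def s0_def NM_def by blast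
qed

section \<open>The two instances of the program and the theorem\<close>

lemma choose_less:
  assumes "pairs d < real q"
  shows "d choose 2 < q"
  using assms by (simp flip: pairs_choose)

text \<open>The instance \<open>Q = q\<close>, \<open>L = 1\<close>; one program serves every range
  \<open>R\<close>. \<open>bound\<close> is asked only for \<open>d \<ge> 2\<close> and
  \<open>q < n\<close>, because otherwise a single function suffices, which the maximum with 1
  allows.\<close>

lemma linear_time_direct:
  assumes R: "\<And>n q d. R n q d \<Longrightarrow> 0 < n \<and> 0 < d \<and> primepow q \<and> pairs d < real q"
    and bound: "\<And>n q d. R n q d \<Longrightarrow> 2 \<le> d \<Longrightarrow> q < n \<Longrightarrow>
      14 * pairs d * ln (real n) / gain (real q / pairs d) \<le> c * f n q d"
  shows "linear_time_PHF R f"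
  unfolding linear_time_PHF_def
proof (rule exI[of _ "phf_prog (Var ''q'') (Const 1)"], rule exI[of _ 16], rule exI[of _ c], rule exI[of _ 300],
    intro allI impI)
  fix n q d assume Rn: "R n q d"
  from R[OF this] have n: "0 < n" and d: "0 < d" and pq: "primepow q" and C: "pairs d < real q" by auto
  obtain p e where p: "prime p" "0 < e" "q = p ^ e" using pq by (auto simp: primepow_def)
  have q2: "2 \<le> q" using primepow_gt_Suc_0[OF pq] by simp
  have dq: "d \<le> q"
  proof (cases "2 \<le> d")
    case True
    then show ?thesis using pairs_bounds(3)[OF True] choose_less[OF C] by (simp flip: pairs_choose)
  qed (use q2 in simp)
  show "\<exists>t s N. exec ((n + q) ^ 16) (phf_prog (Var ''q'') (Const 1)) (init_state n q d) t s \<and>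
      length (outp s) = N * n \<and> perfect_hash_family n q d (family_of_table n N (outp s)) \<and>
      real N \<le> max 1 (c * f n q d) \<and> t \<le> 300 * (N * n)"
  proof (cases "n \<le> q \<or> d = 1")
    case True
    from exec_phf_prog_trivial[OF True n d dq q2] obtain t s where
      "exec ((n + q) ^ 16) (phf_prog (Var ''q'') (Const 1)) (init_state n q d) t s \<and> length (outp s) = 1 * n \<and>
       perfect_hash_family n q d (family_of_table n 1 (outp s)) \<and> t \<le> 300 * (1 * n)" by blast
    then show ?thesis by (intro exI[of _ t] exI[of _ s] exI[of _ 1]) simp
  next
    case False
    then have d2: "2 \<le> d" and qn: "q < n" using d by auto
    have C2: "0 < d choose 2" "d choose 2 < q" using d2 choose_less[OF C] by auto
    have "\<exists>t s N. exec ((n + q) ^ 16) (phf_prog (Var ''q'') (Const 1)) (init_state n q d) t s \<and> length (outp s) = N * n \<and>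
      perfect_hash_family n q d (family_of_table n N (outp s)) \<and> N \<le> 1 * max_rounds n q (d choose 2) \<and> t \<le> 300 * (N * n)"
    proof (rule exec_phf_prog[OF qn d2 p(1,3,2) refl C2(2) p(3)])
      fix G x y assume G: "\<And>A. A < 1 \<Longrightarrow> hankel p e n (min n q) A (G A)" and xy: "x < min n q" "y < min n q" "x \<noteq> y"
      \<comment> \<open>A linear table is the identity below \<open>p ^ e = q\<close>, so nothing
        collides.\<close>
      have "G A x \<noteq> G A y" if "A < 1" for A
        using G[OF that] xy p(3) by (auto simp: hankel_def linear_on_def)
      then have "{A. A < 1 \<and> G A x = G A y} = {}" by auto
      then show "(d choose 2) * card {A. A < 1 \<and> G A x = G A y} < 1" by simp
    qed (use q2 in \<open>auto simp: power2_eq_square\<close>)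
    then obtain t s N where tsN: "exec ((n + q) ^ 16) (phf_prog (Var ''q'') (Const 1)) (init_state n q d) t s"
      "length (outp s) = N * n" "perfect_hash_family n q d (family_of_table n N (outp s))"
      "N \<le> max_rounds n q (d choose 2)" "t \<le> 300 * (N * n)" by auto
    have "real N \<le> real (max_rounds n q (d choose 2))" using tsN(4) by simp
    also have "\<dots> \<le> max 1 (14 * pairs d * ln (real n) / gain (real q / pairs d))"
      using max_rounds_le_real[OF C2 n] by (simp add: pairs_choose)
    also have "\<dots> \<le> max 1 (c * f n q d)" using bound[OF Rn d2 qn] by simp
    finally show ?thesis using tsN by blast
  qed
qed

text \<open>With \<open>Q = q\<close> the gap of 2 between \<open>q\<close> and
  \<open>pairs d\<close> would give only \<open>d ^ 6 * ln n\<close>; the instance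
  \<open>Q = q^2\<close>, \<open>L = q^2 / p\<close> gains the division by
  \<open>ln d\<close>.\<close>

lemma linear_time_smallest:
  "linear_time_PHF
     (\<lambda>n q d. 0 < n \<and> 0 < d \<and> primepow q \<and> real q = pairs d + 2)
     (\<lambda>n q d. real d ^ 6 * (ln (real n) / ln (real d)))"
  unfolding linear_time_PHF_def
proof (rule exI[of _ "phf_prog (Times (Var ''q'') (Var ''q'')) (Div (Times (Var ''q'') (Var ''q'')) (Var ''p''))"],
    rule exI[of _ 16], rule exI[of _ 112], rule exI[of _ 300], intro allI impI)
  fix n q d :: nat assume "0 < n \<and> 0 < d \<and> primepow q \<and> real q = pairs d + 2"
  then have n: "0 < n" and d: "0 < d" and pq: "primepow q" and qd: "real q = pairs d + 2" by auto
  let ?prog = "phf_prog (Times (Var ''q'') (Var ''q'')) (Div (Times (Var ''q'') (Var ''q'')) (Var ''p''))"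
  let ?f = "real d ^ 6 * (ln (real n) / ln (real d))"
  obtain p e where p: "prime p" "0 < e" "q = p ^ e" using pq by (auto simp: primepow_def)
  have p1: "1 < p" using p(1) by (rule prime_gt_1_nat)
  have q2: "2 \<le> q" using primepow_gt_Suc_0[OF pq] by simp
  have C: "d choose 2 < q" using qd by (intro choose_less) simp
  have dq: "d \<le> q"
  proof (cases "2 \<le> d")
    case True
    then show ?thesis using pairs_bounds(3)[OF True] C by (simp flip: pairs_choose)
  qed (use q2 in simp)
  show "\<exists>t s N. exec ((n + q) ^ 16) ?prog (init_state n q d) t s \<and>
      length (outp s) = N * n \<and> perfect_hash_family n q d (family_of_table n N (outp s)) \<and>
      real N \<le> max 1 (112 * ?f) \<and> t \<le> 300 * (N * n)"
  proof (cases "n \<le> q \<or> d = 1")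
    case True
    from exec_phf_prog_trivial[OF True n d dq q2] obtain t s where
      "exec ((n + q) ^ 16) ?prog (init_state n q d) t s \<and> length (outp s) = 1 * n \<and>
       perfect_hash_family n q d (family_of_table n 1 (outp s)) \<and> t \<le> 300 * (1 * n)" by blast
    then show ?thesis by (intro exI[of _ t] exI[of _ s] exI[of _ 1]) simp
  next
    case False
    then have d2: "2 \<le> d" and qn: "q < n" using d by auto
    \<comment> \<open>\<open>2 * e - 1\<close> digits fill a Hankel matrix with \<open>e\<close>
      rows and \<open>e\<close> columns, the columns \<open>e\<close> to \<open>2 * e - 1\<close> of
      a table on \<open>{..<q * q}\<close>.\<close>
    define L where "L = p ^ (2 * e - 1)"
    have QQ: "q * q = p ^ (2 * e)" by (simp add: p(3) mult_2 power_add)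
    have pL: "q * q = p * L" using p(2) by (simp add: QQ L_def flip: power_Suc)
    have L: "0 < L" "L \<le> q\<^sup>2" "q * q div p = L"
      using p1 pL by (auto simp: L_def power2_eq_square)
    have C0: "0 < d choose 2" "d choose 2 < q * q" using d2 C q2 by (auto intro: less_le_trans)
    have "\<exists>t s N. exec ((n + q) ^ 16) ?prog (init_state n q d) t s \<and> length (outp s) = N * n \<and>
      perfect_hash_family n q d (family_of_table n N (outp s)) \<and> N \<le> L * max_rounds n (q * q) (d choose 2) \<and>
      t \<le> 300 * (N * n)"
    proof (rule exec_phf_prog[OF qn d2 p(1,3,2) refl C QQ _ _ L(1,2)])
      fix G x y assume G: "\<And>A. A < L \<Longrightarrow> hankel p e n (min n (q * q)) A (G A)"
        and xy: "x < min n (q * q)" "y < min n (q * q)" "x \<noteq> y"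
      have "card {A. A < L \<and> G A x = G A y} \<le> p ^ (e - 1)"
        unfolding L_def
      proof (rule hankel_collisions[OF p(1,2) _ _ _ xy(3,1,2)])
        show "min n (q * q) \<le> p ^ (2 * e)" by (simp add: QQ)
        show "linear_on p e n (min n (q * q)) (G A)" if "A < p ^ (2 * e - 1)" for A
          using G[of A] that by (simp add: hankel_def L_def)
        show "G A (p ^ (e + i)) = A div p ^ i mod p ^ e"
          if "A < p ^ (2 * e - 1)" "p ^ (e + i) < min n (q * q)" for A i
          using G[of A] that by (simp add: hankel_def L_def)
      qed
      then have "(d choose 2) * card {A. A < L \<and> G A x = G A y} \<le> (d choose 2) * p ^ (e - 1)" by simp
      \<comment> \<open>The collision share \<open>p ^ (e - 1) / L = 1 / q\<close> is below
        \<open>1 / C\<close> because \<open>C < q\<close>.\<close>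
      also have "\<dots> < q * p ^ (e - 1)" using C p1 by simp
      also have "\<dots> = L"
      proof -
        have "e + (e - 1) = 2 * e - 1" using p(2) by simp
        then show ?thesis by (simp add: p(3) L_def flip: power_add)
      qed
      finally show "(d choose 2) * card {A. A < L \<and> G A x = G A y} < L" .
    qed (use q2 L(3) in \<open>auto simp: power2_eq_square\<close>)
    then obtain t s N where tsN: "exec ((n + q) ^ 16) ?prog (init_state n q d) t s"
      "length (outp s) = N * n" "perfect_hash_family n q d (family_of_table n N (outp s))"
      "N \<le> L * max_rounds n (q * q) (d choose 2)" "t \<le> 300 * (N * n)" by auto
    have "real N \<le> real L * real (max_rounds n (q * q) (d choose 2))"
      using tsN(4) unfolding of_nat_mult[symmetric] of_nat_le_iff .
    also have "\<dots> \<le> real (q * q) * max 1 (14 * pairs d * ln (real n) / gain (real (q * q) / pairs d))"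
    proof (rule mult_mono)
      show "real L \<le> real (q * q)" using L(2) unfolding of_nat_le_iff power2_eq_square .
      show "real (max_rounds n (q * q) (d choose 2)) \<le> max 1 (14 * pairs d * ln (real n) / gain (real (q * q) / pairs d))"
        using max_rounds_le_real[OF C0 n] unfolding pairs_choose .
    qed auto
    also have "\<dots> \<le> 112 * ?f" by (rule bound_smallest[OF d2 qd qn])
    finally have "real N \<le> max 1 (112 * ?f)" by simp
    then show ?thesis using tsN by blast
  qed
qed

lemma pairs_nonneg: "0 \<le> pairs d"
  unfolding pairs_choose[symmetric] by simp

lemma pairs_less_square: "0 < d \<Longrightarrow> pairs d < (real d)\<^sup>2 / 2"
  by (simp add: pairs_def power2_eq_square algebra_simps)

theorem theorem1:
  shows
    "linear_time_PHF
       (\<lambda>n q d. 0 < n \<and> 0 < d \<and> primepow q \<and>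
          real q > 4 * (real d * (real d - 1) / 2 + 1))
       (\<lambda>n q d. (real d)\<^sup>2 * ln (real n) /
          ln (real q / (exp 1 * (real d * (real d - 1) / 2 + 1)))) \<and>
     linear_time_PHF
       (\<lambda>n q d. 0 < n \<and> 0 < d \<and> primepow q \<and>
          real d * (real d - 1) / 2 + 2 \<le> real q \<and>
          real q \<le> 4 * (real d * (real d - 1) / 2 + 1))
       (\<lambda>n q d. (real q)\<^sup>2 * (real d)\<^sup>2 * ln (real n) /
          (real q - real d * (real d - 1) / 2 - 1)\<^sup>2) \<and>
     (\<forall>\<delta>::real. \<delta> > 0 \<longrightarrow> linear_time_PHF
       (\<lambda>n q d. 0 < n \<and> 0 < d \<and> primepow q \<and> real q \<ge> real d powr (2 + \<delta>))
       (\<lambda>n q d. (real d)\<^sup>2 * (ln (real n) / ln (real q)))) \<and>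
     (\<forall>c::real. c > 1 \<longrightarrow> linear_time_PHF
       (\<lambda>n q d. 0 < n \<and> 0 < d \<and> primepow q \<and> real q \<ge> c / 2 * (real d)\<^sup>2)
       (\<lambda>n q d. (real d)\<^sup>2 * ln (real n))) \<and>
     (\<forall>\<eta>::real. 0 \<le> \<eta> \<and> \<eta> < 1 \<longrightarrow> linear_time_PHF
       (\<lambda>n q d. 0 < n \<and> 0 < d \<and> primepow q \<and>
          real q = real d * (real d - 1) / 2 + 1 + real d powr (2 * \<eta>))
       (\<lambda>n q d. real d powr (6 - 4 * \<eta>) * ln (real n))) \<and>
     linear_time_PHF
       (\<lambda>n q d. 0 < n \<and> 0 < d \<and> primepow q \<and>
          real q = real d * (real d - 1) / 2 + 2)
       (\<lambda>n q d. (real d) ^ 6 * (ln (real n) / ln (real d)))"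
  unfolding pairs_def[symmetric]
proof (intro conjI allI impI, goal_cases)
  case 1
  show ?case
  proof (rule linear_time_direct[where c = 7])
    fix n q d :: nat assume *: "0 < n \<and> 0 < d \<and> primepow q \<and> real q > 4 * (pairs d + 1)"
    then have "4 * (pairs d + 1) < real q" by blast
    moreover have "pairs d \<le> 4 * (pairs d + 1)" using pairs_nonneg[of d] by simp
    ultimately have "pairs d < real q" by (rule le_less_trans[rotated])
    then show "0 < n \<and> 0 < d \<and> primepow q \<and> pairs d < real q" using * by blast
    assume "2 \<le> d" "q < n"
    then show "14 * pairs d * ln (real n) / gain (real q / pairs d)
        \<le> 7 * ((real d)\<^sup>2 * ln (real n) / ln (real q / (exp 1 * (pairs d + 1))))"
      using * by (intro bound_large_alphabet) auto
  qed
next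
  case 2
  show ?case
  proof (rule linear_time_direct[where c = 14])
    fix n q d :: nat assume *: "0 < n \<and> 0 < d \<and> primepow q \<and> pairs d + 2 \<le> real q \<and> real q \<le> 4 * (pairs d + 1)"
    then have "pairs d + 2 \<le> real q" by blast
    then have "pairs d < real q" by linarith
    then show "0 < n \<and> 0 < d \<and> primepow q \<and> pairs d < real q" using * by blast
    assume "2 \<le> d" "q < n"
    then show "14 * pairs d * ln (real n) / gain (real q / pairs d)
        \<le> 14 * ((real q)\<^sup>2 * (real d)\<^sup>2 * ln (real n) / (real q - pairs d - 1)\<^sup>2)"
      using * by (intro bound_quadratic') auto
  qed
next
  case (3 \<delta>)
  show ?case
  proof (rule linear_time_direct[where c = "112 * (2 + \<delta>) / \<delta>"])
    fix n q d :: nat assume *: "0 < n \<and> 0 < d \<and> primepow q \<and> real q \<ge> real d powr (2 + \<delta>)"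
    then have "real d powr 2 \<le> real d powr (2 + \<delta>)" using 3 by (intro powr_mono) auto
    also have "\<dots> \<le> real q" using * by blast
    finally have "(real d)\<^sup>2 \<le> real q" using * by (simp add: powr_numeral)
    moreover have "pairs d < (real d)\<^sup>2 / 2" using * by (intro pairs_less_square) blast
    ultimately have "pairs d < real q" using zero_le_power2[of "real d"] by linarith
    then show "0 < n \<and> 0 < d \<and> primepow q \<and> pairs d < real q" using * by blast
    assume "2 \<le> d" "q < n"
    then show "14 * pairs d * ln (real n) / gain (real q / pairs d)
        \<le> 112 * (2 + \<delta>) / \<delta> * ((real d)\<^sup>2 * (ln (real n) / ln (real q)))"
      using * 3 by (intro bound_power) auto
  qed
next
  case (4 c)
  show ?case
  proof (rule linear_time_direct[where c = "14 / (1 - 1 / c)\<^sup>2"])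
    fix n q d :: nat assume *: "0 < n \<and> 0 < d \<and> primepow q \<and> real q \<ge> c / 2 * (real d)\<^sup>2"
    have "1 * (real d)\<^sup>2 \<le> c * (real d)\<^sup>2" using 4 by (intro mult_right_mono) auto
    then have "(real d)\<^sup>2 / 2 \<le> c / 2 * (real d)\<^sup>2" by simp
    moreover have "pairs d < (real d)\<^sup>2 / 2" using * by (intro pairs_less_square) blast
    moreover have "c / 2 * (real d)\<^sup>2 \<le> real q" using * by blast
    ultimately have "pairs d < real q" by linarith
    then show "0 < n \<and> 0 < d \<and> primepow q \<and> pairs d < real q" using * by blast
    assume "2 \<le> d" "q < n"
    then show "14 * pairs d * ln (real n) / gain (real q / pairs d)
        \<le> 14 / (1 - 1 / c)\<^sup>2 * ((real d)\<^sup>2 * ln (real n))"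
      using * 4 by (intro bound_proportional) auto
  qed
next
  case (5 \<eta>)
  show ?case
  proof (rule linear_time_direct[where c = 126])
    fix n q d :: nat assume *: "0 < n \<and> 0 < d \<and> primepow q \<and> real q = pairs d + 1 + real d powr (2 * \<eta>)"
    then have "real q = pairs d + 1 + real d powr (2 * \<eta>)" by blast
    then have "pairs d < real q" using powr_ge_zero[of "real d" "2 * \<eta>"] by linarith
    then show "0 < n \<and> 0 < d \<and> primepow q \<and> pairs d < real q" using * by blast
    assume "2 \<le> d" "q < n"
    then show "14 * pairs d * ln (real n) / gain (real q / pairs d)
        \<le> 126 * (real d powr (6 - 4 * \<eta>) * ln (real n))"
      using * 5 by (intro bound_near) auto
  qed
next
  case 6
  show ?case by (rule linear_time_smallest)
qed

end
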